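(* Let $d\geq 3$, $r\geq 1$, $n\geq 1$ be integers, and for an $r$-dimensional linear subspace $\ell\subset\mathbb{P}^n$ set $H_\ell:=\{[F]\in\mathbb{P}(\mathrm{Sym}^d\mathbb{C}^{n+1})^* : V(F)\text{ is tangent to }\ell\}$. Then $$\mathcal{S}_{d,r}=\bigcap_{\ell\subset\mathbb{P}^n}H_\ell,$$ where the intersection runs over all linear spaces $\ell\subset\mathbb{P}^n$ of dimension $r$.
   Context: Points of $\mathbb{P}(\mathrm{Sym}^d\mathbb{C}^{n+1})^*$ are classes $[F]$ of nonzero homogeneous polynomials $F\in\mathbb{C}[x_0,\dots,x_n]$ of degree $d$ (identified with symmetric tensors). $\mathrm{Sing}(F)=\{[x]\in\mathbb{P}^n:\frac{\partial F}{\partial x_0}(x)=\cdots=\frac{\partial F}{\partial x_n}(x)=0\}$, and the symmetric geometric rank is $\mathrm{sgr}(F)=\mathrm{codim}_{\mathbb{P}^n}\mathrm{Sing}(F)$ (the empty set having codimension $n+1$). $\mathcal{S}_{d,r}=\{[F]\in\mathbb{P}(\mathrm{Sym}^d\mathbb{C}^{n+1})^* : \mathrm{sgr}(F)\leq r\}$. $V(F)\subset\mathbb{P}^n$ is the (possibly non-reduced) hypersurface defined by $F$. $V(F)$ is tangent to a linear space $\ell$ if there is a point $p\in V(F)\cap\ell$ at which the restriction $F|_\ell$ vanishes together with all its first-order partial derivatives along $\ell$ (equivalently, $p$ is a singular point of $V(F)$ or $\ell$ is contained in the tangent hyperplane to $V(F)$ at $p$). *)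

theory Defs
  imports "HOL-Analysis.Analysis" "HOL-Library.Poly_Mapping" "HOL-Library.Extended_Nat"
begin

section \<open>Projectivization\<close>

text \<open>
  The class of a nonzero vector is the set of its nonzero multiples; a point of a projective
  space is such a set. The scaling \<open>s\<close> is a parameter because the construction is used both
  for \<open>\<complex>\<^sup>n\<^sup>+\<^sup>1\<close> and for the space of homogeneous polynomials.
\<close>

definition proj_class :: "('k::zero \<Rightarrow> 'v \<Rightarrow> 'v) \<Rightarrow> 'v \<Rightarrow> 'v set" where
  "proj_class s v = {s c v |c. c \<noteq> 0}"

definition projectivization :: "('k::zero \<Rightarrow> 'v \<Rightarrow> 'v) \<Rightarrow> 'v::zero set \<Rightarrow> 'v set set" where
  "projectivization s V = {proj_class s v |v. v \<in> V \<and> v \<noteq> 0}"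

text \<open>
  Projective \<open>n\<close>-space is modelled on \<open>complex ^ 'n\<close> with \<open>CARD('n) = n + 1\<close>.
\<close>

type_synonym 'n point = "(complex ^ 'n) set"

definition proj_space :: "('n::finite) point set" where
  "proj_space = projectivization (*s) UNIV"

definition proj_linear_subspace :: "nat \<Rightarrow> ('n::finite) point set \<Rightarrow> bool" where
  "proj_linear_subspace r l \<longleftrightarrow>
     (\<exists>W. vec.subspace W \<and> vec.dim W = r + 1 \<and> l = projectivization (*s) W)"


section \<open>Homogeneous polynomials\<close>

type_synonym 'n mpoly = "('n \<Rightarrow>\<^sub>0 nat) \<Rightarrow>\<^sub>0 complex"

definition homogeneous :: "nat \<Rightarrow> ('n::finite) mpoly \<Rightarrow> bool" where
  "homogeneous d F \<longleftrightarrow>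
     (\<forall>m \<in> Poly_Mapping.keys F. (\<Sum>i\<in>UNIV. Poly_Mapping.lookup m i) = d)"

definition mp_eval :: "('n::finite) mpoly \<Rightarrow> complex ^ 'n \<Rightarrow> complex" where
  "mp_eval F x =
     (\<Sum>m \<in> Poly_Mapping.keys F.
        Poly_Mapping.lookup F m * (\<Prod>i\<in>UNIV. (x $ i) ^ Poly_Mapping.lookup m i))"

text \<open>
  Monomials in which \<open>x\<^sub>i\<close> does not occur get the coefficient \<open>0\<close>, so the truncated
  subtraction of exponents does no harm.
\<close>

definition mp_deriv :: "'n \<Rightarrow> ('n::finite) mpoly \<Rightarrow> 'n mpoly" where
  "mp_deriv i F =
     (\<Sum>m \<in> Poly_Mapping.keys F.
        Poly_Mapping.single (m - Poly_Mapping.single i 1)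
          (of_nat (Poly_Mapping.lookup m i) * Poly_Mapping.lookup F m))"

definition mp_scale :: "complex \<Rightarrow> ('n::finite) mpoly \<Rightarrow> 'n mpoly" where
  "mp_scale c F = Poly_Mapping.map ((*) c) F"

definition proj_forms :: "nat \<Rightarrow> ('n::finite) mpoly set set" where
  "proj_forms d = projectivization mp_scale {F. homogeneous d F}"


section \<open>Zariski topology and codimension\<close>

definition hypersurface :: "('n::finite) mpoly \<Rightarrow> 'n point set" where
  "hypersurface F = {p \<in> proj_space. \<forall>x\<in>p. mp_eval F x = 0}"

text \<open>
  The complements of hypersurfaces form a basis of the Zariski topology, being closed under
  finite intersections.
\<close>

definition zariski :: "('n::finite) point topology" where
  "zariski = topology_generated_by {proj_space - hypersurface F |F d. homogeneous d F}"

definition irreducible_space :: "'a topology \<Rightarrow> bool" where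
  "irreducible_space X \<longleftrightarrow>
     topspace X \<noteq> {} \<and>
     (\<forall>A B. closedin X A \<and> closedin X B \<and> A \<union> B = topspace X
        \<longrightarrow> A = topspace X \<or> B = topspace X)"

text \<open>
  Supremum of the lengths \<open>m\<close> of chains \<open>Z\<^sub>0 \<subset> \<dots> \<subset> Z\<^sub>m\<close> of irreducible closed subsets.
  Its value \<open>0\<close> on the empty space is not meaningful.
\<close>

definition krull_dim :: "'a topology \<Rightarrow> enat" where
  "krull_dim X =
     Sup {enat m |m. \<exists>Z :: nat \<Rightarrow> 'a set.
        (\<forall>i\<le>m. closedin X (Z i) \<and> irreducible_space (subtopology X (Z i))) \<and>
        (\<forall>i<m. Z i \<subset> Z (Suc i))}"

definition proj_codim :: "('n::finite) point set \<Rightarrow> enat" where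
  "proj_codim S =
     (if S = {} then enat CARD('n)
      else enat (CARD('n) - 1) - krull_dim (subtopology zariski S))"


section \<open>Symmetric geometric rank and tangency\<close>

definition Sing :: "('n::finite) mpoly \<Rightarrow> 'n point set" where
  "Sing F = {p \<in> proj_space. \<forall>x\<in>p. \<forall>i. mp_eval (mp_deriv i F) x = 0}"

definition sgr :: "('n::finite) mpoly \<Rightarrow> enat" where
  "sgr F = proj_codim (Sing F)"

definition sgr_locus :: "nat \<Rightarrow> nat \<Rightarrow> ('n::finite) mpoly set set" where
  "sgr_locus d r =
     {proj_class mp_scale F |F. F \<noteq> 0 \<and> homogeneous d F \<and> sgr F \<le> enat r}"

text \<open>
  For \<open>l = \<P>(W)\<close> the set \<open>\<Union>l\<close> is \<open>W - {0}\<close>, so \<open>w\<close> ranges over the directions along which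
  the restriction of \<open>F\<close> to \<open>W\<close> can be differentiated.
\<close>

definition tangent_to :: "('n::finite) mpoly \<Rightarrow> 'n point set \<Rightarrow> bool" where
  "tangent_to F l \<longleftrightarrow>
     (\<exists>p \<in> hypersurface F \<inter> l. \<forall>x\<in>p. \<forall>w\<in>\<Union>l.
        ((\<lambda>t. mp_eval F (x + t *s w)) has_field_derivative 0) (at 0))"

definition tangent_locus :: "nat \<Rightarrow> ('n::finite) point set \<Rightarrow> 'n mpoly set set" where
  "tangent_locus d l =
     {proj_class mp_scale F |F. F \<noteq> 0 \<and> homogeneous d F \<and> tangent_to F l}"

end

theory Submission
  imports Defs "HOL-Library.Function_Algebras" "HOL-Computational_Algebra.Fundamental_Theorem_Algebra"
begin

text \<open>
  Let \<open>X\<close> be the cone of nonzero \<open>x\<close> at which all partial derivatives of \<open>F\<close> vanish, let \<open>N = n + 1\<close>,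
  and call a cone \<open>k\<close>-thick if it meets every linear subspace cut out by \<open>k\<close> linear forms. For
  \<open>r \<le> n\<close> both sides of the theorem say that \<open>X\<close> is \<open>(n - r)\<close>-thick; for \<open>r > n\<close> every rank is at
  most \<open>N \<le> r\<close> and there are no linear spaces \<open>l\<close> to test.

  \<^emph>\<open>Thickness is dimension\<close> (\<open>thick_iff_krull_dim\<close>). A chain of \<open>k + 1\<close> irreducible cones gives, by
  choosing forms that vanish on one member but not on the next, about \<open>e^k\<close> independent forms of
  degree \<open>e\<close> on the top member. If that member missed the common zeros of \<open>k\<close> linear forms, the
  Nullstellensatz would express every form of high degree on it through these linear forms, and only
  about \<open>e^(k-1)\<close> independent ones could exist (\<open>irreducible_chain_meets_linear_section\<close>).
  Conversely, a minimal \<open>k\<close>-thick cone exists by compactness of the unit sphere. It is irreducible,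
  because a cone that misses one linear section misses almost all of them, so that two cones
  which are not thick miss a common section. Cutting it by a hyperplane that does not contain it
  leaves a smaller \<open>(k-1)\<close>-thick cone, and induction builds the chain
  (\<open>thick_imp_irreducible_chain\<close>).

  \<^emph>\<open>Thickness is tangency\<close> (\<open>sgr_le_iff_tangent_to_all\<close>). A point of \<open>X\<close> on \<open>l\<close> is a point of tangency,
  and a thick \<open>X\<close> meets every \<open>l\<close> of dimension \<open>r\<close>. If \<open>X\<close> is not thick, it misses some section and then
  all nearby ones. Among these there is one to which \<open>V(F)\<close> is not tangent, by a Bertini argument: for
  a subspace \<open>W\<close>, the hyperplanes \<open>h\<close> for which \<open>F\<close> restricted to \<open>W \<inter> ker h\<close> has a singular point that
  is not already singular on \<open>W\<close> form the image of the null set \<open>{F = 0}\<close> under a differentiable map,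
  hence a null set (\<open>tangent_hyperplanes_negligible\<close>). Cutting successively by hyperplanes close to those
  that miss \<open>X\<close> and outside these null sets gives \<open>l\<close> (\<open>exists_transversal_linear_section\<close>).

  Polynomials are handled as functions on \<open>complex ^ 'n\<close>; projective sets are handled as
  the cones of their nonzero representatives.
\<close>

section \<open>Forms as functions\<close>

definition fscale :: "complex \<Rightarrow> ('a \<Rightarrow> complex) \<Rightarrow> 'a \<Rightarrow> complex" where
  "fscale c f = (\<lambda>x. c * f x)"

lemma fscale_apply: "fscale c f x = c * f x"
  by (simp add: fscale_def)

interpretation fv: vector_space fscale
  by unfold_locales (auto simp: fun_eq_iff fscale_apply algebra_simps)

lemma sum_fun_apply [simp]: "(\<Sum>i\<in>A. f i) x = (\<Sum>i\<in>A. f i x)"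
  by (induction A rule: infinite_finite_induct) auto

lemma power_fun_apply [simp]: "(f ^ k) x = f x ^ k" for f :: "'a \<Rightarrow> 'b::monoid_mult"
  by (induction k) auto

lemma fv_span_mult:
  assumes "f \<in> fv.span A" "g \<in> fv.span B" "\<And>a b. a \<in> A \<Longrightarrow> b \<in> B \<Longrightarrow> a * b \<in> fv.span C"
  shows "f * g \<in> fv.span C"
proof -
  have 1: "a * g \<in> fv.span C" if "a \<in> A" for a
    using assms(2)
  proof (induction rule: fv.span_induct_alt)
    case base
    have "a * 0 \<in> fv.span C" by (simp add: fv.span_zero)
    then show ?case .
  next
    case (step c x y)
    have "a * (fscale c x + y) = fscale c (a * x) + a * y"
      by (auto simp: fun_eq_iff fscale_apply algebra_simps)
    moreover have "fscale c (a * x) + a * y \<in> fv.span C"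
      by (rule fv.span_add[OF fv.span_scale[OF assms(3)] step(2)]) (use step that in auto)
    ultimately show ?case by (simp only:)
  qed
  show ?thesis using assms(1)
  proof (induction rule: fv.span_induct_alt)
    case base
    have "0 * g \<in> fv.span C" by (simp add: fv.span_zero)
    then show ?case .
  next
    case (step c x y)
    have "(fscale c x + y) * g = fscale c (x * g) + y * g"
      by (auto simp: fun_eq_iff fscale_apply algebra_simps)
    moreover have "fscale c (x * g) + y * g \<in> fv.span C"
      by (rule fv.span_add[OF fv.span_scale[OF 1] step(2)]) (use step in auto)
    ultimately show ?case by (simp only:)
  qed
qed

text \<open>
  The family may repeat vectors, so that it can be applied to values of an arbitrary choice of
  representatives: a repetition is itself a relation.
\<close>

lemma dependent_of_card_gt:
  fixes a :: "'t \<Rightarrow> 'a \<Rightarrow> complex"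
  assumes "finite B" "finite T" "card T > card B" "\<And>t. t \<in> T \<Longrightarrow> a t \<in> fv.span B"
  shows "\<exists>u. (\<exists>t\<in>T. u t \<noteq> 0) \<and> (\<forall>x. (\<Sum>t\<in>T. u t * a t x) = 0)"
proof (cases "inj_on a T")
  case True
  have "fv.dependent (a ` T)"
  proof (rule ccontr)
    assume "\<not> fv.dependent (a ` T)"
    then have "card (a ` T) \<le> card B"
      using fv.independent_span_bound[OF assms(1), of "a ` T"] assms(4) by blast
    then show False using assms(3) True by (simp add: card_image)
  qed
  then obtain u where u: "\<exists>v\<in>a ` T. u v \<noteq> 0" "(\<Sum>v\<in>a ` T. fscale (u v) v) = 0"
    using fv.dependent_finite[of "a ` T"] assms(2) by auto
  have "(\<Sum>t\<in>T. u (a t) * a t x) = 0" for x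
  proof -
    have "(\<Sum>v\<in>a ` T. fscale (u v) v) x = (\<Sum>t\<in>T. u (a t) * a t x)"
      by (simp add: fscale_apply sum.reindex[OF True])
    then show ?thesis using u(2) by simp
  qed
  then show ?thesis using u(1) by (intro exI[of _ "u \<circ> a"]) auto
next
  case False
  then obtain s t where st: "s \<in> T" "t \<in> T" "s \<noteq> t" "a s = a t" by (auto simp: inj_on_def)
  define u where "u = (\<lambda>r. if r = s then 1 else if r = t then -1 else (0::complex))"
  have "(\<Sum>r\<in>T. u r * a r x) = 0" for x
  proof -
    have "(\<Sum>r\<in>T. u r * a r x) = (\<Sum>r\<in>{s,t}. u r * a r x)"
      using st assms(2) by (intro sum.mono_neutral_right) (auto simp: u_def)
    also have "\<dots> = 0" using st by (simp add: u_def)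
    finally show ?thesis .
  qed
  then show ?thesis using st by (intro exI[of _ u]) (auto simp: u_def)
qed

definition mfun :: "('n::finite \<Rightarrow> nat) \<Rightarrow> complex ^ 'n \<Rightarrow> complex" where
  "mfun m x = (\<Prod>i\<in>UNIV. (x $ i) ^ m i)"

definition exps :: "nat \<Rightarrow> ('n::finite \<Rightarrow> nat) set" where
  "exps d = {m. sum m UNIV = d}"

definition forms :: "nat \<Rightarrow> (complex ^ 'n::finite \<Rightarrow> complex) set" where
  "forms d = fv.span (mfun ` exps d)"

definition polys :: "(complex ^ 'n::finite \<Rightarrow> complex) set" where
  "polys = fv.span (range mfun)"

lemma finite_exps: "finite (exps d :: ('n::finite \<Rightarrow> nat) set)"
proof (rule finite_subset)
  show "exps d \<subseteq> (PiE UNIV (\<lambda>_. {..d}) :: ('n \<Rightarrow> nat) set)"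
  proof (clarsimp simp: exps_def PiE_def Pi_def)
    fix m :: "'n \<Rightarrow> nat" and i
    show "m i \<le> sum m UNIV" by (rule member_le_sum) auto
  qed
  show "finite (PiE UNIV (\<lambda>_. {..d}) :: ('n \<Rightarrow> nat) set)" by (intro finite_PiE) auto
qed

lemma mfun_add: "mfun m * mfun m' = mfun (\<lambda>i. m i + m' i)"
  by (auto simp: fun_eq_iff mfun_def power_add prod.distrib)

lemma forms_induct [consumes 1, case_names zero step]:
  assumes "f \<in> forms d" "P 0"
    "\<And>c m g. m \<in> exps d \<Longrightarrow> g \<in> forms d \<Longrightarrow> P g \<Longrightarrow> P (fscale c (mfun m) + g)"
  shows "P f"
proof -
  have "f \<in> forms d \<and> P f"
    using assms(1) unfolding forms_def
  proof (induction rule: fv.span_induct_alt)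
    case base
    show ?case by (rule conjI[OF fv.span_zero assms(2)])
  next
    case (step c x y)
    then obtain m where m: "m \<in> exps d" "x = mfun m" by blast
    have "fscale c x + y \<in> fv.span (mfun ` exps d)"
      by (rule fv.span_add[OF fv.span_scale[OF fv.span_base]]) (use step in auto)
    moreover have "P (fscale c x + y)"
      unfolding m(2) by (rule assms(3)) (use step m in \<open>auto simp: forms_def\<close>)
    ultimately show ?case by (rule conjI)
  qed
  then show ?thesis by (rule conjunct2)
qed

lemma polys_induct [consumes 1, case_names zero step]:
  assumes "f \<in> polys" "P 0"
    "\<And>c m g. g \<in> polys \<Longrightarrow> P g \<Longrightarrow> P (fscale c (mfun m) + g)"
  shows "P f"
proof -
  have "f \<in> polys \<and> P f"
    using assms(1) unfolding polys_def
  proof (induction rule: fv.span_induct_alt)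
    case base
    show ?case by (rule conjI[OF fv.span_zero assms(2)])
  next
    case (step c x y)
    then obtain m where m: "x = mfun m" by blast
    have "fscale c x + y \<in> fv.span (range mfun)"
      by (rule fv.span_add[OF fv.span_scale[OF fv.span_base]]) (use step in auto)
    moreover have "P (fscale c x + y)"
      unfolding m by (rule assms(3)) (use step m in \<open>auto simp: polys_def\<close>)
    ultimately show ?case by (rule conjI)
  qed
  then show ?thesis by (rule conjunct2)
qed

lemma forms_0 [simp]: "0 \<in> forms d"
  by (simp add: forms_def fv.span_zero)
lemma forms_0' [simp]: "(\<lambda>x. 0) \<in> forms d"
  using forms_0[of d] by (simp only: zero_fun_def)
lemma forms_add: "f \<in> forms d \<Longrightarrow> g \<in> forms d \<Longrightarrow> f + g \<in> forms d"
  by (simp add: forms_def fv.span_add)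
lemma forms_diff: "f \<in> forms d \<Longrightarrow> g \<in> forms d \<Longrightarrow> f - g \<in> forms d"
  by (simp add: forms_def fv.span_diff)
lemma forms_scale: "f \<in> forms d \<Longrightarrow> fscale c f \<in> forms d"
  by (simp add: forms_def fv.span_scale)
lemma forms_sum: "(\<And>i. i \<in> A \<Longrightarrow> f i \<in> forms d) \<Longrightarrow> sum f A \<in> forms d"
  by (simp add: forms_def fv.span_sum)
lemma mfun_forms: "m \<in> exps d \<Longrightarrow> mfun m \<in> forms d"
  by (simp add: forms_def fv.span_base)

lemma forms_mult: "f \<in> forms d \<Longrightarrow> g \<in> forms e \<Longrightarrow> f * g \<in> forms (d + e)"
  unfolding forms_def
  by (erule (1) fv_span_mult) (auto simp: mfun_add exps_def sum.distrib intro!: fv.span_base)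

lemma forms_const: "(\<lambda>x. c) \<in> forms 0"
proof -
  have "fscale c (mfun (\<lambda>_. 0)) \<in> forms 0"
    by (intro forms_scale mfun_forms) (simp add: exps_def)
  then show ?thesis by (simp add: fscale_def mfun_def)
qed

lemma forms_1: "1 \<in> forms 0"
  using forms_const[of 1] by (simp add: one_fun_def)

lemma forms_power: "f \<in> forms d \<Longrightarrow> f ^ k \<in> forms (d * k)"
  by (induction k) (auto simp: forms_1 forms_mult)

lemma forms_coord: "(\<lambda>x. x $ i) \<in> forms 1"
proof -
  have "mfun (\<lambda>j. if j = i then 1 else 0) = (\<lambda>x::complex^'a. x $ i)"
    by (auto simp: fun_eq_iff mfun_def if_distrib[of "\<lambda>k. _ ^ k"] cong: if_cong)
  moreover have "(\<lambda>j. if j = i then 1 else 0) \<in> exps 1" by (simp add: exps_def)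
  ultimately show ?thesis by (metis mfun_forms)
qed

definition lform :: "complex ^ 'n::finite \<Rightarrow> complex ^ 'n \<Rightarrow> complex" where
  "lform h x = (\<Sum>i\<in>UNIV. h $ i * x $ i)"

lemma forms_lform: "lform h \<in> forms 1"
proof -
  have "lform h = (\<Sum>i\<in>UNIV. fscale (h $ i) (\<lambda>x. x $ i))"
    by (auto simp: fscale_apply fun_eq_iff lform_def)
  then show ?thesis by (simp only:) (intro forms_sum forms_scale forms_coord)
qed

lemma lform_add_left: "lform (g + h) x = lform g x + lform h x"
  and lform_add_right: "lform h (x + y) = lform h x + lform h y"
  and lform_diff_left: "lform (g - h) x = lform g x - lform h x"
  and lform_diff_right: "lform h (x - y) = lform h x - lform h y"
  and lform_scale_left: "lform (c *s h) x = c * lform h x"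
  and lform_scale_right: "lform h (c *s x) = c * lform h x"
  by (simp_all add: lform_def algebra_simps sum.distrib sum_subtractf sum_distrib_left)

lemma lform_zero [simp]: "lform 0 x = 0" "lform h 0 = 0"
  by (simp_all add: lform_def)

lemma lform_sum_right: "lform h (\<Sum>i\<in>A. f i) = (\<Sum>i\<in>A. lform h (f i))"
  by (induction A rule: infinite_finite_induct) (auto simp: lform_add_right)

lemma lform_axis [simp]: "lform (axis i c) x = c * x $ i" "lform h (axis i c) = c * h $ i"
  by (simp_all add: lform_def axis_def if_distrib[of "\<lambda>k. k * _"] if_distrib[of "\<lambda>k. _ * k"] cong: if_cong)

lemma forms_homogeneous: "f \<in> forms d \<Longrightarrow> f (c *s x) = c ^ d * f x"
proof (induction rule: forms_induct)
  case zero
  show ?case by simp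
next
  case (step k m h)
  have "mfun m (c *s x) = c ^ d * mfun m x"
    using step(1) by (auto simp: mfun_def power_mult_distrib prod.distrib exps_def power_sum)
  then show ?case using step by (simp add: fscale_apply algebra_simps)
qed

lemma forms_polys: "forms d \<subseteq> polys"
  unfolding forms_def polys_def by (intro fv.span_mono) auto

lemma polys_add: "f \<in> polys \<Longrightarrow> g \<in> polys \<Longrightarrow> f + g \<in> polys"
  by (simp add: polys_def fv.span_add)
lemma polys_diff: "f \<in> polys \<Longrightarrow> g \<in> polys \<Longrightarrow> f - g \<in> polys"
  by (simp add: polys_def fv.span_diff)
lemma polys_mult: "f \<in> polys \<Longrightarrow> g \<in> polys \<Longrightarrow> f * g \<in> polys"
  unfolding polys_def by (erule (1) fv_span_mult) (auto simp: mfun_add intro!: fv.span_base)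
lemma polys_const: "(\<lambda>x. c) \<in> polys" using forms_const forms_polys by blast
lemma polys_1: "1 \<in> polys" using forms_1 forms_polys by blast
lemma polys_0: "0 \<in> polys" using forms_0 forms_polys by blast
lemma polys_coord: "(\<lambda>x. x $ i) \<in> polys" using forms_coord forms_polys by blast
lemma polys_lform: "lform h \<in> polys" using forms_lform forms_polys by blast
lemma polys_power: "f \<in> polys \<Longrightarrow> f ^ k \<in> polys"
  by (induction k) (auto simp: polys_1 polys_mult)

lemma polys_decompose:
  assumes "f \<in> polys"
  shows "\<exists>D g. (\<forall>d. g d \<in> forms d) \<and> f = (\<Sum>d\<le>D. g d)"
  using assms
proof (induction rule: polys_induct)
  case zero
  have "(\<forall>d. (0::complex^'a \<Rightarrow> complex) \<in> forms d) \<and> 0 = (\<Sum>d\<le>0::nat. 0::complex^'a \<Rightarrow> complex)" by auto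
  then show ?case by (intro exI)
next
  case (step c m y)
  then obtain D g where g: "\<And>d. g d \<in> forms d" "y = (\<Sum>d\<le>D. g d)" by blast
  define x :: "complex^'a \<Rightarrow> complex" where m: "x = mfun m"
  define s where "s = sum m UNIV"
  define k where "k d = (if d \<le> D then g d else 0) + (if d = s then fscale c x else 0)" for d
  have "k d \<in> forms d" for d
    unfolding k_def using g(1) m by (auto intro!: forms_add forms_scale mfun_forms simp: exps_def s_def)
  moreover have "fscale c x + y = (\<Sum>d\<le>max D s. k d)"
  proof -
    have "(\<Sum>d\<le>max D s. if d \<le> D then g d else 0) = y"
      unfolding g(2) by (intro sum.mono_neutral_cong_right) auto
    moreover have "(\<Sum>d\<le>max D s. if d = s then fscale c x else 0) = fscale c x" by simp
    ultimately show ?thesis unfolding k_def sum.distrib by simp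
  qed
  ultimately show ?case unfolding m by blast
qed

text \<open>
  On the line through \<open>x\<close> the component of degree \<open>d\<close> is multiplied by \<open>t^d\<close>, so the values at \<open>x\<close> are the
  coefficients of a polynomial in \<open>t\<close> with infinitely many zeros.
\<close>

lemma graded_sum_zero:
  assumes "finite A" "\<And>d. d \<in> A \<Longrightarrow> g d \<in> forms d" 
    and "\<And>t. t \<noteq> 0 \<Longrightarrow> (\<Sum>d\<in>A. g d (t *s x)) = 0" "d \<in> A"
  shows "g d x = 0"
proof -
  define p where "p = (\<Sum>d\<in>A. Polynomial.monom (g d x) d)"
  have ev: "poly p t = 0" if "t \<noteq> 0" for t
  proof -
    have "poly p t = (\<Sum>d\<in>A. g d (t *s x))"
      unfolding p_def poly_sum using assms(2)
      by (intro sum.cong refl) (subst forms_homogeneous, auto simp: poly_monom mult.commute)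
    then show ?thesis using assms(3)[OF that] by simp
  qed
  have "p = 0"
  proof (rule ccontr)
    assume "p \<noteq> 0"
    then have "finite {t. poly p t = 0}" by (rule poly_roots_finite)
    moreover have "UNIV - {0} \<subseteq> {t. poly p t = 0}" using ev by auto
    ultimately have "finite (UNIV - {0::complex})" by (rule finite_subset[rotated])
    then show False by (simp add: infinite_UNIV_char_0)
  qed
  moreover have "coeff p d = g d x"
    using assms(1,4) by (simp add: p_def coeff_sum)
  ultimately show ?thesis by simp
qed

lemma forms_on_line:
  assumes "f \<in> forms d"
  shows "\<exists>p. degree p \<le> d \<and> (\<forall>s. f (w + s *s u) = poly p s)"
  using assms
proof (induction rule: forms_induct)
  case zero
  show ?case by (rule exI[of _ 0]) simp
next
  case (step c m y)
  then obtain q where q: "degree q \<le> d" "\<And>s. y (w + s *s u) = poly q s" by blast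
  have m: "sum m UNIV = d" using step by (auto simp: exps_def)
  define p where "p = (\<Prod>i\<in>UNIV. [:w $ i, u $ i:] ^ m i)"
  have "degree p \<le> (\<Sum>i\<in>UNIV. degree ([:w $ i, u $ i:] ^ m i))"
    using degree_prod_sum_le[of UNIV "\<lambda>i. [:w $ i, u $ i:] ^ m i"] by (simp add: p_def o_def)
  also have "\<dots> \<le> (\<Sum>i\<in>UNIV. m i)"
  proof (rule sum_mono)
    fix i
    have "degree ([:w $ i, u $ i:] ^ m i) \<le> degree [:w $ i, u $ i:] * m i" by (rule degree_power_le)
    also have "\<dots> \<le> m i" by simp
    finally show "degree ([:w $ i, u $ i:] ^ m i) \<le> m i" .
  qed
  finally have "degree p \<le> d" using m by simp
  moreover have "mfun m (w + s *s u) = poly p s" for s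
    by (simp add: p_def mfun_def poly_prod poly_power)
  ultimately show ?case using q m
    by (intro exI[of _ "smult c p + q"]) (auto simp: fscale_apply intro!: degree_add_le order_trans[OF degree_smult_le])
qed

lemma exps_split:
  assumes "m \<in> exps (a + b)"
  obtains m1 m2 where "m1 \<in> exps a" "m2 \<in> exps b" "m = (\<lambda>i. m1 i + m2 i)"
proof -
  have "\<exists>m1 m2. m1 \<in> exps a \<and> m2 \<in> exps b \<and> m = (\<lambda>i. m1 i + m2 i)" if "m \<in> exps (a + b)" for m :: "'a \<Rightarrow> nat"
    using that
  proof (induction a arbitrary: m)
    case 0
    then show ?case by (intro exI[of _ "\<lambda>_. 0"] exI[of _ m]) (auto simp: exps_def)
  next
    case (Suc a)
    then have "sum m UNIV \<noteq> 0" by (simp add: exps_def)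
    then obtain i where i: "m i > 0" by (meson not_gr_zero sum.neutral)
    define m' where "m' = m(i := m i - 1)"
    have "sum m UNIV = m i + sum m (UNIV - {i})" by (simp add: sum.remove)
    moreover have "sum m' UNIV = m' i + sum m' (UNIV - {i})" by (simp add: sum.remove)
    moreover have "sum m' (UNIV - {i}) = sum m (UNIV - {i})" by (rule sum.cong) (auto simp: m'_def)
    ultimately have "m' \<in> exps (a + b)" using Suc.prems i by (simp add: exps_def m'_def)
    then obtain m1 m2 where m12: "m1 \<in> exps a" "m2 \<in> exps b" "m' = (\<lambda>i. m1 i + m2 i)" using Suc.IH by blast
    have "sum (m1(i := Suc (m1 i))) UNIV = Suc (m1 i) + sum m1 (UNIV - {i})"
      by (simp add: sum.remove[of UNIV i])
    also have "\<dots> = Suc (sum m1 UNIV)" by (simp add: sum.remove[of UNIV i m1])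
    finally have "m1(i := Suc (m1 i)) \<in> exps (Suc a)" using m12 by (simp add: exps_def)
    moreover have "m = (\<lambda>j. (m1(i := Suc (m1 i))) j + m2 j)"
    proof
      fix j
      show "m j = (m1(i := Suc (m1 i))) j + m2 j"
        using fun_cong[OF m12(3), of j] i by (auto simp: m'_def split: if_splits)
    qed
    ultimately show ?case using m12(2) by blast
  qed
  then show ?thesis using that assms by blast
qed

text \<open>
  Every monomial of degree \<open>a + b\<close> is a product of monomials of degrees \<open>a\<close> and \<open>b\<close>, so a property
  that is additive has to be checked on products only.
\<close>

lemma forms_split_induct:
  assumes "f \<in> forms (a + b)"
    and "P 0" "\<And>g f. g \<in> forms a \<Longrightarrow> f \<in> forms b \<Longrightarrow> P (g * f)"
    and "\<And>f g. f \<in> forms (a + b) \<Longrightarrow> g \<in> forms (a + b) \<Longrightarrow> P f \<Longrightarrow> P g \<Longrightarrow> P (f + g)"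
  shows "P f"
  using assms(1)
proof (induction rule: forms_induct)
  case zero
  show ?case by (rule assms(2))
next
  case (step c m y)
  obtain m1 m2 where m12: "m1 \<in> exps a" "m2 \<in> exps b" "m = (\<lambda>i. m1 i + m2 i)"
    using exps_split[OF step(1)] .
  have e: "fscale c (mfun m) = fscale c (mfun m1) * mfun m2"
    unfolding m12(3) by (auto simp: fscale_apply fun_eq_iff mfun_add[symmetric])
  have "P (fscale c (mfun m))"
    unfolding e by (rule assms(3)) (auto intro: forms_scale mfun_forms m12)
  then show ?case
    by (rule assms(4)[rotated 2]) (use step in \<open>auto intro: forms_scale mfun_forms\<close>)
qed

section \<open>Hilbert's Nullstellensatz over the complex numbers\<close>

definition poly_ideal :: "(complex ^ 'n::finite \<Rightarrow> complex) set \<Rightarrow> bool" where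
  "poly_ideal J \<longleftrightarrow> J \<subseteq> polys \<and> 0 \<in> J \<and> (\<forall>f\<in>J. \<forall>g\<in>J. f + g \<in> J) \<and> (\<forall>p\<in>polys. \<forall>f\<in>J. p * f \<in> J)"

lemma poly_ideal_diff:
  assumes "poly_ideal J" "f \<in> J" "g \<in> J"
  shows "f - g \<in> J"
proof -
  have "f + (\<lambda>x. -1) * g \<in> J"
    using assms polys_const[of "-1"] unfolding poly_ideal_def by blast
  moreover have "f + (\<lambda>x. -1) * g = f - g" by (auto simp: fun_eq_iff)
  ultimately show ?thesis by (simp only:)
qed

lemma poly_ideal_sum:
  assumes "poly_ideal J" "finite A" "\<And>i. i \<in> A \<Longrightarrow> f i \<in> J"
  shows "(\<Sum>i\<in>A. f i) \<in> J"
  using assms(2,3) by (induction A rule: finite_induct) (use assms(1) in \<open>auto simp: poly_ideal_def\<close>)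

lemma exists_maximal_ideal_avoiding_powers:
  assumes "poly_ideal J" "\<And>s. g ^ s \<notin> J"
  obtains P where "poly_ideal P" "J \<subseteq> P" "\<And>s. g ^ s \<notin> P"
    "\<And>K. poly_ideal K \<Longrightarrow> P \<subseteq> K \<Longrightarrow> (\<And>s. g ^ s \<notin> K) \<Longrightarrow> K = P"
proof -
  define A where "A = {K. poly_ideal K \<and> J \<subseteq> K \<and> (\<forall>s. g ^ s \<notin> K)}"
  have "\<exists>M\<in>A. \<forall>X\<in>A. M \<subseteq> X \<longrightarrow> X = M"
  proof (rule subset_Zorn_nonempty)
    show "A \<noteq> {}" using assms by (auto simp: A_def)
    fix \<C> assume ne: "\<C> \<noteq> {}" and ch: "subset.chain A \<C>"
    have sub: "K \<in> A" if "K \<in> \<C>" for K using ch that by (auto simp: subset_chain_def)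
    have "poly_ideal (\<Union>\<C>)"
      unfolding poly_ideal_def
    proof (intro conjI ballI)
      have "K \<subseteq> polys" if "K \<in> \<C>" for K using sub[OF that] by (simp add: A_def poly_ideal_def)
      then show "\<Union>\<C> \<subseteq> polys" by blast
      show "0 \<in> \<Union>\<C>" using ne sub by (auto simp: A_def poly_ideal_def)
    next
      fix f h assume "f \<in> \<Union>\<C>" "h \<in> \<Union>\<C>"
      then obtain K L where KL: "K \<in> \<C>" "L \<in> \<C>" "f \<in> K" "h \<in> L" by blast
      have "K \<subseteq> L \<or> L \<subseteq> K" using ch KL by (auto simp: subset_chain_def)
      then obtain M where "M \<in> \<C>" "f \<in> M" "h \<in> M" using KL by blast
      then show "f + h \<in> \<Union>\<C>" using sub[of M] by (auto simp: A_def poly_ideal_def)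
    next
      fix p f :: "complex ^ 'a \<Rightarrow> complex" assume "p \<in> polys" "f \<in> \<Union>\<C>"
      then show "p * f \<in> \<Union>\<C>" using sub by (fastforce simp: A_def poly_ideal_def)
    qed
    moreover have "J \<subseteq> \<Union>\<C>" using ne sub by (auto simp: A_def)
    moreover have "g ^ s \<notin> \<Union>\<C>" for s using sub by (auto simp: A_def)
    ultimately show "\<Union>\<C> \<in> A" by (auto simp: A_def)
  qed
  then obtain P where P: "P \<in> A" "\<And>X. X \<in> A \<Longrightarrow> P \<subseteq> X \<Longrightarrow> X = P" by blast
  show thesis
    using P by (intro that[of P]) (auto simp: A_def)
qed

lemma polys_bounded_span:
  assumes "f \<in> polys"
  obtains D where "f \<in> fv.span (mfun ` (\<Union>d\<le>D. exps d))"
proof -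
  obtain D g where g: "\<And>d. g d \<in> forms d" "f = (\<Sum>d\<le>D. g d)"
    using polys_decompose[OF assms] by blast
  have "g d \<in> fv.span (mfun ` (\<Union>d\<le>D. exps d))" if "d \<le> D" for d
  proof -
    have "forms d \<subseteq> fv.span (mfun ` (\<Union>d\<le>D. exps d))"
      unfolding forms_def using that by (intro fv.span_mono) auto
    then show ?thesis using g(1) by blast
  qed
  then have "f \<in> fv.span (mfun ` (\<Union>d\<le>D. exps d))"
    unfolding g(2) by (intro fv.span_sum) auto
  then show ?thesis using that by blast
qed

text \<open>
  The pigeonhole principle behind the Nullstellensatz: uncountably many \<open>c\<close>, each with a power \<open>s c\<close> and
  a degree bound \<open>D c\<close>, must share the same power and bound infinitely often.
\<close>

lemma uncountable_bounded_fibre: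
  fixes s D :: "complex \<Rightarrow> nat"
  obtains a b where "infinite {c. s c = a \<and> D c = b}"
proof (rule ccontr)
  assume "\<not> thesis"
  then have "finite {c. s c = a \<and> D c = b}" for a b using that by blast
  then have "countable (\<Union>(a, b)\<in>UNIV. {c. s c = a \<and> D c = b})"
    by (intro countable_UN) (auto intro: countable_finite)
  moreover have "(\<Union>(a, b)\<in>UNIV. {c. s c = a \<and> D c = b}) = (UNIV :: complex set)" by auto
  ultimately show False using uncountable_UNIV_complex by simp
qed

text \<open>
  The proof exploits that the complex numbers are uncountable. Let \<open>P\<close> be an ideal containing \<open>J\<close> and
  maximal among those without a power of \<open>g\<close>. Modulo \<open>P\<close> every polynomial outside \<open>P\<close> divides a power of
  \<open>g\<close>; in particular \<open>P\<close> is prime. If no \<open>x\<^sub>i - c\<close> were in \<open>P\<close>, the cofactors of \<open>x\<^sub>i - c\<close> for infinitely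
  many \<open>c\<close> would lie in one finite-dimensional space, and a linear relation among them would yield a
  nonzero polynomial in \<open>x\<^sub>i\<close> inside \<open>P\<close>, which splits into linear factors. So \<open>P\<close> contains
  \<open>x\<^sub>i - c\<^sub>i\<close> for every \<open>i\<close>, and \<open>c\<close> is the desired point.
\<close>

theorem nullstellensatz:
  fixes g :: "complex ^ 'n::finite \<Rightarrow> complex"
  assumes "poly_ideal J" "g \<in> polys" "\<And>s. g ^ s \<notin> J"
  shows "\<exists>x. (\<forall>f\<in>J. f x = 0) \<and> g x \<noteq> 0"
proof -
  obtain P where P: "poly_ideal P" "J \<subseteq> P" "\<And>s. g ^ s \<notin> P"
    and max: "\<And>K. poly_ideal K \<Longrightarrow> P \<subseteq> K \<Longrightarrow> (\<And>s. g ^ s \<notin> K) \<Longrightarrow> K = P"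
    using exists_maximal_ideal_avoiding_powers[OF assms(1,3)] by metis
  have Psub: "P \<subseteq> polys" and P0: "0 \<in> P" and Padd: "\<And>f h. f \<in> P \<Longrightarrow> h \<in> P \<Longrightarrow> f + h \<in> P"
    and Pmult: "\<And>p f. p \<in> polys \<Longrightarrow> f \<in> P \<Longrightarrow> p * f \<in> P"
    using P(1) by (auto simp: poly_ideal_def)
  note Pdiff = poly_ideal_diff[OF P(1)]
  have inv: "\<exists>s a. a \<in> polys \<and> g ^ s - a * f \<in> P" if f: "f \<in> polys" "f \<notin> P" for f
  proof (rule ccontr)
    assume no: "\<not> ?thesis"
    define K where "K = {p + a * f |p a. p \<in> P \<and> a \<in> polys}"
    have "poly_ideal K"
      unfolding poly_ideal_def
    proof (intro conjI ballI)
      show "K \<subseteq> polys" using Psub f by (auto simp: K_def intro!: polys_add polys_mult)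
      have "0 + 0 * f \<in> K" unfolding K_def using P0 polys_0 by blast
      then show "0 \<in> K" by simp
    next
      fix h h' assume "h \<in> K" "h' \<in> K"
      then obtain p a p' a' where *: "h = p + a * f" "h' = p' + a' * f" "p \<in> P" "p' \<in> P" "a \<in> polys" "a' \<in> polys"
        by (auto simp: K_def)
      have "h + h' = (p + p') + (a + a') * f" unfolding * by (simp add: algebra_simps)
      then show "h + h' \<in> K" unfolding K_def using * Padd polys_add by blast
    next
      fix q h :: "complex ^ 'n \<Rightarrow> complex" assume q: "q \<in> polys" "h \<in> K"
      then obtain p a where *: "h = p + a * f" "p \<in> P" "a \<in> polys"
        by (auto simp: K_def)
      have "q * h = q * p + (q * a) * f" unfolding * by (simp add: algebra_simps)
      then show "q * h \<in> K" unfolding K_def using * q Pmult polys_mult by blast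
    qed
    moreover have "P \<subseteq> K"
    proof
      fix p assume "p \<in> P"
      then have "p + 0 * f \<in> K" unfolding K_def using polys_0 by blast
      then show "p \<in> K" by simp
    qed
    moreover have "g ^ s \<notin> K" for s
    proof
      assume "g ^ s \<in> K"
      then obtain p a where *: "g ^ s = p + a * f" "p \<in> P" "a \<in> polys" by (auto simp: K_def)
      then have "g ^ s - a * f \<in> P" by (metis add_diff_cancel_right')
      then show False using no * by blast
    qed
    ultimately have "K = P" by (rule max)
    moreover have "0 + 1 * f \<in> K" unfolding K_def using P0 polys_1 by blast
    ultimately show False using f by simp
  qed
  have prime: "f \<in> P \<or> h \<in> P" if fh: "f * h \<in> P" "f \<in> polys" "h \<in> polys" for f h
  proof (rule ccontr)
    assume "\<not> ?thesis"
    then have "f \<notin> P" "h \<notin> P" by auto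
    then obtain s a s' a' where *: "a \<in> polys" "g ^ s - a * f \<in> P" "a' \<in> polys" "g ^ s' - a' * h \<in> P"
      using inv[of f] inv[of h] fh by auto
    have "g ^ s' * (g ^ s - a * f) + (a * f) * (g ^ s' - a' * h) + (a * a') * (f * h) \<in> P"
      by (rule Padd[OF Padd[OF Pmult Pmult] Pmult[OF _ fh(1)]]) (use * fh assms(2) in \<open>auto intro: polys_mult polys_power\<close>)
    moreover have "g ^ s' * (g ^ s - a * f) + (a * f) * (g ^ s' - a' * h) + (a * a') * (f * h) = g ^ (s + s')"
      by (simp add: algebra_simps power_add)
    ultimately show False using P(3) by (simp only:)
  qed
  have no1: "1 \<notin> P" using P(3)[of 0] by simp
  have const: "c = 0" if "(\<lambda>x. c) \<in> P" for c
  proof (rule ccontr)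
    assume "c \<noteq> 0"
    have "(\<lambda>x. inverse c) * (\<lambda>x. c) \<in> P" using that by (intro Pmult polys_const)
    moreover have "(\<lambda>x. inverse c) * (\<lambda>x. c) = (1 :: complex ^ 'n \<Rightarrow> complex)"
      using \<open>c \<noteq> 0\<close> by (auto simp: fun_eq_iff)
    ultimately show False using no1 by simp
  qed
  have polyX: "(\<lambda>x. poly p (x $ i)) \<in> polys" for p and i :: 'n
  proof (induction p)
    case 0
    then show ?case using polys_const[of 0] by simp
  next
    case (pCons a p)
    have "(\<lambda>x. a) + (\<lambda>x. x $ i) * (\<lambda>x. poly p (x $ i)) \<in> polys"
      using pCons by (intro polys_add polys_mult polys_const polys_coord)
    then show ?case by (simp add: plus_fun_def times_fun_def)
  qed
  have root: "\<exists>b. (\<lambda>x. x $ i - b) \<in> P" if "p \<noteq> 0" "(\<lambda>x. poly p (x $ i)) \<in> P" for p and i :: 'n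
    using that
  proof (induction "degree p" arbitrary: p rule: less_induct)
    case less
    show ?case
    proof (cases "degree p = 0")
      case True
      then obtain a where "p = [:a:]" by (metis degree_eq_zeroE)
      then show ?thesis using less.prems const[of a] by simp
    next
      case False
      then have "\<not> constant (poly p)" by (simp add: constant_degree)
      then obtain b where "poly p b = 0" using fundamental_theorem_of_algebra by blast
      then obtain q where q: "p = [:-b, 1:] * q" by (metis poly_eq_0_iff_dvd dvdE)
      have qn: "q \<noteq> 0" using q less.prems by auto
      have e: "(\<lambda>x. poly p (x $ i)) = (\<lambda>x. x $ i - b) * (\<lambda>x. poly q (x $ i))"
        by (auto simp: q fun_eq_iff algebra_simps)
      have "(\<lambda>x. x $ i) - (\<lambda>x. b) \<in> polys" by (intro polys_diff polys_coord polys_const)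
      then have "(\<lambda>x. x $ i - b) \<in> polys" by (simp add: fun_diff_def)
      then have "(\<lambda>x. x $ i - b) \<in> P \<or> (\<lambda>x. poly q (x $ i)) \<in> P"
        using less.prems(2) polyX unfolding e by (intro prime)
      moreover have "degree q < degree p"
        using qn degree_mult_eq[of "[:-b, 1:]" q] by (simp only: q) simp
      ultimately show ?thesis using less.hyps qn by blast
    qed
  qed
  have coord: "\<exists>c. (\<lambda>x. x $ i - c) \<in> P" for i :: 'n
  proof (rule ccontr)
    assume no: "\<not> ?thesis"
    have lin: "(\<lambda>x. x $ i - c) \<in> polys" for c
      using polyX[of "[:-c, 1:]" i] by simp
    have "\<forall>c. \<exists>s a D. a \<in> polys \<and> g ^ s - a * (\<lambda>x. x $ i - c) \<in> P \<and> a \<in> fv.span (mfun ` (\<Union>d\<le>D. exps d))"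
    proof
      fix c
      obtain s a where "a \<in> polys" "g ^ s - a * (\<lambda>x. x $ i - c) \<in> P"
        using inv[OF lin[of c]] no by blast
      then show "\<exists>s a D. a \<in> polys \<and> g ^ s - a * (\<lambda>x. x $ i - c) \<in> P \<and> a \<in> fv.span (mfun ` (\<Union>d\<le>D. exps d))"
        using polys_bounded_span by metis
    qed
    then obtain s a D where sa: "\<And>c. a c \<in> polys" "\<And>c. g ^ s c - a c * (\<lambda>x. x $ i - c) \<in> P"
      and span: "\<And>c. a c \<in> fv.span (mfun ` (\<Union>d\<le>D c. exps d))" by metis
    obtain s0 D0 where inf: "infinite {c. s c = s0 \<and> D c = D0}" using uncountable_bounded_fibre .
    define B where "B = mfun ` (\<Union>d\<le>D0. exps d :: ('n \<Rightarrow> nat) set)"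
    have "finite B" by (simp add: B_def finite_exps)
    obtain T where T: "T \<subseteq> {c. s c = s0 \<and> D c = D0}" "finite T" "card T = Suc (card B)"
      using infinite_arbitrarily_large[OF inf] by blast
    obtain u where u: "\<exists>c\<in>T. u c \<noteq> 0" "\<And>x. (\<Sum>c\<in>T. u c * a c x) = 0"
      using dependent_of_card_gt[OF \<open>finite B\<close> T(2), of a] T span unfolding B_def by (force simp: subset_iff)
    \<comment> \<open>Multiplying the relation among the cofactors by the product of all \<open>x\<^sub>i - c\<close> turns it, modulo \<open>P\<close>,
      into \<open>g ^ s0\<close> times the polynomial \<open>p\<close> in \<open>x\<^sub>i\<close>.\<close>
    define p where "p = (\<Sum>c\<in>T. smult (u c) (\<Prod>c'\<in>T - {c}. [:-c', 1:]))"
    obtain c0 where c0: "c0 \<in> T" "u c0 \<noteq> 0" using u by blast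
    have "poly p c0 = (\<Sum>c\<in>T. if c = c0 then u c0 * (\<Prod>c'\<in>T - {c0}. c0 - c') else 0)"
      unfolding p_def poly_sum
    proof (intro sum.cong refl)
      fix c assume c: "c \<in> T"
      show "poly (smult (u c) (\<Prod>c'\<in>T - {c}. [:- c', 1:])) c0 = (if c = c0 then u c0 * (\<Prod>c'\<in>T - {c0}. c0 - c') else 0)"
        using c0 c T(2) by (auto simp: poly_prod)
    qed
    then have "poly p c0 \<noteq> 0" using c0 T(2) by auto
    then have pn: "p \<noteq> 0" by auto
    define R where "R c = (\<lambda>x::complex^'n. poly (smult (u c) (\<Prod>c'\<in>T - {c}. [:-c', 1:])) (x $ i))" for c
    have "(\<Sum>c\<in>T. R c * (g ^ s0 - a c * (\<lambda>x. x $ i - c))) \<in> P"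
    proof (rule poly_ideal_sum[OF P(1) T(2)])
      fix c assume "c \<in> T"
      then have "s c = s0" using T by auto
      then show "R c * (g ^ s0 - a c * (\<lambda>x. x $ i - c)) \<in> P"
        using sa(2)[of c] unfolding R_def by (intro Pmult polyX) simp
    qed
    moreover have "(\<Sum>c\<in>T. R c * (g ^ s0 - a c * (\<lambda>x. x $ i - c))) = g ^ s0 * (\<lambda>x. poly p (x $ i))"
    proof
      fix x
      have "(\<Sum>c\<in>T. R c x * (a c x * (x $ i - c))) = (\<Sum>c\<in>T. (\<Prod>c'\<in>T. x $ i - c') * (u c * a c x))"
      proof (intro sum.cong refl)
        fix c assume "c \<in> T"
        then have "(\<Prod>c'\<in>T. x $ i - c') = (x $ i - c) * (\<Prod>c'\<in>T - {c}. x $ i - c')"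
          using T(2) by (simp add: prod.remove)
        then show "R c x * (a c x * (x $ i - c)) = (\<Prod>c'\<in>T. x $ i - c') * (u c * a c x)"
          by (simp add: R_def poly_prod)
      qed
      also have "\<dots> = 0" using u(2)[of x] by (simp flip: sum_distrib_left)
      finally have "(\<Sum>c\<in>T. R c x * (a c x * (x $ i - c))) = 0" .
      then show "(\<Sum>c\<in>T. R c * (g ^ s0 - a c * (\<lambda>x. x $ i - c))) x = (g ^ s0 * (\<lambda>x. poly p (x $ i))) x"
        by (simp add: right_diff_distrib sum_subtractf) (simp add: R_def p_def poly_sum sum_distrib_left mult.commute)
    qed
    ultimately have "g ^ s0 * (\<lambda>x. poly p (x $ i)) \<in> P" by (simp only:)
    then have "(\<lambda>x. poly p (x $ i)) \<in> P"
      using prime polys_power[OF assms(2)] polyX P(3) by blast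
    then show False using root[OF pn] no by blast
  qed
  then obtain c where c: "\<And>i. (\<lambda>x. x $ i - c i) \<in> P" by metis
  define z where "z = (\<chi> i. c i)"
  \<comment> \<open>Every polynomial is congruent to its value at \<open>z\<close>, because this holds for the coordinates and the
    set of such polynomials is a subring.\<close>
  define Q where "Q = {f \<in> polys. f - (\<lambda>x. f z) \<in> P}"
  have Qconst: "(\<lambda>x. k) \<in> Q" for k
    using P0 polys_const[of k] by (simp add: Q_def fun_diff_def zero_fun_def)
  have Qcoord: "(\<lambda>x. x $ i) \<in> Q" for i
    using c[of i] polys_coord[of i] by (simp add: Q_def fun_diff_def z_def)
  have Qadd: "f + h \<in> Q" if "f \<in> Q" "h \<in> Q" for f h
  proof -
    have "(f - (\<lambda>x. f z)) + (h - (\<lambda>x. h z)) \<in> P" using that Padd by (simp add: Q_def)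
    moreover have "(f - (\<lambda>x. f z)) + (h - (\<lambda>x. h z)) = f + h - (\<lambda>x. (f + h) z)" by (auto simp: fun_eq_iff)
    ultimately show ?thesis using that by (auto simp: Q_def intro: polys_add simp del: plus_fun_apply)
  qed
  have Qmult: "f * h \<in> Q" if "f \<in> Q" "h \<in> Q" for f h
  proof -
    have "f * (h - (\<lambda>x. h z)) + (\<lambda>x. h z) * (f - (\<lambda>x. f z)) \<in> P"
      using that by (intro Padd Pmult polys_const) (auto simp: Q_def)
    moreover have "f * (h - (\<lambda>x. h z)) + (\<lambda>x. h z) * (f - (\<lambda>x. f z)) = f * h - (\<lambda>x. (f * h) z)"
      by (auto simp: fun_eq_iff algebra_simps)
    ultimately show ?thesis using that by (auto simp: Q_def intro: polys_mult simp del: times_fun_apply)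
  qed
  have Qpow: "f ^ k \<in> Q" if "f \<in> Q" for f k
  proof (induction k)
    case 0
    show ?case using Qconst[of 1] by (simp add: one_fun_def)
  next
    case (Suc k)
    have "f * f ^ k \<in> Q" using Qmult that Suc.IH by blast
    then show ?case by (simp only: power_Suc)
  qed
  have Qprod: "(\<lambda>x. \<Prod>i\<in>A. f i x) \<in> Q" if "finite A" "\<And>i. f i \<in> Q" for A :: "'n set" and f
    using that(1)
  proof (induction A rule: finite_induct)
    case empty
    then show ?case using Qconst[of 1] by simp
  next
    case (insert i A)
    then have "f i * (\<lambda>x. \<Prod>i\<in>A. f i x) \<in> Q" using that Qmult by blast
    then show ?case using insert by (simp add: times_fun_def)
  qed
  have Qall: "f \<in> Q" if "f \<in> polys" for f
    using that
  proof (induction rule: polys_induct)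
    case zero
    then show ?case using Qconst[of 0] by (simp add: zero_fun_def)
  next
    case (step k m f)
    have "(\<lambda>x. \<Prod>i\<in>UNIV. ((\<lambda>x. x $ i) ^ m i) x) \<in> Q" by (intro Qprod Qpow Qcoord) simp
    then have "mfun m \<in> Q" by (simp add: mfun_def[abs_def])
    then have "(\<lambda>x. k) * mfun m \<in> Q" using Qmult Qconst by blast
    then have "fscale k (mfun m) \<in> Q" by (simp add: fscale_def times_fun_def)
    then show ?case using step Qadd by blast
  qed
  have "f z = 0" if "f \<in> P" for f
  proof -
    have "f - (\<lambda>x. f z) \<in> P" using that Qall Psub by (auto simp: Q_def)
    then have "f - (f - (\<lambda>x. f z)) \<in> P" by (rule Pdiff[OF that])
    moreover have "f - (f - (\<lambda>x. f z)) = (\<lambda>x. f z)" by (auto simp: fun_eq_iff)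
    ultimately show ?thesis using const[of "f z"] by (simp only:)
  qed
  moreover have "g z \<noteq> 0"
  proof
    assume "g z = 0"
    then have "g - 0 \<in> P" using Qall[OF assms(2)] by (simp add: Q_def zero_fun_def)
    then show False using P(3)[of 1] by simp
  qed
  ultimately show ?thesis using P(2) by blast
qed

section \<open>Cones and linear sections\<close>

definition zero_cone :: "(complex ^ 'n::finite \<Rightarrow> complex) set \<Rightarrow> (complex ^ 'n) set" where
  "zero_cone S = {x. x \<noteq> 0 \<and> (\<forall>f\<in>S. f x = 0)}"

text \<open>
  These are the cones over the Zariski closed subsets of projective space, the origin removed.
\<close>

definition acone :: "(complex ^ 'n::finite) set \<Rightarrow> bool" where
  "acone C \<longleftrightarrow> (\<exists>S. S \<subseteq> (\<Union>d. forms d) \<and> C = zero_cone S)"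

lemma acone_nonzero: "acone C \<Longrightarrow> x \<in> C \<Longrightarrow> x \<noteq> 0"
  by (auto simp: acone_def zero_cone_def)

lemma acone_scale:
  assumes "acone C" "x \<in> C" "t \<noteq> 0"
  shows "t *s x \<in> C"
proof -
  obtain S where S: "S \<subseteq> (\<Union>d. forms d)" "C = zero_cone S" using assms(1) by (auto simp: acone_def)
  have "f (t *s x) = 0" if f: "f \<in> S" for f
  proof -
    obtain d where "f \<in> forms d" using f S(1) by blast
    then show ?thesis using assms(2) f S(2) by (simp add: forms_homogeneous zero_cone_def)
  qed
  then show ?thesis using assms(2,3) by (auto simp: S(2) zero_cone_def)
qed

text \<open>
  The projective Nullstellensatz for a cone that avoids the linear subspace cut out by \<open>k\<close> linear forms.
  The functions that agree on \<open>C\<close> with a combination of the linear forms are an ideal whose only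
  possible common zero is the origin, where \<open>x\<^sub>i\<close> vanishes too.
\<close>

lemma coord_power_mod_lforms:
  fixes C :: "(complex ^ 'n::finite) set"
  assumes "acone C" "\<And>x. x \<in> C \<Longrightarrow> \<exists>j<k::nat. lform (l j) x \<noteq> 0"
  obtains s q where "s \<ge> 1" "\<And>j. q j \<in> forms (s - 1)"
    "\<And>x. x \<in> C \<Longrightarrow> x $ i ^ s = (\<Sum>j<k. lform (l j) x * q j x)"
proof -
  define J where "J = {p \<in> polys. \<exists>q. (\<forall>j. q j \<in> polys) \<and> (\<forall>x\<in>C. p x = (\<Sum>j<k. lform (l j) x * q j x))}"
  obtain S where S: "S \<subseteq> (\<Union>d. forms d)" "C = zero_cone S" using assms(1) by (auto simp: acone_def)
  have J: "poly_ideal J"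
    unfolding poly_ideal_def
  proof (intro conjI ballI)
    show "J \<subseteq> polys" by (auto simp: J_def)
    show "0 \<in> J" unfolding J_def using polys_0 by (auto intro!: exI[of _ "\<lambda>_. 0"])
  next
    fix f g assume "f \<in> J" "g \<in> J"
    from \<open>f \<in> J\<close> obtain q where "f \<in> polys" "\<And>j. q j \<in> polys"
      "\<And>x. x \<in> C \<Longrightarrow> f x = (\<Sum>j<k. lform (l j) x * q j x)" by (auto simp: J_def)
    moreover from \<open>g \<in> J\<close> obtain r where "g \<in> polys" "\<And>j. r j \<in> polys"
      "\<And>x. x \<in> C \<Longrightarrow> g x = (\<Sum>j<k. lform (l j) x * r j x)" by (auto simp: J_def)
    ultimately show "f + g \<in> J"
      unfolding J_def by (auto intro!: polys_add exI[of _ "\<lambda>j. q j + r j"] simp: sum.distrib algebra_simps)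
  next
    fix p f :: "complex ^ 'n \<Rightarrow> complex" assume p: "p \<in> polys" "f \<in> J"
    then obtain q where "f \<in> polys" "\<And>j. q j \<in> polys"
      "\<And>x. x \<in> C \<Longrightarrow> f x = (\<Sum>j<k. lform (l j) x * q j x)" by (auto simp: J_def)
    then show "p * f \<in> J"
      unfolding J_def using p by (auto intro!: polys_mult exI[of _ "\<lambda>j. p * q j"] simp: sum_distrib_left algebra_simps)
  qed
  have SJ: "f \<in> J" if "f \<in> S" for f
    using that S forms_polys polys_0 unfolding J_def by (auto simp: zero_cone_def intro!: exI[of _ "\<lambda>_. 0"])
  have lJ: "lform (l j) \<in> J" if "j < k" for j
    unfolding J_def using that polys_lform polys_0 polys_1
    by (auto intro!: exI[of _ "\<lambda>j'. if j' = j then 1 else 0"] simp: if_distrib[of "\<lambda>f. f _"] if_distrib[of "\<lambda>f. _ * f"]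
        sum.delta cong: if_cong)
  have "\<exists>s. (\<lambda>x. x $ i) ^ s \<in> J"
  proof (rule ccontr)
    assume "\<not> ?thesis"
    then obtain x where x: "\<And>f. f \<in> J \<Longrightarrow> f x = 0" "x $ i \<noteq> 0"
      using nullstellensatz[OF J polys_coord] by blast
    have "x \<in> C" using x SJ S by (auto simp: zero_cone_def)
    then show False using assms(2) x(1) lJ by blast
  qed
  then obtain s0 where "(\<lambda>x. x $ i) ^ s0 \<in> J" by blast
  then have "(\<lambda>x. x $ i) * (\<lambda>x. x $ i) ^ s0 \<in> J" using J polys_coord unfolding poly_ideal_def by blast
  then obtain q where q: "\<And>j. q j \<in> polys"
      "\<And>x. x \<in> C \<Longrightarrow> x $ i ^ Suc s0 = (\<Sum>j<k. lform (l j) x * q j x)" by (auto simp: J_def)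
  have "\<forall>j. \<exists>D g. (\<forall>d. g d \<in> forms d) \<and> q j = (\<Sum>d\<le>D. g d)" using polys_decompose q(1) by blast
  then obtain D r where r: "\<And>j d. r j d \<in> forms d" "\<And>j. q j = (\<Sum>d\<le>D j. r j d)" by metis
  define M where "M = s0 + (\<Sum>j<k. D j)"
  define r' where "r' j d = (if d \<le> D j then r j d else 0)" for j d
  have DM: "D j \<le> M" if "j < k" for j
    using member_le_sum[of j "{..<k}" D] that by (simp add: M_def)
  have qr: "q j = (\<Sum>d\<le>M. r' j d)" if "j < k" for j
    unfolding r(2) r'_def using DM[OF that] by (intro sum.mono_neutral_cong_left) auto
  have r'f: "r' j d \<in> forms d" for j d using r(1) by (auto simp: r'_def)
  \<comment> \<open>The component of degree \<open>Suc d\<close> of the difference of the two sides. Multiplication by a linear form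
    raises the degree by one, which is why the pieces of degree \<open>d\<close> of the coefficients occur in it.\<close>
  define G where "G d = (if d = s0 then (\<lambda>x. x $ i) ^ Suc s0 else 0) - (\<Sum>j<k. lform (l j) * r' j d)" for d
  have Xf: "(\<lambda>x. x $ i) ^ k \<in> forms k" for k using forms_power[OF forms_coord[of i], of k] by simp
  have Gf: "G d \<in> forms (Suc d)" for d
    unfolding G_def
  proof (rule forms_diff)
    show "(if d = s0 then (\<lambda>x. x $ i) ^ Suc s0 else 0) \<in> forms (Suc d)"
      using Xf[of "Suc s0"] by (cases "d = s0") (simp_all del: power_Suc)
    show "(\<Sum>j<k. lform (l j) * r' j d) \<in> forms (Suc d)"
      using forms_mult[OF forms_lform r'f] by (intro forms_sum) simp
  qed
  have "(\<lambda>e. G (e - 1)) (Suc s0) x = 0" if x: "x \<in> C" for x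
  proof (rule graded_sum_zero[where A = "{1..Suc M}" and g = "\<lambda>e. G (e - 1)"])
    show "G (d - 1) \<in> forms d" if "d \<in> {1..Suc M}" for d using Gf[of "d - 1"] that by simp
    show "Suc s0 \<in> {1..Suc M}" by (simp add: M_def)
    fix t :: complex assume "t \<noteq> 0"
    define y where "y = t *s x"
    have y: "y \<in> C" using acone_scale[OF assms(1) x \<open>t \<noteq> 0\<close>] by (simp add: y_def)
    have "(\<Sum>d\<in>{1..Suc M}. G (d - 1) y) = (\<Sum>d\<le>M. G d y)"
      by (rule sum.reindex_bij_witness[of _ Suc "\<lambda>d. d - 1"]) auto
    also have "\<dots> = (\<Sum>d\<le>M. (if d = s0 then y $ i ^ Suc s0 else 0)) - (\<Sum>d\<le>M. \<Sum>j<k. lform (l j) y * r' j d y)"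
      unfolding G_def by (simp add: sum_subtractf if_distrib[of "\<lambda>f. f y"] cong: if_cong)
    also have "(\<Sum>d\<le>M. \<Sum>j<k. lform (l j) y * r' j d y) = (\<Sum>j<k. \<Sum>d\<le>M. lform (l j) y * r' j d y)"
      by (rule sum.swap)
    also have "\<dots> = (\<Sum>j<k. lform (l j) y * q j y)"
      by (intro sum.cong refl) (simp add: qr sum_distrib_left)
    also have "(\<Sum>d\<le>M. (if d = s0 then y $ i ^ Suc s0 else 0)) = y $ i ^ Suc s0" by (simp add: M_def)
    finally show "(\<Sum>d\<in>{1..Suc M}. G (d - 1) (t *s x)) = 0" using q(2)[OF y] by (simp add: y_def)
  qed simp
  then show thesis
    by (intro that[of "Suc s0" "\<lambda>j. r' j s0"]) (auto simp: G_def r'f)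
qed

text \<open>
  In degree \<open>D\<close> larger than the sum of the exponents for the single coordinates, each monomial is
  divisible by one of the coordinate powers of \<open>coord_power_mod_lforms\<close>.
\<close>

lemma forms_mod_lforms:
  fixes C :: "(complex ^ 'n::finite) set"
  assumes "acone C" "\<And>x. x \<in> C \<Longrightarrow> \<exists>j<k::nat. lform (l j) x \<noteq> 0"
  obtains D where "D \<ge> 1" 
    "\<And>g. g \<in> forms D \<Longrightarrow> \<exists>q. (\<forall>j. q j \<in> forms (D - 1)) \<and> (\<forall>x\<in>C. g x = (\<Sum>j<k. lform (l j) x * q j x))"
proof -
  have "\<forall>i. \<exists>s q. s \<ge> 1 \<and> (\<forall>j. q j \<in> forms (s - 1)) \<and> (\<forall>x\<in>C. x $ i ^ s = (\<Sum>j<k. lform (l j) x * q j x))"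
  proof
    fix i
    obtain s q where "s \<ge> 1" "\<And>j. q j \<in> forms (s - 1)"
      "\<And>x. x \<in> C \<Longrightarrow> x $ i ^ s = (\<Sum>j<k. lform (l j) x * q j x)"
      using coord_power_mod_lforms[OF assms, where i = i] by blast
    then show "\<exists>s q. s \<ge> 1 \<and> (\<forall>j. q j \<in> forms (s - 1)) \<and> (\<forall>x\<in>C. x $ i ^ s = (\<Sum>j<k. lform (l j) x * q j x))"
      by (intro exI[of _ s] exI[of _ q]) simp
  qed
  then obtain s q where s: "\<And>i. s i \<ge> (1::nat)" and q: "\<And>i j. q i j \<in> forms (s i - 1)"
    and eq: "\<And>i x. x \<in> C \<Longrightarrow> x $ i ^ s i = (\<Sum>j<k. lform (l j) x * q i j x)"
    unfolding choice_iff by blast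
  define D where "D = Suc (sum s UNIV)"
  have "\<exists>q. (\<forall>j. q j \<in> forms (D - 1)) \<and> (\<forall>x\<in>C. g x = (\<Sum>j<k. lform (l j) x * q j x))" if "g \<in> forms D" for g
    using that
  proof (induction rule: forms_induct)
    case zero
    show ?case by (rule exI[of _ "\<lambda>_. 0"]) auto
  next
    case (step c m g)
    obtain r where r: "\<And>j. r j \<in> forms (D - 1)" "\<And>x. x \<in> C \<Longrightarrow> g x = (\<Sum>j<k. lform (l j) x * r j x)"
      using step by blast
    have "\<exists>i. m i \<ge> s i"
    proof (rule ccontr)
      assume "\<not> ?thesis"
      then have "sum m UNIV \<le> sum s UNIV" by (intro sum_mono) (simp add: not_le less_imp_le)
      then show False using step(1) by (simp add: exps_def D_def)
    qed
    then obtain i where i: "m i \<ge> s i" by blast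
    define m' where "m' = m(i := m i - s i)"
    have "sum m UNIV = m i + sum m (UNIV - {i})" by (simp add: sum.remove)
    moreover have "sum m' UNIV = m' i + sum m' (UNIV - {i})" by (simp add: sum.remove)
    moreover have "sum m' (UNIV - {i}) = sum m (UNIV - {i})" by (rule sum.cong) (auto simp: m'_def)
    ultimately have m': "m' \<in> exps (D - s i)" "s i \<le> D" using step(1) i by (auto simp: exps_def m'_def)
    have mm: "mfun m x = x $ i ^ s i * mfun m' x" for x :: "complex ^ 'n"
    proof -
      have "(\<Prod>j\<in>UNIV - {i}. x $ j ^ m j) = (\<Prod>j\<in>UNIV - {i}. x $ j ^ m' j)"
        by (rule prod.cong) (auto simp: m'_def)
      then show ?thesis using i
        by (simp add: mfun_def prod.remove[of UNIV i] m'_def power_add[symmetric])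
    qed
    have "q i j * mfun m' \<in> forms (D - 1)" for j
      using forms_mult[OF q mfun_forms[OF m'(1)], of i j] s[of i] m'(2) by simp
    then have "fscale c (q i j * mfun m') + r j \<in> forms (D - 1)" for j
      using r(1) by (intro forms_add forms_scale)
    moreover have "(fscale c (mfun m) + g) x = (\<Sum>j<k. lform (l j) x * (fscale c (q i j * mfun m') + r j) x)" if "x \<in> C" for x
      using eq[OF that, of i] r(2)[OF that]
      by (simp add: mm fscale_apply sum_distrib_left sum_distrib_right sum.distrib algebra_simps)
    ultimately show ?case by (intro exI[of _ "\<lambda>j. fscale c (q i j * mfun m') + r j"]) blast
  qed
  then show thesis by (intro that[of D]) (simp_all add: D_def)
qed

section \<open>Hilbert functions of irreducible cones\<close>

definition irr_cone :: "(complex ^ 'n::finite) set \<Rightarrow> bool" where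
  "irr_cone C \<longleftrightarrow> acone C \<and> C \<noteq> {} \<and>
     (\<forall>A B. acone A \<and> acone B \<and> A \<union> B = C \<longrightarrow> A = C \<or> B = C)"

lemma acone_restrict:
  assumes "acone C" "f \<in> forms d"
  shows "acone {x \<in> C. f x = 0}"
proof -
  obtain S where S: "S \<subseteq> (\<Union>d. forms d)" "C = zero_cone S" using assms(1) by (auto simp: acone_def)
  have "{x \<in> C. f x = 0} = zero_cone (insert f S)" by (auto simp: S(2) zero_cone_def)
  moreover have "insert f S \<subseteq> (\<Union>d. forms d)" using S(1) assms(2) by blast
  ultimately show ?thesis unfolding acone_def by blast
qed

lemma irr_cone_mult:
  assumes "irr_cone C" "f \<in> forms d" "g \<in> forms e" "\<And>x. x \<in> C \<Longrightarrow> f x * g x = 0"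
  shows "(\<forall>x\<in>C. f x = 0) \<or> (\<forall>x\<in>C. g x = 0)"
proof -
  have "{x \<in> C. f x = 0} \<union> {x \<in> C. g x = 0} = C" using assms(4) by auto
  then have "{x \<in> C. f x = 0} = C \<or> {x \<in> C. g x = 0} = C"
    using assms(1) acone_restrict[OF _ assms(2)] acone_restrict[OF _ assms(3)]
    unfolding irr_cone_def by blast
  then show ?thesis by blast
qed

lemma acone_separate:
  assumes "acone C'" "acone C" "C' \<subset> C"
  obtains d f where "f \<in> forms d" "\<And>x. x \<in> C' \<Longrightarrow> f x = 0" "\<exists>x\<in>C. f x \<noteq> 0"
proof -
  obtain S where S: "S \<subseteq> (\<Union>d. forms d)" "C' = zero_cone S" using assms(1) by (auto simp: acone_def)
  obtain x where x: "x \<in> C" "x \<notin> C'" using assms(3) by blast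
  then obtain f where f: "f \<in> S" "f x \<noteq> 0" using acone_nonzero[OF assms(2)] by (auto simp: S(2) zero_cone_def)
  then obtain d where d: "f \<in> forms d" using S(1) by blast
  show thesis by (rule that[OF d]) (use f x S(2) in \<open>auto simp: zero_cone_def\<close>)
qed

text \<open>
  This says that the Hilbert function of \<open>C\<close> at \<open>e\<close> is at least \<open>m\<close>.
\<close>

definition indep_on :: "(complex ^ 'n::finite) set \<Rightarrow> nat \<Rightarrow> nat \<Rightarrow> bool" where
  "indep_on C e m \<longleftrightarrow> (\<exists>f. (\<forall>i<m. f i \<in> forms e) \<and>
     (\<forall>c. (\<forall>x\<in>C. (\<Sum>i<m. c i * f i x) = 0) \<longrightarrow> (\<forall>i<m. c i = 0)))"

lemma coord_power_nonzero:
  assumes "acone C" "x \<in> C"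
  obtains i where "(\<lambda>x. x $ i) ^ e \<in> forms e" "((\<lambda>x. x $ i) ^ e) x \<noteq> 0"
proof -
  obtain i where i: "x $ i \<noteq> 0" using acone_nonzero[OF assms] by (auto simp: vec_eq_iff)
  show thesis using forms_power[OF forms_coord[of i], of e] i by (intro that[of i]) auto
qed

lemma indep_on_one:
  assumes "acone C" "C \<noteq> {}"
  shows "indep_on C e 1"
proof -
  obtain x where x: "x \<in> C" using assms(2) by blast
  obtain i where i: "(\<lambda>x. x $ i) ^ e \<in> forms e" "((\<lambda>x. x $ i) ^ e) x \<noteq> 0"
    using coord_power_nonzero[OF assms(1) x] .
  show ?thesis unfolding indep_on_def
    by (rule exI[of _ "\<lambda>_. (\<lambda>x. x $ i) ^ e"]) (use i x in auto)
qed

text \<open>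
  A lower bound for the growth of Hilbert functions: a form \<open>g\<close> that vanishes on \<open>C'\<close> but not on \<open>C\<close>
  separates the two families. A relation between the forms independent on \<open>C'\<close> and the multiples of \<open>g\<close>
  involves only the latter after restriction to \<open>C'\<close>, and then \<open>g\<close> cancels because \<open>C\<close> is irreducible.
\<close>

lemma indep_on_append:
  assumes "irr_cone C" "C' \<subseteq> C" "g \<in> forms a" "\<And>x. x \<in> C' \<Longrightarrow> g x = 0" "\<exists>x\<in>C. g x \<noteq> 0"
    and "indep_on C' (a + e) m'" "indep_on C e m"
  shows "indep_on C (a + e) (m' + m)"
proof -
  obtain f' where f': "\<And>i. i < m' \<Longrightarrow> f' i \<in> forms (a + e)"
    "\<And>c. (\<forall>x\<in>C'. (\<Sum>i<m'. c i * f' i x) = 0) \<Longrightarrow> (\<forall>i<m'. c i = 0)"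
    using assms(6) unfolding indep_on_def by blast
  obtain f where f: "\<And>i. i < m \<Longrightarrow> f i \<in> forms e"
    "\<And>c. (\<forall>x\<in>C. (\<Sum>i<m. c i * f i x) = 0) \<Longrightarrow> (\<forall>i<m. c i = 0)"
    using assms(7) unfolding indep_on_def by blast
  define h where "h i = (if i < m' then f' i else g * f (i - m'))" for i
  have "h i \<in> forms (a + e)" if "i < m' + m" for i
    using that f'(1) forms_mult[OF assms(3) f(1), of "i - m'"] by (auto simp: h_def)
  moreover have "c i = 0" if c: "\<forall>x\<in>C. (\<Sum>i<m' + m. c i * h i x) = 0" and i: "i < m' + m" for c i
  proof -
    have split: "(\<Sum>i<m' + m. c i * h i x) = (\<Sum>i<m'. c i * f' i x) + g x * (\<Sum>i<m. c (m' + i) * f i x)" for x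
    proof -
      have "(\<Sum>i<m' + m. c i * h i x) = (\<Sum>i<m'. c i * h i x) + (\<Sum>i<m. c (m' + i) * h (m' + i) x)"
      proof (induction m)
        case (Suc m)
        then show ?case by (simp add: algebra_simps)
      qed simp
      then show ?thesis by (simp add: h_def sum_distrib_left algebra_simps)
    qed
    have c1: "\<forall>i<m'. c i = 0"
    proof (rule f'(2), rule ballI)
      fix x assume x: "x \<in> C'"
      then have "(\<Sum>i<m' + m. c i * h i x) = 0" using c assms(2) by blast
      then show "(\<Sum>i<m'. c i * f' i x) = 0" using split[of x] assms(4)[OF x] by simp
    qed
    define F where "F = (\<Sum>i<m. fscale (c (m' + i)) (f i))"
    have "F \<in> forms e" unfolding F_def using f(1) by (intro forms_sum forms_scale) auto
    moreover have "g x * F x = 0" if "x \<in> C" for x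
      using c that split[of x] c1 by (simp add: F_def fscale_apply)
    ultimately have "(\<forall>x\<in>C. g x = 0) \<or> (\<forall>x\<in>C. F x = 0)"
      using irr_cone_mult[OF assms(1,3)] by blast
    then have "\<forall>x\<in>C. (\<Sum>i<m. c (m' + i) * f i x) = 0" using assms(5) by (auto simp: F_def fscale_apply)
    then have "\<forall>i<m. c (m' + i) = 0" by (rule f(2))
    then show ?thesis using c1 i by (metis add_diff_inverse_nat nat_add_left_cancel_less)
  qed
  ultimately show ?thesis unfolding indep_on_def by blast
qed

text \<open>
  All separating forms along a chain can be given one common degree \<open>a\<close>: multiplying by a power of a
  coordinate that does not vanish identically on \<open>C\<close> preserves the separation by irreducibility.
\<close>

lemma separate_in_degree:
  assumes "irr_cone C" "f \<in> forms d" "\<And>x. x \<in> C' \<Longrightarrow> f x = 0" "\<exists>x\<in>C. f x \<noteq> 0" "d \<le> a"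
  obtains g where "g \<in> forms a" "\<And>x. x \<in> C' \<Longrightarrow> g x = 0" "\<exists>x\<in>C. g x \<noteq> 0"
proof -
  obtain x where x: "x \<in> C" "f x \<noteq> 0" using assms(4) by blast
  obtain i where i: "(\<lambda>x. x $ i) ^ (a - d) \<in> forms (a - d)" "((\<lambda>x. x $ i) ^ (a - d)) x \<noteq> 0"
    using coord_power_nonzero[OF _ x(1), of "a - d"] assms(1) unfolding irr_cone_def by metis
  have "f * (\<lambda>x. x $ i) ^ (a - d) \<in> forms a"
    using forms_mult[OF assms(2) i(1)] assms(5) by simp
  then show thesis
    by (rule that) (use assms(3) x i in auto)
qed

text \<open>
  Along the chain, \<open>indep_on_append\<close> becomes Pascal's rule for the number of monomials of degree \<open>M\<close>
  in \<open>i + 1\<close> variables.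
\<close>

lemma indep_on_chain:
  assumes "\<And>i. i \<le> k \<Longrightarrow> irr_cone (Z i)" "\<And>i. i < k \<Longrightarrow> Z i \<subset> Z (Suc i)"
  obtains a where "\<And>i M. i \<le> k \<Longrightarrow> indep_on (Z i) (a * M) ((M + i) choose i)"
proof -
  have "\<forall>i. \<exists>d f. i < k \<longrightarrow> f \<in> forms d \<and> (\<forall>x\<in>Z i. f x = 0) \<and> (\<exists>x\<in>Z (Suc i). f x \<noteq> 0)"
  proof
    fix i
    show "\<exists>d f. i < k \<longrightarrow> f \<in> forms d \<and> (\<forall>x\<in>Z i. f x = 0) \<and> (\<exists>x\<in>Z (Suc i). f x \<noteq> 0)"
    proof (cases "i < k")
      case True
      then have ac: "acone (Z i)" "acone (Z (Suc i))" using assms(1)[of i] assms(1)[of "Suc i"] by (auto simp: irr_cone_def)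
      obtain d f where "f \<in> forms d" "\<And>x. x \<in> Z i \<Longrightarrow> f x = 0" "\<exists>x\<in>Z (Suc i). f x \<noteq> 0"
        by (rule acone_separate[OF ac assms(2)[OF True]]) blast
      then show ?thesis by blast
    qed blast
  qed
  then obtain d f where df: "\<And>i. i < k \<Longrightarrow> f i \<in> forms (d i)" "\<And>i x. i < k \<Longrightarrow> x \<in> Z i \<Longrightarrow> f i x = 0"
    "\<And>i. i < k \<Longrightarrow> \<exists>x\<in>Z (Suc i). f i x \<noteq> 0" unfolding choice_iff by blast
  define a where "a = (\<Sum>i<k. d i)"
  have da: "d i \<le> a" if "i < k" for i
    using member_le_sum[of i "{..<k}" d] that by (simp add: a_def)
  have "indep_on (Z i) (a * M) ((M + i) choose i)" if "i \<le> k" for i M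
    using that
  proof (induction i arbitrary: M)
    case 0
    then show ?case using assms(1)[of 0] indep_on_one[of "Z 0" "a * M"] by (simp add: irr_cone_def)
  next
    case (Suc i)
    have irr: "irr_cone (Z (Suc i))" and i: "i < k" using Suc.prems assms(1) by auto
    obtain g where g: "g \<in> forms a" "\<And>x. x \<in> Z i \<Longrightarrow> g x = 0" "\<exists>x\<in>Z (Suc i). g x \<noteq> 0"
    proof (rule separate_in_degree[where C' = "Z i" and f = "f i", OF irr df(1)[OF i] _ df(3)[OF i] da[OF i]])
      show "f i x = 0" if "x \<in> Z i" for x using df(2)[OF i that] .
    qed blast
    show ?case
    proof (induction M)
      case 0
      then show ?case using irr indep_on_one[of "Z (Suc i)" 0] by (simp add: irr_cone_def)
    next
      case (Suc M)
      have "indep_on (Z i) (a + a * M) ((Suc M + i) choose i)"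
        using \<open>\<And>M. i \<le> k \<Longrightarrow> indep_on (Z i) (a * M) ((M + i) choose i)\<close>[of "Suc M"] i by simp
      then have "indep_on (Z (Suc i)) (a + a * M) (((Suc M + i) choose i) + ((M + Suc i) choose Suc i))"
        using assms(2)[OF i] by (intro indep_on_append[OF irr _ g(1) g(2) g(3) _ Suc.IH]) auto
      then show ?case by simp
    qed
  qed
  then show thesis by (rule that)
qed

text \<open>
  The monomials of degree \<open>e\<close> in the first \<open>j\<close> linear forms, split according to whether the last one
  occurs.
\<close>

fun lform_monomials :: "(nat \<Rightarrow> complex ^ 'n::finite) \<Rightarrow> nat \<Rightarrow> nat \<Rightarrow> (complex ^ 'n \<Rightarrow> complex) set" where
  "lform_monomials l j 0 = {1}"
| "lform_monomials l 0 (Suc e) = {}"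
| "lform_monomials l (Suc j) (Suc e) =
     lform_monomials l j (Suc e) \<union> (\<lambda>f. lform (l j) * f) ` lform_monomials l (Suc j) e"

lemma finite_lform_monomials: "finite (lform_monomials l j e)"
  by (induction l j e rule: lform_monomials.induct) auto

lemma card_lform_monomials: "card (lform_monomials l (Suc j) e) \<le> ((e + j) choose j)"
proof (induction j arbitrary: e)
  case 0
  show ?case
  proof (induction e)
    case (Suc e)
    have "card ((\<lambda>f. lform (l 0) * f) ` lform_monomials l (Suc 0) e) \<le> card (lform_monomials l (Suc 0) e)"
      by (rule card_image_le[OF finite_lform_monomials])
    then show ?case using Suc by simp
  qed simp
next
  case (Suc j)
  show ?case
  proof (induction e)
    case (Suc e)
    have "card (lform_monomials l (Suc (Suc j)) (Suc e)) \<le> card (lform_monomials l (Suc j) (Suc e)) +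
        card ((\<lambda>f. lform (l (Suc j)) * f) ` lform_monomials l (Suc (Suc j)) e)"
      using card_Un_le by (simp only: lform_monomials.simps)
    also have "\<dots> \<le> ((Suc e + j) choose j) + ((e + Suc j) choose Suc j)"
      using card_image_le[OF finite_lform_monomials] Suc.IH \<open>\<And>e. card (lform_monomials l (Suc j) e) \<le> ((e + j) choose j)\<close>[of "Suc e"]
      by (intro add_mono) (blast intro: order_trans)+
    also have "\<dots> = ((Suc e + Suc j) choose Suc j)" by simp
    finally show ?case .
  qed simp
qed

lemma lform_mult_lform_monomials:
  "i < j \<Longrightarrow> f \<in> lform_monomials l j e \<Longrightarrow> lform (l i) * f \<in> lform_monomials l j (Suc e)"
proof (induction l j e arbitrary: f rule: lform_monomials.induct)
  case (1 l j)
  then show ?case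
  proof (induction j)
    case (Suc j)
    then show ?case by (cases "i = j") auto
  qed simp
next
  case (2 l e)
  then show ?case by simp
next
  case (3 l j e)
  show ?case
  proof (cases "i = j")
    case True
    have "lform (l j) * f \<in> (\<lambda>f. lform (l j) * f) ` lform_monomials l (Suc j) (Suc e)"
      using 3(4) by (rule imageI)
    then show ?thesis unfolding True by (subst lform_monomials.simps) (rule UnI2)
  next
    case False
    then have i: "i < j" using 3 by simp
    from 3(4) consider "f \<in> lform_monomials l j (Suc e)"
      | g where "f = lform (l j) * g" "g \<in> lform_monomials l (Suc j) e" by auto
    then show ?thesis
    proof cases
      case 1
      then show ?thesis using 3(1)[OF i] by (subst lform_monomials.simps) blast
    next
      case 2
      then have "lform (l i) * g \<in> lform_monomials l (Suc j) (Suc e)" using 3(2,3) by blast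
      then have "lform (l j) * (lform (l i) * g) \<in> lform_monomials l (Suc j) (Suc (Suc e))"
        by (subst lform_monomials.simps) blast
      then show ?thesis unfolding 2 by (simp only: mult.left_commute)
    qed
  qed
qed

text \<open>
  The matching upper bound. Repeated use of \<open>forms_mod_lforms\<close> rewrites each form on \<open>C\<close> into monomials in
  the \<open>Suc k\<close> linear forms with coefficients of degree less than \<open>D\<close>. Thus the Hilbert function grows no faster
  than the number of such monomials, up to the factor \<open>K\<close> that counts the coefficient monomials.
\<close>

lemma forms_spanned_mod_cone:
  fixes C :: "(complex ^ 'n::finite) set"
  assumes "acone C" "\<And>x. x \<in> C \<Longrightarrow> \<exists>j<Suc k. lform (l j) x \<noteq> 0"
  obtains K where "\<And>e. \<exists>B. finite B \<and> card B \<le> K * ((e + k) choose k) \<and>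
    (\<forall>f\<in>forms e. \<exists>h\<in>fv.span B. \<forall>x\<in>C. f x = h x)"
proof -
  obtain D where D: "D \<ge> 1" 
    "\<And>g. g \<in> forms D \<Longrightarrow> \<exists>q. (\<forall>j. q j \<in> forms (D - 1)) \<and> (\<forall>x\<in>C. g x = (\<Sum>j<Suc k. lform (l j) x * q j x))"
    using forms_mod_lforms[OF assms] by blast
  define B where "B e = (\<Union>b\<in>{..<D} \<inter> {..e}. (\<lambda>(m, p). mfun m * p) ` (exps b \<times> lform_monomials l (Suc k) (e - b)))"
    for e
  define K where "K = (\<Sum>b<D. card (exps b :: ('n \<Rightarrow> nat) set))"
  have finB: "finite (B e)" for e
    unfolding B_def by (intro finite_UN_I finite_imageI finite_cartesian_product finite_exps finite_lform_monomials) auto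
  have cardB: "card (B e) \<le> K * ((e + k) choose k)" for e
  proof -
    have "card (B e) \<le> (\<Sum>b\<in>{..<D} \<inter> {..e}. card ((\<lambda>(m, p). mfun m * p) ` ((exps b :: ('n \<Rightarrow> nat) set) \<times> lform_monomials l (Suc k) (e - b))))"
      unfolding B_def by (rule card_UN_le) auto
    also have "\<dots> \<le> (\<Sum>b\<in>{..<D} \<inter> {..e}. card (exps b :: ('n \<Rightarrow> nat) set) * ((e + k) choose k))"
    proof (rule sum_mono)
      fix b assume "b \<in> {..<D} \<inter> {..e}"
      have "card ((\<lambda>(m, p). mfun m * p) ` ((exps b :: ('n \<Rightarrow> nat) set) \<times> lform_monomials l (Suc k) (e - b)))
          \<le> card ((exps b :: ('n \<Rightarrow> nat) set) \<times> lform_monomials l (Suc k) (e - b))"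
        by (intro card_image_le finite_cartesian_product finite_exps finite_lform_monomials)
      also have "\<dots> = card (exps b :: ('n \<Rightarrow> nat) set) * card (lform_monomials l (Suc k) (e - b))"
        by (rule card_cartesian_product)
      also have "card (lform_monomials l (Suc k) (e - b)) \<le> ((e - b + k) choose k)" by (rule card_lform_monomials)
      also have "\<dots> \<le> ((e + k) choose k)" by (rule binomial_right_mono) simp
      finally show "card ((\<lambda>(m, p). mfun m * p) ` ((exps b :: ('n \<Rightarrow> nat) set) \<times> lform_monomials l (Suc k) (e - b)))
          \<le> card (exps b :: ('n \<Rightarrow> nat) set) * ((e + k) choose k)" by simp
    qed
    also have "\<dots> \<le> (\<Sum>b<D. card (exps b :: ('n \<Rightarrow> nat) set) * ((e + k) choose k))"
      by (rule sum_mono2) auto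
    also have "\<dots> = K * ((e + k) choose k)" by (simp add: K_def sum_distrib_right)
    finally show ?thesis .
  qed
  have "\<exists>h\<in>fv.span (B e). \<forall>x\<in>C. f x = h x" if "f \<in> forms e" for e f
    using that
  proof (induction e arbitrary: f rule: less_induct)
    case (less e)
    show ?case
    proof (cases "e < D")
      case True
      have "forms e \<subseteq> fv.span (B e)"
        unfolding forms_def
      proof (intro fv.span_mono subsetI)
        fix g :: "complex ^ 'n \<Rightarrow> complex" assume "g \<in> mfun ` exps e"
        then obtain m where m: "m \<in> exps e" "g = mfun m * 1" by auto
        then have "g \<in> (\<lambda>(m, p). mfun m * p) ` (exps e \<times> lform_monomials l (Suc k) (e - e))"
          by (intro image_eqI[of _ _ "(m, 1)"]) auto
        then show "g \<in> B e" using True unfolding B_def by blast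
      qed
      then show ?thesis using less.prems by blast
    next
      case False
      then have e: "e = D + (e - D)" by simp
      have step: "lform (l j) * r \<in> fv.span (B e)" if r: "r \<in> fv.span (B (e - 1))" "j < Suc k" for j r
      proof (rule fv_span_mult[OF _ r(1)])
        show "lform (l j) \<in> fv.span {lform (l j)}" by (intro fv.span_base) simp
        fix a b assume "a \<in> {lform (l j)}" and b: "b \<in> B (e - 1)"
        from b obtain b' m p where *: "b' < D" "b' \<le> e - 1" "m \<in> exps b'"
          "p \<in> lform_monomials l (Suc k) (e - 1 - b')" "b = mfun m * p"
          unfolding B_def by auto
        have "lform (l j) * p \<in> lform_monomials l (Suc k) (Suc (e - 1 - b'))"
          by (rule lform_mult_lform_monomials[OF r(2) *(4)])
        moreover have "Suc (e - 1 - b') = e - b'" using * False D(1) by simp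
        ultimately have p': "lform (l j) * p \<in> lform_monomials l (Suc k) (e - b')" by (simp only:)
        have ab: "a * b = mfun m * (lform (l j) * p)"
          using \<open>a \<in> _\<close> *(5) by (simp add: mult.left_commute)
        have "a * b \<in> (\<lambda>(m, p). mfun m * p) ` (exps b' \<times> lform_monomials l (Suc k) (e - b'))"
          unfolding ab by (rule image_eqI[of _ _ "(m, lform (l j) * p)"]) (use p' *(3) in auto)
        moreover have "b' \<in> {..<D} \<inter> {..e}" using * by auto
        ultimately have "a * b \<in> B e" unfolding B_def by blast
        then show "a * b \<in> fv.span (B e)" by (rule fv.span_base)
      qed
      have "f \<in> forms (D + (e - D))" using less.prems e by simp
      then show ?thesis
      proof (rule forms_split_induct[where P = "\<lambda>f. \<exists>h\<in>fv.span (B e). \<forall>x\<in>C. f x = h x"])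
        show "\<exists>h\<in>fv.span (B e). \<forall>x\<in>C. 0 x = h x" by (rule bexI[OF _ fv.span_zero]) simp
      next
        fix g f :: "complex ^ 'n \<Rightarrow> complex" assume gf: "g \<in> forms D" "f \<in> forms (e - D)"
        obtain q where q: "\<And>j. q j \<in> forms (D - 1)" "\<And>x. x \<in> C \<Longrightarrow> g x = (\<Sum>j<Suc k. lform (l j) x * q j x)"
          using D(2)[OF gf(1)] by blast
        have "q j * f \<in> forms (e - 1)" for j
          using forms_mult[OF q(1) gf(2), of j] False D(1) by simp
        moreover have "e - 1 < e" using False D(1) by simp
        ultimately have "\<forall>j. \<exists>h\<in>fv.span (B (e - 1)). \<forall>x\<in>C. (q j * f) x = h x"
          by (intro allI less.IH)
        then obtain h where h: "\<And>j. h j \<in> fv.span (B (e - 1))" "\<And>j x. x \<in> C \<Longrightarrow> (q j * f) x = h j x" by metis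
        have "(\<Sum>j<Suc k. lform (l j) * h j) \<in> fv.span (B e)"
          by (intro fv.span_sum step h) simp
        moreover have "(g * f) x = (\<Sum>j<Suc k. lform (l j) * h j) x" if "x \<in> C" for x
          unfolding times_fun_apply sum_fun_apply q(2)[OF that] sum_distrib_right h(2)[OF that, symmetric]
          by (simp only: mult.assoc)
        ultimately show "\<exists>h\<in>fv.span (B e). \<forall>x\<in>C. (g * f) x = h x" by blast
      next
        fix f g :: "complex ^ 'n \<Rightarrow> complex" assume "\<exists>h\<in>fv.span (B e). \<forall>x\<in>C. f x = h x" "\<exists>h\<in>fv.span (B e). \<forall>x\<in>C. g x = h x"
        then obtain h h' where "h \<in> fv.span (B e)" "\<forall>x\<in>C. f x = h x" "h' \<in> fv.span (B e)" "\<forall>x\<in>C. g x = h' x" by blast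
        then show "\<exists>h\<in>fv.span (B e). \<forall>x\<in>C. (f + g) x = h x"
          by (intro bexI[of _ "h + h'"] fv.span_add) auto
      qed
    qed
  qed
  then show thesis using finB cardB by (intro that[of K]) blast
qed

lemma indep_on_le_card:
  assumes "indep_on C e m" "finite B" "\<And>f. f \<in> forms e \<Longrightarrow> \<exists>h\<in>fv.span B. \<forall>x\<in>C. f x = h x"
  shows "m \<le> card B"
proof (rule ccontr)
  assume m: "\<not> m \<le> card B"
  obtain f where f: "\<And>i. i < m \<Longrightarrow> f i \<in> forms e"
    "\<And>c. (\<forall>x\<in>C. (\<Sum>i<m. c i * f i x) = 0) \<Longrightarrow> (\<forall>i<m. c i = 0)"
    using assms(1) unfolding indep_on_def by blast
  have "\<forall>i. \<exists>h. i < m \<longrightarrow> h \<in> fv.span B \<and> (\<forall>x\<in>C. f i x = h x)" using f(1) assms(3) by blast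
  then obtain h where h: "\<And>i. i < m \<Longrightarrow> h i \<in> fv.span B" "\<And>i x. i < m \<Longrightarrow> x \<in> C \<Longrightarrow> f i x = h i x"
    unfolding choice_iff by blast
  obtain u where u: "\<exists>i\<in>{..<m}. u i \<noteq> 0" "\<And>x. (\<Sum>i<m. u i * h i x) = 0"
    using dependent_of_card_gt[OF assms(2), of "{..<m}" h] h(1) m by auto
  have "(\<Sum>i<m. u i * f i x) = 0" if "x \<in> C" for x
    using u(2)[of x] h(2)[OF _ that] by simp
  then show False using f(2)[of u] u(1) by blast
qed

text \<open>
  The lower bound of order \<open>k\<close> from the chain contradicts the upper bound of order \<open>k - 1\<close> if the section is
  missed.
\<close>

theorem irreducible_chain_meets_linear_section:
  fixes Z :: "nat \<Rightarrow> (complex ^ 'n::finite) set"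
  assumes "\<And>i. i \<le> k \<Longrightarrow> irr_cone (Z i)" "\<And>i. i < k \<Longrightarrow> Z i \<subset> Z (Suc i)"
  shows "\<exists>x\<in>Z k. \<forall>j<k. lform (l j) x = 0"
proof (cases k)
  case 0
  then show ?thesis using assms(1)[of 0] by (auto simp: irr_cone_def)
next
  case (Suc j)
  show ?thesis
  proof (rule ccontr)
    assume no: "\<not> ?thesis"
    obtain a where a: "\<And>i M. i \<le> k \<Longrightarrow> indep_on (Z i) (a * M) ((M + i) choose i)"
      using indep_on_chain[where Z = Z and k = k] assms by blast
    have "acone (Z k)" using assms(1)[of k] by (simp add: irr_cone_def)
    then obtain K where K: "\<And>e. \<exists>B. finite B \<and> card B \<le> K * ((e + j) choose j) \<and>
        (\<forall>f\<in>forms e. \<exists>h\<in>fv.span B. \<forall>x\<in>Z k. f x = h x)"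
    proof (rule forms_spanned_mod_cone[of "Z k" j l])
      show "\<exists>i<Suc j. lform (l i) x \<noteq> 0" if "x \<in> Z k" for x using no that Suc by blast
    qed blast
    have le: "(M + k) choose k \<le> K * ((a * M + j) choose j)" for M
    proof -
      obtain B where B: "finite B" "card B \<le> K * ((a * M + j) choose j)"
        "\<And>f. f \<in> forms (a * M) \<Longrightarrow> \<exists>h\<in>fv.span B. \<forall>x\<in>Z k. f x = h x" using K[of "a * M"] by blast
      have "(M + k) choose k \<le> card B" by (rule indep_on_le_card[OF a[OF order_refl] B(1,3)])
      then show ?thesis using B(2) by simp
    qed
    \<comment> \<open>With \<open>N = M + k\<close> the two bounds give \<open>(N / k) ^ k \<le> K * ((a + 1) * N) ^ (k - 1)\<close>, that is \<open>N \<le> M\<close>.\<close>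
    define M where "M = K * k ^ k * (a + 1) ^ j"
    define N where "N = M + k"
    have "(real N / real k) ^ k \<le> real (N choose k)"
      using binomial_ge_n_over_k_pow_k[of k N, where 'a = real] by (simp add: N_def)
    also have "\<dots> \<le> real (K * ((a * M + j) choose j))" using le[of M] unfolding N_def by (simp only: of_nat_le_iff)
    also have "\<dots> \<le> real (K * (a * M + j) ^ j)"
      using binomial_le_pow[of j "a * M + j"] by (simp only: of_nat_le_iff) simp
    also have "\<dots> \<le> real (K * ((a + 1) * N) ^ j)"
      unfolding of_nat_le_iff by (intro mult_left_mono power_mono) (simp_all add: N_def Suc algebra_simps)
    finally have "real N ^ k \<le> real (K * ((a + 1) * N) ^ j) * real k ^ k"
      using Suc by (simp add: power_divide divide_le_eq)
    then have "real (N ^ k) \<le> real (K * ((a + 1) * N) ^ j * k ^ k)" by simp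
    then have "N ^ k \<le> K * ((a + 1) * N) ^ j * k ^ k" by (simp only: of_nat_le_iff)
    also have "\<dots> = M * N ^ j" by (simp only: M_def power_mult_distrib ac_simps)
    finally have "N * N ^ j \<le> M * N ^ j" by (simp add: Suc)
    moreover have "N ^ j > 0" by (simp add: N_def Suc)
    ultimately have "N \<le> M" by (metis mult_le_cancel2)
    then show False by (simp add: N_def Suc)
  qed
qed

section \<open>Genericity of linear sections and thick cones\<close>

text \<open>
  Evaluations at the points \<open>x t\<close> are eigenvectors, with distinct eigenvalues \<open>- 1 / t\<close>, of the dual of
  \<open>g \<mapsto> g'\<close>. They are independent by the usual induction on the number of eigenvectors.
\<close>

lemma eigenfunctional_relation_trivial:
  fixes x :: "complex \<Rightarrow> 'a" and V :: "('a \<Rightarrow> complex) set"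
  assumes "finite T" "0 \<notin> T"
    and "\<And>g. g \<in> V \<Longrightarrow> \<exists>g'\<in>V. \<forall>t\<in>T. g (x t) = - t * g' (x t)"
    and "\<And>t. t \<in> T \<Longrightarrow> \<exists>g\<in>V. g (x t) \<noteq> 0"
    and "\<And>g. g \<in> V \<Longrightarrow> (\<Sum>t\<in>T. u t * g (x t)) = 0"
  shows "\<forall>t\<in>T. u t = 0"
  using assms
proof (induction T arbitrary: u rule: finite_induct)
  case empty
  then show ?case by simp
next
  case (insert t0 T)
  have t0: "t0 \<noteq> 0" using insert.prems(1) by auto
  \<comment> \<open>Applying the operator and eliminating the eigenvector of \<open>t0\<close> leaves a shorter relation.\<close>
  have "\<forall>t\<in>T. u t * (1 / t0 - 1 / t) = 0"
  proof (rule insert.IH)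
    show "0 \<notin> T" using insert.prems(1) by auto
    show "\<exists>g'\<in>V. \<forall>t\<in>T. g (x t) = - t * g' (x t)" if "g \<in> V" for g
      using insert.prems(2)[OF that] by auto
    show "\<exists>g\<in>V. g (x t) \<noteq> 0" if "t \<in> T" for t using insert.prems(3) that by auto
    fix g assume g: "g \<in> V"
    obtain g' where g': "g' \<in> V" "\<And>t. t \<in> insert t0 T \<Longrightarrow> g (x t) = - t * g' (x t)"
      using insert.prems(2)[OF g] by blast
    have "(\<Sum>t\<in>insert t0 T. u t * g (x t)) / t0 + (\<Sum>t\<in>insert t0 T. u t * g' (x t)) = 0"
      using insert.prems(4)[OF g] insert.prems(4)[OF g'(1)] by simp
    also have "(\<Sum>t\<in>insert t0 T. u t * g (x t)) / t0 + (\<Sum>t\<in>insert t0 T. u t * g' (x t))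
        = (\<Sum>t\<in>insert t0 T. u t * (1 / t0 - 1 / t) * g (x t))"
      unfolding sum_divide_distrib sum.distrib[symmetric]
    proof (rule sum.cong[OF refl])
      fix t assume t: "t \<in> insert t0 T"
      then have "t \<noteq> 0" using insert.prems(1) by auto
      then show "u t * g (x t) / t0 + u t * g' (x t) = u t * (1 / t0 - 1 / t) * g (x t)"
        using t0 by (simp add: g'(2)[OF t] field_simps)
    qed
    finally show "(\<Sum>t\<in>T. u t * (1 / t0 - 1 / t) * g (x t)) = 0"
      using insert.hyps by simp
  qed
  then have uT: "\<forall>t\<in>T. u t = 0"
    using insert.hyps(2) by (auto simp: divide_eq_eq_1)
  obtain g where g: "g \<in> V" "g (x t0) \<noteq> 0" using insert.prems(3) by blast
  have "(\<Sum>t\<in>T. u t * g (x t)) = 0" using uT by simp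
  then have "u t0 * g (x t0) = 0" using insert.prems(4)[OF g(1)] insert.hyps by simp
  then show ?case using uT g by simp
qed

text \<open>
  A cone that misses a linear section misses almost all sections in a pencil through it. At a point
  \<open>x\<close> of \<open>A\<close> on the section with parameter \<open>t\<close> one has \<open>l\<^sub>j x = - t * h\<^sub>j x\<close>. Substituting this into the expressions
  of \<open>forms_mod_lforms\<close> makes the evaluation of forms of degree \<open>D\<close> at \<open>x\<close> an eigenvector for the eigenvalue
  \<open>- 1 / t\<close>, and the forms of degree \<open>D\<close> have finite dimension.
\<close>

lemma finite_parameters_meeting_cone:
  fixes A :: "(complex ^ 'n::finite) set"
  assumes A: "acone A" and miss: "\<And>x. x \<in> A \<Longrightarrow> \<exists>j<k::nat. lform (l j) x \<noteq> 0"
  shows "finite {t. \<exists>x\<in>A. \<forall>j<k. lform (l j + t *s h j) x = 0}"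
proof (rule ccontr)
  assume inf: "infinite {t. \<exists>x\<in>A. \<forall>j<k. lform (l j + t *s h j) x = 0}"
  obtain D where D: "D \<ge> 1"
    "\<And>g. g \<in> forms D \<Longrightarrow> \<exists>q. (\<forall>j. q j \<in> forms (D - 1)) \<and> (\<forall>x\<in>A. g x = (\<Sum>j<k. lform (l j) x * q j x))"
    using forms_mod_lforms[OF A miss] by blast
  define M where "M = (exps D :: ('n \<Rightarrow> nat) set)"
  obtain T where T: "T \<subseteq> {t. \<exists>x\<in>A. \<forall>j<k. lform (l j + t *s h j) x = 0}" "finite T" "card T = Suc (card M)"
    using infinite_arbitrarily_large[OF inf] by blast
  have "\<forall>t. \<exists>x. t \<in> T \<longrightarrow> x \<in> A \<and> (\<forall>j<k. lform (l j + t *s h j) x = 0)" using T(1) by blast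
  then obtain x where x: "\<And>t. t \<in> T \<Longrightarrow> x t \<in> A" "\<And>t j. t \<in> T \<Longrightarrow> j < k \<Longrightarrow> lform (l j + t *s h j) (x t) = 0"
    unfolding choice_iff by blast
  have lx: "lform (l j) (x t) = - t * lform (h j) (x t)" if "t \<in> T" "j < k" for t j
    using x(2)[OF that] by (simp add: lform_add_left lform_scale_left eq_neg_iff_add_eq_0)
  define \<delta> where "\<delta> m = (\<lambda>m'. if m' = m then 1 else 0 :: complex)" for m :: "'n \<Rightarrow> nat"
  define a where "a t = (\<lambda>m. if m \<in> M then mfun m (x t) else 0)" for t
  have finM: "finite M" by (simp add: M_def finite_exps)
  have "a t \<in> fv.span (\<delta> ` M)" for t
  proof -
    have "a t = (\<Sum>m\<in>M. fscale (mfun m (x t)) (\<delta> m))"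
    proof
      fix m
      have "(\<Sum>m'\<in>M. mfun m' (x t) * \<delta> m' m) = (\<Sum>m'\<in>M. if m' = m then mfun m (x t) else 0)"
        by (rule sum.cong) (auto simp: \<delta>_def)
      then show "a t m = (\<Sum>m\<in>M. fscale (mfun m (x t)) (\<delta> m)) m"
        using finM by (simp add: a_def fscale_apply)
    qed
    moreover have "(\<Sum>m\<in>M. fscale (mfun m (x t)) (\<delta> m)) \<in> fv.span (\<delta> ` M)"
      by (intro fv.span_sum fv.span_scale fv.span_base) simp
    ultimately show ?thesis by (simp only:)
  qed
  moreover have "card T > card (\<delta> ` M)" using T(3) card_image_le[OF finM, of \<delta>] by simp
  ultimately obtain u where u: "\<exists>t\<in>T. u t \<noteq> 0" "\<And>m. (\<Sum>t\<in>T. u t * a t m) = 0"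
    using dependent_of_card_gt[of "\<delta> ` M" T a] finM T(2) by auto
  have rel: "(\<Sum>t\<in>T. u t * g (x t)) = 0" if "g \<in> forms D" for g
    using that
  proof (induction rule: forms_induct)
    case zero
    then show ?case by simp
  next
    case (step c m g)
    have "(\<Sum>t\<in>T. u t * (fscale c (mfun m) + g) (x t)) = c * (\<Sum>t\<in>T. u t * mfun m (x t)) + (\<Sum>t\<in>T. u t * g (x t))"
      by (simp add: fscale_apply sum_distrib_left sum.distrib algebra_simps)
    then show ?case using step u(2)[of m] by (simp add: a_def M_def)
  qed
  have "\<forall>t\<in>T. u t = 0"
  proof (rule eigenfunctional_relation_trivial[OF T(2), where V = "forms D" and x = x])
    show "0 \<notin> T"
    proof
      assume 0: "0 \<in> T"
      then show False using miss[OF x(1)[OF 0]] lx[OF 0] by auto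
    qed
    fix g :: "complex ^ 'n \<Rightarrow> complex" assume g: "g \<in> forms D"
    obtain q where q: "\<And>j. q j \<in> forms (D - 1)" "\<And>x. x \<in> A \<Longrightarrow> g x = (\<Sum>j<k. lform (l j) x * q j x)"
      using D(2)[OF g] by blast
    have "lform (h j) * q j \<in> forms D" for j
      using forms_mult[OF forms_lform q(1)] D(1) by simp
    then have "(\<Sum>j<k. lform (h j) * q j) \<in> forms D" by (intro forms_sum)
    moreover have "g (x t) = - t * (\<Sum>j<k. lform (h j) * q j) (x t)" if "t \<in> T" for t
      unfolding q(2)[OF x(1)[OF that]] sum_fun_apply sum_distrib_left
      using lx[OF that] by (intro sum.cong) auto
    ultimately show "\<exists>g'\<in>forms D. \<forall>t\<in>T. g (x t) = - t * g' (x t)" by blast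
  next
    fix t assume t: "t \<in> T"
    show "\<exists>g\<in>forms D. g (x t) \<noteq> 0" using coord_power_nonzero[OF A x(1)[OF t], of D] by blast
  qed (rule rel)
  then show False using u(1) by blast
qed

definition thick :: "nat \<Rightarrow> (complex ^ 'n::finite) set \<Rightarrow> bool" where
  "thick k C \<longleftrightarrow> (\<forall>l. \<exists>x\<in>C. \<forall>j<k. lform (l j) x = 0)"

text \<open>
  The two cones each miss almost all members of the pencil joining a section missed by \<open>A\<close> to a section
  missed by \<open>B\<close>.
\<close>

lemma thick_Un:
  fixes A B :: "(complex ^ 'n::finite) set"
  assumes "acone A" "acone B" "thick k (A \<union> B)"
  shows "thick k A \<or> thick k B"
proof (rule ccontr)
  assume "\<not> ?thesis"
  then obtain l m where l: "\<And>x. x \<in> A \<Longrightarrow> \<exists>j<k. lform (l j) x \<noteq> 0"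
    and m: "\<And>x. x \<in> B \<Longrightarrow> \<exists>j<k. lform (m j) x \<noteq> 0" unfolding thick_def by blast
  define TA where "TA = {t. \<exists>x\<in>A. \<forall>j<k. lform (l j + t *s (m j - l j)) x = 0}"
  define TB where "TB = {t. \<exists>x\<in>B. \<forall>j<k. lform (m j + t *s (l j - m j)) x = 0}"
  have "finite TA" unfolding TA_def by (rule finite_parameters_meeting_cone[OF assms(1) l])
  moreover have "finite TB" unfolding TB_def by (rule finite_parameters_meeting_cone[OF assms(2) m])
  ultimately have "finite (TA \<union> (\<lambda>s. 1 - s) ` TB)" by simp
  then obtain t where t: "t \<notin> TA" "t \<notin> (\<lambda>s. 1 - s) ` TB"
    using ex_new_if_finite[OF infinite_UNIV_char_0, of "TA \<union> (\<lambda>s. 1 - s) ` TB"] by blast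
  have "1 - t \<notin> TB"
  proof
    assume "1 - t \<in> TB"
    then have "1 - (1 - t) \<in> (\<lambda>s. 1 - s) ` TB" by (rule imageI)
    then show False using t(2) by simp
  qed
  moreover have "m j + (1 - t) *s (l j - m j) = l j + t *s (m j - l j)" for j
    by (auto simp: vec_eq_iff algebra_simps)
  ultimately have "\<not> thick k (A \<union> B)"
    using t(1) unfolding thick_def TA_def TB_def
    by (auto intro!: exI[of _ "\<lambda>j. l j + t *s (m j - l j)"])
  then show False using assms(3) by blast
qed

lemma continuous_on_mfun: "continuous_on A (mfun m)"
  unfolding mfun_def[abs_def] by (intro continuous_intros)

lemma continuous_on_forms: "f \<in> forms d \<Longrightarrow> continuous_on A f"
proof (induction rule: forms_induct)
  case zero
  show ?case by (simp add: zero_fun_def)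
next
  case (step c m g)
  then show ?case unfolding plus_fun_def fscale_def
    by (intro continuous_intros continuous_on_mfun)
qed

lemma compact_acone_sphere:
  assumes "acone C"
  shows "compact {x \<in> C. norm x = 1 \<and> (\<forall>j<k. lform (l j) x = 0)}"
proof -
  obtain S where S: "S \<subseteq> (\<Union>d. forms d)" "C = zero_cone S" using assms by (auto simp: acone_def)
  have cl: "closed {x. f x = 0}" if "f \<in> forms d" for f :: "complex^'a \<Rightarrow> complex" and d
    by (rule closed_Collect_eq) (auto intro: continuous_on_forms[OF that])
  have "closed ((\<Inter>f\<in>S. {x. f x = 0}) \<inter> (\<Inter>j\<in>{..<k}. {x. lform (l j) x = 0}))"
    using S(1) cl forms_lform by (intro closed_Int closed_INT ballI) blast+
  moreover have "{x \<in> C. norm x = 1 \<and> (\<forall>j<k. lform (l j) x = 0)} =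
      sphere 0 1 \<inter> ((\<Inter>f\<in>S. {x. f x = 0}) \<inter> (\<Inter>j\<in>{..<k}. {x. lform (l j) x = 0}))"
    by (auto simp: S(2) zero_cone_def)
  ultimately show ?thesis by (simp add: compact_Int_closed)
qed

lemma acone_normalize:
  assumes "acone C" "x \<in> C"
  obtains t where "t \<noteq> 0" "t *s x \<in> C" "norm (t *s x) = 1"
proof -
  have nz: "x \<noteq> 0" using acone_nonzero[OF assms] .
  define t where "t = complex_of_real (inverse (norm x))"
  have "(t *s x) $ i = (inverse (norm x) *\<^sub>R x) $ i" for i
    unfolding vector_smult_component vector_scaleR_component t_def by (simp only: scaleR_conv_of_real)
  then have "t *s x = inverse (norm x) *\<^sub>R x" by (intro vec_eq_iff[THEN iffD2] allI)
  then have "norm (t *s x) = 1" using nz by simp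
  moreover have "t \<noteq> 0" using nz by (simp add: t_def)
  ultimately show thesis using that acone_scale[OF assms] by blast
qed

lemma acone_Inter:
  assumes "\<And>C. C \<in> \<C> \<Longrightarrow> acone C" "\<C> \<noteq> {}"
  shows "acone (\<Inter>\<C>)"
proof -
  have "\<forall>C. \<exists>S. C \<in> \<C> \<longrightarrow> S \<subseteq> (\<Union>d. forms d) \<and> C = zero_cone S" using assms(1) unfolding acone_def by blast
  then obtain S where S: "\<And>C. C \<in> \<C> \<Longrightarrow> S C \<subseteq> (\<Union>d. forms d)" "\<And>C. C \<in> \<C> \<Longrightarrow> C = zero_cone (S C)"
    unfolding choice_iff by blast
  have "x \<in> \<Inter>\<C> \<longleftrightarrow> x \<in> zero_cone (\<Union>C\<in>\<C>. S C)" for x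
  proof -
    have "x \<in> \<Inter>\<C> \<longleftrightarrow> (\<forall>C\<in>\<C>. x \<in> zero_cone (S C))" using S(2) by blast
    also have "\<dots> \<longleftrightarrow> x \<in> zero_cone (\<Union>C\<in>\<C>. S C)" using assms(2) by (auto simp: zero_cone_def)
    finally show ?thesis .
  qed
  then have "\<Inter>\<C> = zero_cone (\<Union>C\<in>\<C>. S C)" by blast
  moreover have "(\<Union>C\<in>\<C>. S C) \<subseteq> (\<Union>d. forms d)" using S(1) by blast
  ultimately show ?thesis unfolding acone_def by blast
qed

lemma finite_chain_has_least:
  assumes "finite \<F>" "\<F> \<noteq> {}" "\<forall>A\<in>\<F>. \<forall>B\<in>\<F>. A \<subseteq> B \<or> B \<subseteq> A"
  shows "\<exists>A\<in>\<F>. \<forall>B\<in>\<F>. A \<subseteq> B"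
  using assms
proof (induction rule: finite_ne_induct)
  case (singleton x)
  then show ?case by simp
next
  case (insert x F)
  then obtain A where A: "A \<in> F" "\<forall>B\<in>F. A \<subseteq> B" by blast
  then have "A \<subseteq> x \<or> x \<subseteq> A" using insert.prems by blast
  then show ?case using A by (elim disjE) (blast, metis insert_iff order_trans order_refl)
qed

text \<open>
  Each linear section meets the members of the chain in nested nonempty compact subsets of the unit
  sphere.
\<close>

lemma thick_Inter_chain:
  fixes \<C> :: "(complex ^ 'n::finite) set set"
  assumes "\<And>C. C \<in> \<C> \<Longrightarrow> acone C" "\<And>C. C \<in> \<C> \<Longrightarrow> thick k C" "\<C> \<noteq> {}"
    and chain: "\<And>A B. A \<in> \<C> \<Longrightarrow> B \<in> \<C> \<Longrightarrow> A \<subseteq> B \<or> B \<subseteq> A"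
  shows "thick k (\<Inter>\<C>)"
  unfolding thick_def
proof
  fix l
  define K where "K C = {x \<in> C. norm x = 1 \<and> (\<forall>j<k. lform (l j) x = 0)}" for C :: "(complex ^ 'n) set"
  obtain C0 where C0: "C0 \<in> \<C>" using assms(3) by blast
  have ne: "K C \<noteq> {}" if C: "C \<in> \<C>" for C
  proof -
    obtain x where x: "x \<in> C" "\<And>j. j < k \<Longrightarrow> lform (l j) x = 0" using assms(2)[OF C] unfolding thick_def by blast
    obtain t where "t \<noteq> 0" "t *s x \<in> C" "norm (t *s x) = 1" using acone_normalize[OF assms(1)[OF C] x(1)] .
    then have "t *s x \<in> K C" using x(2) by (simp add: K_def lform_scale_right)
    then show ?thesis by blast
  qed
  have "K C0 \<inter> \<Inter>(K ` \<C>) \<noteq> {}"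
  proof (rule compact_imp_fip)
    show "compact (K C0)" unfolding K_def by (rule compact_acone_sphere[OF assms(1)[OF C0]])
    show "closed T" if "T \<in> K ` \<C>" for T
      using that compact_acone_sphere[OF assms(1)] unfolding K_def by (auto intro: compact_imp_closed)
    fix F' assume F': "finite F'" "F' \<subseteq> K ` \<C>"
    then obtain F where F: "F \<subseteq> \<C>" "finite F" "F' = K ` F" by (meson finite_subset_image)
    have "\<exists>A\<in>insert C0 F. \<forall>B\<in>insert C0 F. A \<subseteq> B"
    proof (intro finite_chain_has_least ballI chain)
      show "A \<in> \<C>" if "A \<in> insert C0 F" for A using that F(1) C0 by blast
      show "A \<in> \<C>" if "A \<in> insert C0 F" for A using that F(1) C0 by blast
    qed (use F(2) in auto)
    then obtain A where A: "A \<in> insert C0 F" "\<forall>B\<in>insert C0 F. A \<subseteq> B" by (rule bexE)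
    have "A \<in> \<C>" using A(1) F C0 by blast
    then obtain x where "x \<in> K A" using ne by blast
    moreover have "K A \<subseteq> K B" if "B \<in> insert C0 F" for B using A(2) that by (auto simp: K_def)
    ultimately show "K C0 \<inter> \<Inter>F' \<noteq> {}" unfolding F(3) by blast
  qed
  then show "\<exists>x\<in>\<Inter>\<C>. \<forall>j<k. lform (l j) x = 0" using C0 by (auto simp: K_def)
qed

text \<open>
  Zorn's lemma is applied to the complements, because it is available for maximal sets.
\<close>

lemma exists_minimal_thick:
  fixes C :: "(complex ^ 'n::finite) set"
  assumes "acone C" "thick k C"
  obtains Z where "acone Z" "thick k Z" "Z \<subseteq> C"
    "\<And>Y. acone Y \<Longrightarrow> thick k Y \<Longrightarrow> Y \<subseteq> Z \<Longrightarrow> Y = Z"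
proof -
  define A where "A = uminus ` {Y. acone Y \<and> thick k Y \<and> Y \<subseteq> C}"
  have "\<exists>M\<in>A. \<forall>X\<in>A. M \<subseteq> X \<longrightarrow> X = M"
  proof (rule subset_Zorn_nonempty)
    show "A \<noteq> {}" using assms by (auto simp: A_def)
    fix \<C> assume ne: "\<C> \<noteq> {}" and ch: "subset.chain A \<C>"
    define \<D> where "\<D> = uminus ` \<C>"
    have D: "acone Y" "thick k Y" "Y \<subseteq> C" if "Y \<in> \<D>" for Y
      using that ch unfolding \<D>_def A_def by (auto simp: subset_chain_def)
    have ne': "\<D> \<noteq> {}" using ne by (simp add: \<D>_def)
    have "thick k (\<Inter>\<D>)"
    proof (rule thick_Inter_chain[OF D(1,2) ne'])
      fix Y Y' assume "Y \<in> \<D>" "Y' \<in> \<D>"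
      then obtain X X' where "Y = - X" "Y' = - X'" "X \<in> \<C>" "X' \<in> \<C>" unfolding \<D>_def by blast
      moreover have "X \<subseteq> X' \<or> X' \<subseteq> X" using ch \<open>X \<in> \<C>\<close> \<open>X' \<in> \<C>\<close> by (auto simp: subset_chain_def)
      ultimately show "Y \<subseteq> Y' \<or> Y' \<subseteq> Y" by blast
    qed
    moreover have "acone (\<Inter>\<D>)" by (rule acone_Inter[OF D(1) ne'])
    moreover have "\<Inter>\<D> \<subseteq> C" using D(3) ne' by blast
    moreover have "\<Union>\<C> = - \<Inter>\<D>" unfolding \<D>_def by auto
    ultimately show "\<Union>\<C> \<in> A" unfolding A_def by blast
  qed
  then obtain M where M: "M \<in> A" and min: "\<And>X. X \<in> A \<Longrightarrow> M \<subseteq> X \<Longrightarrow> X = M" by blast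
  then obtain Z where Z: "acone Z" "thick k Z" "Z \<subseteq> C" and MZ: "M = - Z" by (auto simp: A_def)
  show thesis
  proof (rule that[OF Z])
    fix Y assume Y: "acone Y" "thick k Y" "Y \<subseteq> Z"
    then have "- Y \<in> A" using Z(3) unfolding A_def by blast
    then have "- Y = - Z" using min[of "- Y"] Y(3) MZ by blast
    then show "Y = Z" by simp
  qed
qed

text \<open>
  A minimal thick cone \<open>Y\<close> is irreducible by \<open>thick_Un\<close>; it is the top of the chain, and the rest is found
  in its intersection with a hyperplane that does not contain it.
\<close>

theorem thick_imp_irreducible_chain:
  fixes C :: "(complex ^ 'n::finite) set"
  assumes "acone C" "thick k C"
  shows "\<exists>Z :: nat \<Rightarrow> (complex ^ 'n) set. (\<forall>i\<le>k. irr_cone (Z i)) \<and> (\<forall>i<k. Z i \<subset> Z (Suc i)) \<and> Z k \<subseteq> C"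
  using assms
proof (induction k arbitrary: C)
  case (0 C)
  then obtain Y where Y: "acone Y" "thick 0 Y" "Y \<subseteq> C" "\<And>X. acone X \<Longrightarrow> thick 0 X \<Longrightarrow> X \<subseteq> Y \<Longrightarrow> X = Y"
    using exists_minimal_thick by metis
  have "irr_cone Y" unfolding irr_cone_def
  proof (intro conjI allI impI)
    show "Y \<noteq> {}" using Y(2) by (auto simp: thick_def)
    fix A B assume AB: "acone A \<and> acone B \<and> A \<union> B = Y"
    then have "thick 0 A \<or> thick 0 B" using thick_Un Y(2) by blast
    then show "A = Y \<or> B = Y" using AB Y(4) by blast
  qed (rule Y(1))
  then show ?case using Y(3) by (intro exI[of _ "\<lambda>_. Y"]) simp
next
  case (Suc k C)
  then obtain Y where Y: "acone Y" "thick (Suc k) Y" "Y \<subseteq> C" "\<And>X. acone X \<Longrightarrow> thick (Suc k) X \<Longrightarrow> X \<subseteq> Y \<Longrightarrow> X = Y"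
    using exists_minimal_thick by metis
  have ne: "Y \<noteq> {}" using Y(2) by (auto simp: thick_def)
  have irr: "irr_cone Y" unfolding irr_cone_def
  proof (intro conjI allI impI)
    fix A B assume AB: "acone A \<and> acone B \<and> A \<union> B = Y"
    then have "thick (Suc k) A \<or> thick (Suc k) B" using thick_Un Y(2) by blast
    then show "A = Y \<or> B = Y" using AB Y(4) by blast
  qed (rule Y(1), rule ne)
  obtain y where y: "y \<in> Y" using ne by blast
  then obtain i where i: "y $ i \<noteq> 0" using acone_nonzero[OF Y(1) y] by (auto simp: vec_eq_iff)
  define h where "h = (axis i 1 :: complex ^ 'n)"
  define Y' where "Y' = {x \<in> Y. lform h x = 0}"
  have "acone Y'" unfolding Y'_def by (rule acone_restrict[OF Y(1) forms_lform])
  moreover have "thick k Y'" unfolding thick_def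
  proof
    fix l :: "nat \<Rightarrow> complex ^ 'n"
    obtain x where x: "x \<in> Y" "\<And>j. j < Suc k \<Longrightarrow> lform ((l(k := h)) j) x = 0"
      using Y(2) unfolding thick_def by blast
    have "lform h x = 0" using x(2)[of k] by simp
    moreover have "lform (l j) x = 0" if "j < k" for j using x(2)[of j] that by simp
    ultimately show "\<exists>x\<in>Y'. \<forall>j<k. lform (l j) x = 0" using x(1) by (auto simp: Y'_def)
  qed
  ultimately obtain Z where Z: "\<And>i. i \<le> k \<Longrightarrow> irr_cone (Z i)" "\<And>i. i < k \<Longrightarrow> Z i \<subset> Z (Suc i)" "Z k \<subseteq> Y'"
    using Suc.IH by metis
  have "y \<notin> Y'" using i by (simp add: Y'_def h_def)
  then have sub: "Z k \<subset> Y" using Z(3) y by (auto simp: Y'_def)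
  show ?case
  proof (intro exI[of _ "Z(Suc k := Y)"] conjI allI impI)
    fix i assume "i \<le> Suc k"
    then show "irr_cone ((Z(Suc k := Y)) i)" using irr Z(1) by auto
  next
    fix i assume "i < Suc k"
    then show "(Z(Suc k := Y)) i \<subset> (Z(Suc k := Y)) (Suc i)" using sub Z(2) by (cases "i = k") auto
  qed (use Y(3) in simp)
qed

lemma norm_lform_le: "norm (lform h x) \<le> CARD('n) * (norm h * norm x)" for h x :: "complex ^ 'n::finite"
proof -
  have "norm (lform h x) \<le> (\<Sum>i\<in>UNIV. norm (h $ i * x $ i))"
    unfolding lform_def by (rule norm_sum)
  also have "\<dots> \<le> (\<Sum>i\<in>(UNIV :: 'n set). norm h * norm x)"
    by (intro sum_mono) (auto simp: norm_mult intro!: mult_mono Finite_Cartesian_Product.norm_nth_le)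
  finally show ?thesis by simp
qed

text \<open>
  On the compact set of unit vectors of \<open>C\<close> the sum \<open>\<Sum>j<k. norm (lform (l j) x)\<close> is bounded away from
  zero, so small changes of the linear forms cannot make it vanish.
\<close>

lemma missing_linear_section_open:
  fixes C :: "(complex ^ 'n::finite) set"
  assumes C: "acone C" and miss: "\<And>x. x \<in> C \<Longrightarrow> \<exists>j<k::nat. lform (l j) x \<noteq> 0"
  obtains \<epsilon> where "\<epsilon> > 0"
    "\<And>l'. (\<And>j. j < k \<Longrightarrow> dist (l' j) (l j) < \<epsilon>) \<Longrightarrow> (\<And>x. x \<in> C \<Longrightarrow> \<exists>j<k. lform (l' j) x \<noteq> 0)"
proof -
  define K where "K = {x \<in> C. norm x = 1}"
  define \<phi> where "\<phi> x = (\<Sum>j<k. norm (lform (l j) x))" for x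
  have cK: "compact K" using compact_acone_sphere[OF C, of 0 l] by (simp add: K_def)
  have c\<phi>: "continuous_on K \<phi>"
    unfolding \<phi>_def by (intro continuous_intros continuous_on_forms[OF forms_lform])
  have pos: "\<phi> x > 0" if "x \<in> K" for x
  proof -
    have "\<exists>j<k. lform (l j) x \<noteq> 0" using miss that by (simp add: K_def)
    then obtain j where "j < k" "lform (l j) x \<noteq> 0" by blast
    then show ?thesis unfolding \<phi>_def by (intro sum_pos2[of _ j]) auto
  qed
  obtain \<delta> where \<delta>: "\<delta> > 0" "\<And>x. x \<in> K \<Longrightarrow> \<delta> \<le> \<phi> x"
  proof (cases "K = {}")
    case True
    then show thesis using that[of 1] by simp
  next
    case False
    then obtain x where "x \<in> K" "\<And>y. y \<in> K \<Longrightarrow> \<phi> x \<le> \<phi> y"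
      using continuous_attains_inf[OF cK _ c\<phi>] by blast
    then show thesis using that[of "\<phi> x"] pos by blast
  qed
  define N where "N = real CARD('n)"
  have N: "N > 0" by (simp add: N_def)
  define \<epsilon> where "\<epsilon> = \<delta> / (N * (k + 1))"
  have \<epsilon>: "\<epsilon> > 0" using \<delta>(1) N by (simp add: \<epsilon>_def)
  have "\<exists>j<k. lform (l' j) x \<noteq> 0" if l': "\<And>j. j < k \<Longrightarrow> dist (l' j) (l j) < \<epsilon>" and x: "x \<in> C" for l' x
  proof (rule ccontr)
    assume no: "\<not> ?thesis"
    obtain t where t: "t \<noteq> 0" "t *s x \<in> C" "norm (t *s x) = 1" using acone_normalize[OF C x] .
    define y where "y = t *s x"
    have y: "y \<in> K" "norm y = 1" using t by (auto simp: K_def y_def)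
    have "\<phi> y \<le> (\<Sum>j<k. N * \<epsilon>)"
      unfolding \<phi>_def
    proof (rule sum_mono)
      fix j assume j: "j \<in> {..<k}"
      then have "lform (l' j) y = 0" using no by (simp add: y_def lform_scale_right)
      then have "norm (lform (l j) y) = norm (lform (l' j - l j) y)"
        by (simp add: lform_diff_left)
      also have "\<dots> \<le> N * (norm (l' j - l j) * norm y)" unfolding N_def by (rule norm_lform_le)
      also have "\<dots> \<le> N * \<epsilon>" using l'[of j] j N y(2) by (intro mult_left_mono) (auto simp: dist_norm)
      finally show "norm (lform (l j) y) \<le> N * \<epsilon>" .
    qed
    also have "\<dots> = k * (\<delta> / (k + 1))" using N by (simp add: \<epsilon>_def)
    also have "\<dots> < \<delta>" using \<delta>(1) by (simp add: field_simps)
    finally show False using \<delta>(2)[OF y(1)] by simp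
  qed
  then show thesis using that \<epsilon> by blast
qed

section \<open>Generic hyperplane sections\<close>

text \<open>
  For a bounded piece \<open>K\<close> of \<open>Z\<close>, no point lies in more than \<open>D\<close> of the translates of \<open>K\<close> by
  \<open>v / (j + 1)\<close>. As these translates have equal measure and stay in a fixed ball, the measure must be zero.
\<close>

lemma negligible_of_line_sections:
  fixes Z :: "'a::euclidean_space set"
  assumes "closed Z" "\<And>z. finite {t::real. z + t *\<^sub>R v \<in> Z}" "\<And>z. card {t::real. z + t *\<^sub>R v \<in> Z} \<le> D"
  shows "negligible Z"
proof (subst negligible_on_intervals, intro allI)
  fix a b :: 'a
  define K where "K = Z \<inter> cbox a b"
  have cK: "compact K" unfolding K_def by (intro closed_Int_compact assms(1) compact_cbox)
  have mK: "K \<in> lmeasurable" using cK by (rule lmeasurable_compact)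
  define s where "s j = 1 / (real j + 1)" for j
  define T where "T j = (+) (s j *\<^sub>R v) ` K" for j
  obtain R where R: "\<And>x. x \<in> K \<Longrightarrow> norm x \<le> R" using compact_imp_bounded[OF cK] by (auto simp: bounded_iff)
  define Q where "Q = cball (0::'a) (R + norm v)"
  have mQ: "Q \<in> lmeasurable" unfolding Q_def by simp
  have TQ: "T j \<subseteq> Q" for j
  proof
    fix y assume "y \<in> T j"
    then obtain x where x: "x \<in> K" "y = s j *\<^sub>R v + x" unfolding T_def by blast
    have "norm y \<le> \<bar>s j\<bar> * norm v + norm x" unfolding x(2) by (metis norm_triangle_ineq norm_scaleR)
    also have "\<dots> \<le> 1 * norm v + R" by (intro add_mono mult_right_mono R x(1)) (auto simp: s_def)
    finally show "y \<in> Q" by (simp add: Q_def)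
  qed
  have mT: "T j \<in> lmeasurable" "measure lebesgue (T j) = measure lebesgue K" for j
    unfolding T_def using mK by (auto simp: measurable_translation measure_translation)
  have intT: "integrable lebesgue (indicat_real (T j))" for j
    using mT(1)[of j] by (intro integrable_real_indicator) (simp_all only: fmeasurable_def mem_Collect_eq infinity_ennreal_def)
  have intQ: "integrable lebesgue (indicat_real Q)"
    using mQ by (intro integrable_real_indicator) (simp_all only: fmeasurable_def mem_Collect_eq infinity_ennreal_def)
  have inds: "(\<Sum>j<m. indicat_real (T j) x) \<le> D * indicat_real Q x" for m x
  proof (cases "x \<in> Q")
    case True
    have inj: "inj_on (\<lambda>j. - s j) A" for A by (auto simp: inj_on_def s_def)
    have "(\<Sum>j<m. indicat_real (T j) x) = card {j\<in>{..<m}. x \<in> T j}"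
      by (simp add: indicator_def sum.If_cases Int_def)
    also have "card {j\<in>{..<m}. x \<in> T j} = card ((\<lambda>j. - s j) ` {j\<in>{..<m}. x \<in> T j})"
      by (rule card_image[symmetric, OF inj])
    also have "\<dots> \<le> card {t::real. x + t *\<^sub>R v \<in> Z}"
      by (rule card_mono[OF assms(2)]) (auto simp: T_def K_def)
    also have "\<dots> \<le> D" by (rule assms(3))
    finally show ?thesis using True by simp
  next
    case False
    then have "x \<notin> T j" for j using TQ by blast
    then show ?thesis using False by simp
  qed
  have bound: "real m * measure lebesgue K \<le> D * measure lebesgue Q" for m
  proof -
    have "real m * measure lebesgue K = (\<Sum>j<m. LINT x|lebesgue. indicat_real (T j) x)"
      using mT by simp
    also have "\<dots> = (LINT x|lebesgue. (\<Sum>j<m. indicat_real (T j) x))"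
      using intT by (intro Bochner_Integration.integral_sum[symmetric])
    also have "\<dots> \<le> (LINT x|lebesgue. D * indicat_real Q x)"
      using intT intQ inds by (intro integral_mono Bochner_Integration.integrable_sum integrable_mult_right)
    also have "\<dots> = D * measure lebesgue Q" using mQ by simp
    finally show ?thesis .
  qed
  have "measure lebesgue K = 0"
  proof (rule ccontr)
    assume "measure lebesgue K \<noteq> 0"
    then have pos: "measure lebesgue K > 0" by (simp add: zero_less_measure_iff)
    obtain m where "real m > D * measure lebesgue Q / measure lebesgue K" using reals_Archimedean2 by blast
    then show False using bound[of m] pos by (simp add: divide_less_eq)
  qed
  then show "negligible (Z \<inter> cbox a b)" using mK negligible_iff_measure0 unfolding K_def by blast
qed

definition lincomb :: "('n::finite \<Rightarrow> complex ^ 'n) \<Rightarrow> complex ^ 'n \<Rightarrow> complex ^ 'n" where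
  "lincomb \<phi> z = (\<Sum>i\<in>UNIV. z $ i *s \<phi> i)"

lemma lincomb_add: "lincomb \<phi> (x + y) = lincomb \<phi> x + lincomb \<phi> y"
  by (simp add: lincomb_def vec.scale_left_distrib sum.distrib)

lemma lincomb_scale: "lincomb \<phi> (c *s x) = c *s lincomb \<phi> x"
  by (simp add: lincomb_def vec.scale_sum_right)

lemma lincomb_nth: "lincomb \<phi> z $ i = (\<Sum>j\<in>UNIV. z $ j * \<phi> j $ i)"
  by (simp add: lincomb_def sum_component)

lemma scaleR_vec_complex: "r *\<^sub>R x = complex_of_real r *s x" for x :: "complex ^ 'n"
proof (intro vec_eq_iff[THEN iffD2] allI)
  fix i show "(r *\<^sub>R x) $ i = (complex_of_real r *s x) $ i"
    unfolding vector_smult_component vector_scaleR_component by (rule scaleR_conv_of_real)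
qed

lemma linear_lincomb: "linear (lincomb \<phi>)"
  by (rule linearI) (simp_all only: lincomb_add scaleR_vec_complex lincomb_scale)

text \<open>
  Write \<open>z\<close> and \<open>v\<close> also for their images. On a line \<open>z + t v\<close> with \<open>f v \<noteq> 0\<close> a form of degree \<open>d\<close> has at most \<open>d\<close> zeros besides \<open>t = 0\<close>: by
  homogeneity, the zero \<open>t\<close> corresponds to the zero \<open>1 / t\<close> of the polynomial \<open>s \<mapsto> f (v + s z)\<close>, which does
  not vanish at \<open>0\<close>.
\<close>

lemma negligible_form_zeros:
  assumes f: "f \<in> forms d" and v: "f (lincomb \<phi> v) \<noteq> 0"
  shows "negligible {z. f (lincomb \<phi> z) = 0}"
proof (rule negligible_of_line_sections[where v = v and D = "Suc d"])
  have "continuous_on UNIV (\<lambda>z. f (lincomb \<phi> z))"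
    by (rule continuous_on_compose2[OF continuous_on_forms[OF f, of UNIV] linear_continuous_on[OF linear_lincomb[THEN linear_conv_bounded_linear[THEN iffD1]]]]) simp
  then show "closed {z. f (lincomb \<phi> z) = 0}"
    by (intro closed_Collect_eq) auto
  fix z
  define T where "T = {t::real. z + t *\<^sub>R v \<in> {z. f (lincomb \<phi> z) = 0}}"
  obtain p where p: "degree p \<le> d" "\<And>s. f (lincomb \<phi> v + s *s lincomb \<phi> z) = poly p s"
    using forms_on_line[OF f] by blast
  have "poly p 0 \<noteq> 0" using p(2)[of 0] v by simp
  then have p0: "p \<noteq> 0" by auto
  have sub: "(\<lambda>t. inverse (complex_of_real t)) ` (T - {0}) \<subseteq> {s. poly p s = 0}"
  proof
    fix s assume "s \<in> (\<lambda>t. inverse (complex_of_real t)) ` (T - {0})"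
    then obtain t where t: "t \<in> T" "t \<noteq> 0" "s = inverse (complex_of_real t)" by blast
    have "s *s (z + t *\<^sub>R v) = v + s *s z" 
      using t by (simp add: scaleR_vec_complex vec_eq_iff algebra_simps)
    then have "lincomb \<phi> v + s *s lincomb \<phi> z = s *s lincomb \<phi> (z + t *\<^sub>R v)"
      by (metis lincomb_add lincomb_scale)
    then have "poly p s = s ^ d * f (lincomb \<phi> (z + t *\<^sub>R v))"
      using p(2)[of s] forms_homogeneous[OF f] by simp
    then show "s \<in> {s. poly p s = 0}" using t(1) by (simp add: T_def)
  qed
  have fin: "finite {s. poly p s = 0}" using poly_roots_finite[OF p0] .
  have inj: "inj_on (\<lambda>t. inverse (complex_of_real t)) (T - {0})" by (auto simp: inj_on_def)
  have finT': "finite (T - {0})" by (rule finite_imageD[OF finite_subset[OF sub fin] inj])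
  then show finT: "finite {t::real. z + t *\<^sub>R v \<in> {z. f (lincomb \<phi> z) = 0}}" unfolding T_def[symmetric] by simp
  have "card (T - {0}) \<le> card {s. poly p s = 0}"
    using card_mono[OF fin sub] card_image[OF inj] by simp
  also have "\<dots> \<le> degree p" by (rule card_poly_roots_bound[OF p0])
  finally have "card (T - {0}) \<le> d" using p(1) by simp
  then have "card T \<le> Suc d" using finT unfolding T_def[symmetric] by (simp add: card_Diff_singleton_if split: if_splits)
  then show "card {t::real. z + t *\<^sub>R v \<in> {z. f (lincomb \<phi> z) = 0}} \<le> Suc d" unfolding T_def .
qed

text \<open>
  Indexing the basis by the coordinates lets one vector \<open>z\<close> hold both a point of \<open>W\<close>, in the coordinates
  in \<open>S\<close>, and data on a complement of \<open>W\<close>, in the others.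
\<close>

lemma exists_adapted_basis:
  fixes W :: "(complex ^ 'n::finite) set"
  assumes "vec.subspace W"
  shows "\<exists>\<phi> (S :: 'n set). card S = vec.dim W \<and>
    W = {lincomb \<phi> z |z. \<forall>i. i \<notin> S \<longrightarrow> z $ i = 0} \<and> (\<forall>x. \<exists>z. x = lincomb \<phi> z)"
proof -
  obtain B where B: "B \<subseteq> W" "vec.independent B" "W \<subseteq> vec.span B" "card B = vec.dim W"
    using vec.basis_exists[of W] by blast
  have WB: "W = vec.span B" using B assms vec.span_minimal by blast
  define E where "E = vec.extend_basis B"
  have E: "B \<subseteq> E" "vec.independent E" "vec.span E = UNIV"
    using vec.extend_basis_superset[OF B(2)] vec.independent_extend_basis[OF B(2)] vec.span_extend_basis[OF B(2)]
    by (simp_all add: E_def)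
  have finE: "finite E" using E(2) vec.finiteI_independent by blast
  have "card E = CARD('n)"
    using vec.dim_eq_card[of E UNIV] E vec_dim_card by (metis vec.span_UNIV)
  then obtain \<phi> where \<phi>: "bij_betw \<phi> (UNIV :: 'n set) E"
    using finite_same_card_bij[of "UNIV :: 'n set" E] finE by auto
  define S where "S = {i. \<phi> i \<in> B}"
  have bS: "bij_betw \<phi> S B" using \<phi> E(1) unfolding S_def bij_betw_def by (auto simp: inj_on_def)
  have finB: "finite B" using finE E(1) finite_subset by blast
  have span: "\<exists>z. x = lincomb \<phi> z \<and> (\<forall>i. i \<notin> A \<longrightarrow> z $ i = 0)"
    if bA: "bij_betw \<phi> A C" "finite C" and x: "x \<in> vec.span C" for A C x
  proof -
    obtain u where "x = (\<Sum>b\<in>C. u b *s b)" using x vec.span_finite[OF bA(2)] by blast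
    also have "\<dots> = (\<Sum>i\<in>A. u (\<phi> i) *s \<phi> i)" by (rule sum.reindex_bij_betw[OF bA(1), symmetric])
    also have "\<dots> = lincomb \<phi> (\<chi> i. if i \<in> A then u (\<phi> i) else 0)"
      unfolding lincomb_def by (intro sum.mono_neutral_cong_left) auto
    finally show ?thesis by (intro exI[of _ "\<chi> i. if i \<in> A then u (\<phi> i) else 0"]) simp
  qed
  show ?thesis
  proof (intro exI[of _ \<phi>] exI[of _ S] conjI allI)
    show "card S = vec.dim W" using bij_betw_same_card[OF bS] B(4) by simp
    show "\<exists>z. x = lincomb \<phi> z" for x using span[OF \<phi> finE, of x] E(3) by auto
    have "lincomb \<phi> z \<in> W" if z: "\<forall>i. i \<notin> S \<longrightarrow> z $ i = 0" for z
      unfolding lincomb_def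
    proof (intro vec.subspace_sum assms)
      fix i
      show "z $ i *s \<phi> i \<in> W"
      proof (cases "i \<in> S")
        case True
        then show ?thesis using B(1) assms by (auto simp: S_def intro: vec.subspace_scale)
      next
        case False
        then show ?thesis using z assms vec.subspace_0 by simp
      qed
    qed
    then show "W = {lincomb \<phi> z |z. \<forall>i. i \<notin> S \<longrightarrow> z $ i = 0}"
      using span[OF bS finB] WB by blast
  qed
qed

lemma lform_eq_zero_imp: 
  assumes "\<And>x. lform h x = 0" shows "h = 0"
proof -
  have "h $ i = 0" for i using assms[of "axis i 1"] by simp
  then show ?thesis by (simp add: vec_eq_iff)
qed

lemma lform_lincomb: "lform h (lincomb \<phi> z) = (\<Sum>i\<in>UNIV. z $ i * lform h (\<phi> i))"
  by (simp add: lincomb_def lform_sum_right lform_scale_right)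

lemma dual_coordinates_linear: "linear (\<lambda>h. \<chi> i. lform h (\<phi> i))"
proof (rule linearI; intro vec_eq_iff[THEN iffD2] allI)
  show "(\<chi> i. lform (x + y) (\<phi> i)) $ i = ((\<chi> i. lform x (\<phi> i)) + (\<chi> i. lform y (\<phi> i))) $ i" for x y i
    by (simp add: lform_add_left)
  show "(\<chi> i. lform (r *\<^sub>R x) (\<phi> i)) $ i = (r *\<^sub>R (\<chi> i. lform x (\<phi> i))) $ i" for r x i
    by (simp add: scaleR_vec_complex lform_scale_left)
qed

lemma dual_coordinates_inj:
  assumes "\<And>x. \<exists>z. x = lincomb \<phi> z"
  shows "inj (\<lambda>h. \<chi> i. lform h (\<phi> i))"
  unfolding linear_injective_0[OF dual_coordinates_linear]
proof (intro allI impI)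
  fix h assume "(\<chi> i. lform h (\<phi> i)) = 0"
  then have 0: "lform h (\<phi> i) = 0" for i by (metis vec_lambda_beta zero_index)
  show "h = 0"
  proof (rule lform_eq_zero_imp)
    fix x
    obtain z where "x = lincomb \<phi> z" using assms by blast
    then show "lform h x = 0" by (simp add: lform_lincomb 0)
  qed
qed

lemma exists_dual:
  assumes "\<And>x. \<exists>z. x = lincomb \<phi> z"
  obtains h where "\<And>i. lform h (\<phi> i) = y $ i"
proof -
  have "surj (\<lambda>h. \<chi> i. lform h (\<phi> i))"
    by (rule linear_injective_imp_surjective[OF dual_coordinates_linear dual_coordinates_inj[OF assms] refl])
  then have "\<exists>h. y = (\<chi> i. lform h (\<phi> i))" by (rule surjD)
  then obtain h where h: "y = (\<chi> i. lform h (\<phi> i))" by blast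
  show thesis by (rule that[of h]) (simp add: h)
qed

lemma subspace_contains_linear_section:
  fixes W :: "(complex ^ 'n::finite) set"
  assumes "vec.subspace W" "vec.dim W + k = CARD('n)"
  obtains l where "\<And>x. (\<And>j. j < k \<Longrightarrow> lform (l j) x = 0) \<Longrightarrow> x \<in> W"
proof -
  obtain S :: "'n set" and \<phi> where \<phi>: "card S = vec.dim W"
    "W = {lincomb \<phi> z |z. \<forall>i. i \<notin> S \<longrightarrow> z $ i = 0}" "\<forall>x. \<exists>z. x = lincomb \<phi> z"
    using exists_adapted_basis[OF assms(1)] by (elim exE conjE) (rule that)
  have "card (- S) = k" using assms(2) \<phi>(1) by (simp add: Compl_eq_Diff_UNIV card_Diff_subset)
  then obtain e where e: "bij_betw e {..<k} (- S)"
    using finite_same_card_bij[of "{..<k}" "- S"] by auto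
  have "\<forall>i. \<exists>h. \<forall>j. lform h (\<phi> j) = axis i 1 $ j" using exists_dual[OF \<phi>(3)[rule_format]] by metis
  then obtain h where h: "\<And>i j. lform (h i) (\<phi> j) = axis i 1 $ j" by metis
  show thesis
  proof (rule that[of "\<lambda>j. h (e j)"])
    fix x assume x: "\<And>j. j < k \<Longrightarrow> lform (h (e j)) x = 0"
    obtain z where z: "x = lincomb \<phi> z" using \<phi>(3) by blast
    have hz: "lform (h i) x = z $ i" for i
      by (simp add: z lform_lincomb h axis_def if_distrib[of "\<lambda>c. _ * c"] cong: if_cong)
    have "z $ i = 0" if "i \<notin> S" for i
    proof -
      have "i \<in> e ` {..<k}" using e that by (simp add: bij_betw_def)
      then obtain j where "j < k" "e j = i" by auto
      then show ?thesis using x[of j] hz by simp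
    qed
    then show "x \<in> W" using z \<phi>(2) by blast
  qed
qed

lemma dim_hyperplane_section:
  fixes W :: "(complex ^ 'n::finite) set"
  assumes W: "vec.subspace W" and w: "w \<in> W" "lform h w \<noteq> 0"
  shows "vec.subspace {x \<in> W. lform h x = 0}" "vec.dim W = Suc (vec.dim {x \<in> W. lform h x = 0})"
proof -
  define U where "U = {x \<in> W. lform h x = 0}"
  show sub: "vec.subspace {x \<in> W. lform h x = 0}"
    using W by (auto simp: vec.subspace_def lform_add_right lform_scale_right)
  have "w \<notin> vec.span U"
  proof -
    have "vec.span U = U" using sub by (subst vec.span_eq_iff) (simp add: U_def)
    moreover have "w \<notin> U" using w(2) by (simp add: U_def)
    ultimately show ?thesis by metis
  qed
  then have "vec.dim (insert w U) = Suc (vec.dim U)" by (simp add: vec.dim_insert)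
  moreover have "vec.span (insert w U) = vec.span W"
  proof
    show "vec.span (insert w U) \<subseteq> vec.span W" using w(1) by (intro vec.span_mono) (auto simp: U_def)
    have "x \<in> vec.span (insert w U)" if x: "x \<in> W" for x
    proof -
      define c where "c = lform h x / lform h w"
      have "x - c *s w \<in> W" using W x w(1) by (intro vec.subspace_diff vec.subspace_scale)
      moreover have "lform h (x - c *s w) = 0" using w(2) by (simp add: lform_diff_right lform_scale_right c_def)
      ultimately have "x - c *s w \<in> U" by (simp add: U_def)
      then have "(x - c *s w) + c *s w \<in> vec.span (insert w U)"
        by (intro vec.span_add vec.span_scale vec.span_base) auto
      then show ?thesis by simp
    qed
    then show "vec.span W \<subseteq> vec.span (insert w U)" by (intro vec.span_minimal) auto
  qed
  ultimately show "vec.dim W = Suc (vec.dim {x \<in> W. lform h x = 0})"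
    unfolding U_def[symmetric] by (metis vec.dim_span)
qed

lemma differentiable_forms:
  assumes "f \<in> forms d"
  shows "f differentiable (at x)"
  using assms
proof (induction rule: forms_induct)
  case zero
  show ?case by (simp add: zero_fun_def)
next
  case (step c m g)
  have "(\<lambda>x::complex^'a. \<Prod>i\<in>A. x $ i ^ m i) differentiable (at x)" if "finite A" for A
    using that
  proof (induction A rule: finite_induct)
    case (insert i A)
    have "(\<lambda>x::complex^'a. x $ i ^ m i * (\<Prod>i\<in>A. x $ i ^ m i)) differentiable (at x)"
      by (intro differentiable_mult differentiable_power insert.IH
          bounded_linear_imp_differentiable[OF bounded_linear_vec_nth])
    then show ?case using insert.hyps by simp
  qed simp
  then have "mfun m differentiable (at x)" unfolding mfun_def[abs_def] by simp
  then show ?case using step unfolding plus_fun_def fscale_def by (intro differentiable_add differentiable_mult) auto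
qed

lemma differentiable_vec_lambda:
  fixes g :: "'n::finite \<Rightarrow> complex ^ 'm::finite \<Rightarrow> complex"
  assumes "\<And>i. g i differentiable (at x)"
  shows "(\<lambda>x. \<chi> i. g i x) differentiable (at x)"
proof -
  have lin: "bounded_linear (axis i :: complex \<Rightarrow> complex ^ 'n)" for i
    unfolding linear_conv_bounded_linear[symmetric]
    by (rule linearI) (auto simp: axis_def vec_eq_iff)
  have "(\<lambda>x. \<chi> i. g i x) = (\<lambda>x. \<Sum>i\<in>UNIV. axis i (g i x))"
    by (auto simp: vec_eq_iff sum_component axis_def)
  moreover have "(\<lambda>x. \<Sum>i\<in>UNIV. axis i (g i x)) differentiable (at x)"
  proof (rule differentiable_sum)
    show "\<forall>i\<in>UNIV. (\<lambda>x. axis i (g i x)) differentiable (at x)"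
    proof
      fix i
      obtain g' where "(g i has_derivative g') (at x)" using assms[of i] by (auto simp: differentiable_def)
      then have "((\<lambda>x. axis i (g i x)) has_derivative (\<lambda>h. axis i (g' h))) (at x)"
        by (rule bounded_linear.has_derivative[OF lin])
      then show "(\<lambda>x. axis i (g i x)) differentiable (at x)" by (auto simp: differentiable_def)
    qed
  qed simp
  ultimately show ?thesis by simp
qed

lemma exists_complex_root: "n > 0 \<Longrightarrow> \<exists>s. s ^ n = (a::complex)"
proof (cases "a = 0")
  case False
  assume "n > 0"
  then have "exp (Ln a / of_nat n) ^ n = a"
    using False by (simp flip: exp_of_nat_mult)
  then show ?thesis by blast
qed (auto intro!: exI[of _ 0])

text \<open>
  The Bertini step. If the restriction of \<open>f\<close> to \<open>W \<inter> ker h\<close> is singular at \<open>x\<close> but its restriction to \<open>W\<close> is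
  not, the differential at \<open>x\<close> is a nonzero multiple of \<open>h\<close> on \<open>W\<close>; rescaling \<open>x\<close> makes it equal to \<open>h\<close>
  there, and Euler's identity puts \<open>x\<close> on \<open>f = 0\<close>. So \<open>h\<close> is determined by a zero of \<open>f\<close> in \<open>W\<close> together
  with the values of \<open>h\<close> on a complement of \<open>W\<close>. Together these are as many parameters as \<open>h\<close> has, one equation
  holds among them, and differentiable maps between spaces of equal dimension preserve null sets.
\<close>

lemma tangent_hyperplanes_negligible:
  fixes f :: "complex ^ 'n::finite \<Rightarrow> complex" and D :: "'n \<Rightarrow> complex ^ 'n \<Rightarrow> complex"
  assumes d: "d \<ge> 2" and f: "f \<in> forms d" and D: "\<And>i. D i \<in> forms (d - 1)"
    and euler: "\<And>x. of_nat d * f x = lform (\<chi> i. D i x) x"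
    and W: "vec.subspace W" and nz: "\<exists>u\<in>W. f u \<noteq> 0"
  shows "negligible {h. \<exists>x\<in>W. lform h x = 0 \<and> (\<forall>w\<in>W. lform h w = 0 \<longrightarrow> lform (\<chi> i. D i x) w = 0)
            \<and> (\<exists>w\<in>W. lform (\<chi> i. D i x) w \<noteq> 0)}" (is "negligible ?bad")
proof -
  obtain S :: "'n set" and \<phi> where \<phi>: "card S = vec.dim W"
    "W = {lincomb \<phi> z |z. \<forall>i. i \<notin> S \<longrightarrow> z $ i = 0}" "\<forall>x. \<exists>z. x = lincomb \<phi> z"
    using exists_adapted_basis[OF W] by (elim exE conjE) (rule that)
  define \<psi> where "\<psi> i = (if i \<in> S then \<phi> i else 0)" for i
  have \<psi>\<phi>: "lincomb \<psi> z = lincomb \<phi> z" if "\<And>i. i \<notin> S \<Longrightarrow> z $ i = 0" for z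
    unfolding lincomb_def \<psi>_def by (rule sum.cong) (use that in auto)
  have \<psi>W: "lincomb \<psi> z \<in> W" for z
  proof -
    have "lincomb \<psi> z = lincomb \<phi> (\<chi> i. if i \<in> S then z $ i else 0)"
      unfolding lincomb_def \<psi>_def by (rule sum.cong) auto
    then show ?thesis unfolding \<phi>(2) by (intro CollectI exI[of _ "\<chi> i. if i \<in> S then z $ i else 0"]) auto
  qed
  define L where "L h = (\<chi> i. lform h (\<phi> i))" for h
  have linL: "linear L" unfolding L_def[abs_def] by (rule dual_coordinates_linear)
  have injL: "inj L" unfolding L_def[abs_def] by (rule dual_coordinates_inj[OF \<phi>(3)[rule_format]])
  obtain L' where L': "linear L'" "L' \<circ> L = id" using linear_injective_left_inverse[OF linL injL] by blast
  \<comment> \<open>In coordinates adapted to \<open>W\<close>, \<open>G\<close> uses the coordinates in \<open>S\<close> as a point of \<open>W\<close>, whose differential on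
    \<open>W\<close> it records, and keeps the others as the values of the hyperplane on the complement.\<close>
  define G where "G z = (\<chi> i. if i \<in> S then lform (\<chi> j. D j (lincomb \<psi> z)) (\<phi> i) else z $ i)" for z
  define N where "N = {z. f (lincomb \<psi> z) = 0}"
  obtain u z0 where "u = lincomb \<phi> z0" "f u \<noteq> 0" "\<And>i. i \<notin> S \<Longrightarrow> z0 $ i = 0" using nz \<phi>(2) by blast
  then have "f (lincomb \<psi> z0) \<noteq> 0" using \<psi>\<phi> by simp
  then have negN: "negligible N" unfolding N_def by (rule negligible_form_zeros[OF f])
  have diffG: "G differentiable (at z)" for z
    unfolding G_def
  proof (rule differentiable_vec_lambda)
    fix i
    have dl: "lincomb \<psi> differentiable (at z)"
      using linear_lincomb by (intro bounded_linear_imp_differentiable) (simp add: linear_conv_bounded_linear)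
    have "(\<lambda>z. D j (lincomb \<psi> z)) differentiable (at z)" for j
      using differentiable_chain_at[OF dl differentiable_forms[OF D[of j]]] by (simp add: o_def)
    then have "(\<lambda>z. lform (\<chi> j. D j (lincomb \<psi> z)) (\<phi> i)) differentiable (at z)"
      unfolding lform_def by (simp add: differentiable_sum differentiable_mult)
    then show "(\<lambda>z. if i \<in> S then lform (\<chi> j. D j (lincomb \<psi> z)) (\<phi> i) else z $ i) differentiable (at z)"
      by (cases "i \<in> S") (auto intro: bounded_linear_imp_differentiable bounded_linear_vec_nth)
  qed
  have "negligible ((\<lambda>z. L' (G z)) ` N)"
  proof (rule negligible_differentiable_image_negligible[OF order_refl negN])
    have "L' differentiable (at y)" for y
      using L'(1) by (intro bounded_linear_imp_differentiable) (simp add: linear_conv_bounded_linear)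
    then have "(\<lambda>z. L' (G z)) differentiable (at z)" for z
      using differentiable_chain_at[OF diffG, of L' z] by (simp add: o_def)
    then show "(\<lambda>z. L' (G z)) differentiable_on N"
      by (simp add: differentiable_at_imp_differentiable_on)
  qed
  moreover have "?bad \<subseteq> (\<lambda>z. L' (G z)) ` N"
  proof
    fix h assume "h \<in> ?bad"
    then obtain x w0 where x: "x \<in> W" "lform h x = 0" "\<And>w. w \<in> W \<Longrightarrow> lform h w = 0 \<Longrightarrow> lform (\<chi> i. D i x) w = 0"
      and w0: "w0 \<in> W" "lform (\<chi> i. D i x) w0 \<noteq> 0" by blast
    have hw0: "lform h w0 \<noteq> 0" using x(3) w0 by blast
    define a where "a = lform (\<chi> i. D i x) w0 / lform h w0"
    have a0: "a \<noteq> 0" using w0 hw0 by (simp add: a_def)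
    have aw: "lform (\<chi> i. D i x) w = a * lform h w" if w: "w \<in> W" for w
    proof -
      define c where "c = lform h w / lform h w0"
      have "w - c *s w0 \<in> W" using W w w0(1) by (intro vec.subspace_diff vec.subspace_scale)
      moreover have "lform h (w - c *s w0) = 0" using hw0 by (simp add: lform_diff_right lform_scale_right c_def)
      ultimately have "lform (\<chi> i. D i x) (w - c *s w0) = 0" by (rule x(3))
      then show ?thesis using hw0 by (simp add: lform_diff_right lform_scale_right c_def a_def)
    qed
    obtain s where s: "s ^ (d - 1) = 1 / a" using exists_complex_root[of "d - 1" "1 / a"] d by auto
    define y where "y = s *s x"
    have "D i y = (1 / a) * D i x" for i by (simp only: y_def forms_homogeneous[OF D] s)
    then have "(\<chi> i. D i y) = (1 / a) *s (\<chi> i. D i x)" by (simp add: vec_eq_iff)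
    then have yw: "lform (\<chi> i. D i y) w = lform h w" if "w \<in> W" for w
      using aw[OF that] a0 by (simp add: lform_scale_left)
    have yW: "y \<in> W" unfolding y_def using W x(1) by (rule vec.subspace_scale)
    have hy: "lform h y = 0" by (simp add: y_def lform_scale_right x(2))
    have fy: "f y = 0" using euler[of y] yw[OF yW] hy d by simp
    obtain z1 where z1: "y = lincomb \<phi> z1" "\<And>i. i \<notin> S \<Longrightarrow> z1 $ i = 0" using yW \<phi>(2) by blast
    define z where "z = (\<chi> i. if i \<in> S then z1 $ i else lform h (\<phi> i))"
    have zy: "lincomb \<psi> z = y"
    proof -
      have "lincomb \<psi> z = lincomb \<psi> z1" unfolding lincomb_def \<psi>_def z_def by (rule sum.cong) auto
      then show ?thesis using \<psi>\<phi>[OF z1(2)] z1(1) by simp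
    qed
    have \<phi>W: "\<phi> i \<in> W" if "i \<in> S" for i
    proof -
      have "lincomb \<psi> (axis i 1) = \<phi> i"
        using that by (simp add: lincomb_def \<psi>_def axis_def if_distrib[of "\<lambda>c. c *s _"] cong: if_cong)
      then show ?thesis using \<psi>W by metis
    qed
    have "G z = L h"
      unfolding G_def L_def zy by (rule vec_eq_iff[THEN iffD2]) (use yw[OF \<phi>W] in \<open>auto simp: z_def\<close>)
    then have "h = L' (G z)" using L'(2) by (metis comp_apply id_apply)
    moreover have "z \<in> N" using zy fy by (simp add: N_def)
    ultimately show "h \<in> (\<lambda>z. L' (G z)) ` N" by blast
  qed
  ultimately show ?thesis by (rule negligible_subset)
qed

text \<open>
  If \<open>u\<close> and \<open>v\<close> in \<open>W\<close> are independent, the vector \<open>h(v) u - h(u) v\<close> lies in \<open>W \<inter> ker h\<close> and depends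
  linearly on \<open>h\<close>, so \<open>f\<close> vanishes there only for a null set of \<open>h\<close> if \<open>f u \<noteq> 0\<close>.
\<close>

lemma vanishing_hyperplane_sections_negligible:
  fixes f :: "complex ^ 'n::finite \<Rightarrow> complex"
  assumes f: "f \<in> forms d" "d \<ge> 1" and W: "vec.subspace W" "vec.dim W \<ge> 2" and nz: "\<exists>u\<in>W. f u \<noteq> 0"
  shows "negligible {h. \<forall>x\<in>W. lform h x = 0 \<longrightarrow> f x = 0}" (is "negligible ?bad")
proof -
  obtain u where u: "u \<in> W" "f u \<noteq> 0" using nz by blast
  have "\<not> W \<subseteq> vec.span {u}"
  proof
    assume "W \<subseteq> vec.span {u}"
    then have "vec.dim W \<le> card {u}" by (rule vec.dim_le_card) simp
    then show False using W(2) by simp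
  qed
  then obtain v where v: "v \<in> W" "v \<notin> vec.span {u}" by blast
  have "u \<noteq> 0"
  proof
    assume "u = 0"
    have "f (0 *s u) = 0 ^ d * f u" by (rule forms_homogeneous[OF f(1)])
    moreover have "(0::complex) ^ d = 0" using f(2) by (intro zero_power) simp
    ultimately have "f (0 *s u) = 0" by (simp only: mult_zero_left)
    then show False using \<open>u = 0\<close> u(2) by simp
  qed
  then obtain i where i: "u $ i \<noteq> 0" by (auto simp: vec_eq_iff)
  have "(v $ i / u $ i) *s u \<in> vec.span {u}" by (intro vec.span_scale vec.span_base) simp
  then have "v \<noteq> (v $ i / u $ i) *s u" using v(2) by metis
  then obtain j where j: "v $ j \<noteq> (v $ i / u $ i) * u $ j" by (auto simp: vec_eq_iff)
  define h1 where "h1 = axis j (u $ i) - axis i (u $ j)"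
  have h1: "lform h1 u = 0" "lform h1 v \<noteq> 0"
    using i j by (simp_all add: h1_def lform_diff_left field_simps)
  define \<phi> where "\<phi> i = v $ i *s u - u $ i *s v" for i
  have \<phi>: "lincomb \<phi> h = lform h v *s u - lform h u *s v" for h
    by (simp add: vec_eq_iff lincomb_nth \<phi>_def lform_def sum_distrib_right right_diff_distrib sum_subtractf mult.assoc)
  have "f (lincomb \<phi> h1) \<noteq> 0" using h1 u(2) by (simp add: \<phi> forms_homogeneous[OF f(1)])
  then have "negligible {h. f (lincomb \<phi> h) = 0}" by (rule negligible_form_zeros[OF f(1)])
  moreover have "?bad \<subseteq> {h. f (lincomb \<phi> h) = 0}"
  proof
    fix h assume "h \<in> ?bad"
    moreover have "lincomb \<phi> h \<in> W" unfolding \<phi> using W(1) u(1) v(1) by (intro vec.subspace_diff vec.subspace_scale)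
    moreover have "lform h (lincomb \<phi> h) = 0" by (simp add: \<phi> lform_diff_right lform_scale_right)
    ultimately show "h \<in> {h. f (lincomb \<phi> h) = 0}" by blast
  qed
  ultimately show ?thesis by (rule negligible_subset)
qed

text \<open>
  The hyperplanes are chosen one after another, each close to the prescribed one. The condition
  that \<open>f\<close> does not vanish on \<open>W\<close> is carried along because the next step needs the zeros of \<open>f\<close> in \<open>W\<close> to be
  a null set.
\<close>

lemma exists_generic_linear_section:
  fixes f :: "complex ^ 'n::finite \<Rightarrow> complex" and D :: "'n \<Rightarrow> complex ^ 'n \<Rightarrow> complex"
  assumes d: "d \<ge> 2" and f: "f \<in> forms d" and D: "\<And>i. D i \<in> forms (d - 1)"
    and euler: "\<And>x. of_nat d * f x = lform (\<chi> i. D i x) x"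
    and nz: "\<exists>u. f u \<noteq> 0" and \<epsilon>: "\<epsilon> > 0" and k: "k + 2 \<le> CARD('n)"
  shows "\<exists>l' W. (\<forall>j<k. dist (l' j) (l j) < \<epsilon>) \<and> (\<forall>x\<in>W. \<forall>j<k. lform (l' j) x = 0) \<and>
    vec.subspace W \<and> vec.dim W + k = CARD('n) \<and> (\<exists>u\<in>W. f u \<noteq> 0) \<and>
    (\<forall>x\<in>W. (\<forall>w\<in>W. lform (\<chi> i. D i x) w = 0) \<longrightarrow> (\<forall>w. lform (\<chi> i. D i x) w = 0))"
  using k
proof (induction k)
  case 0
  show ?case
    by (rule exI[of _ l], rule exI[of _ UNIV]) (use nz in \<open>simp add: card_cart_basis\<close>)
next
  case (Suc k)
  obtain l' W where l': "\<And>j. j < k \<Longrightarrow> dist (l' j) (l j) < \<epsilon>" and lW: "\<And>x j. x \<in> W \<Longrightarrow> j < k \<Longrightarrow> lform (l' j) x = 0"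
    and W: "vec.subspace W" "vec.dim W + k = CARD('n)" "\<exists>u\<in>W. f u \<noteq> 0"
    and sing: "\<And>x. x \<in> W \<Longrightarrow> (\<forall>w\<in>W. lform (\<chi> i. D i x) w = 0) \<Longrightarrow> (\<forall>w. lform (\<chi> i. D i x) w = 0)"
  proof -
    have "k + 2 \<le> CARD('n)" using Suc.prems by simp
    then show thesis using Suc.IH that by blast
  qed
  define N1 where "N1 = {h. \<forall>x\<in>W. lform h x = 0 \<longrightarrow> f x = 0}"
  define N2 where "N2 = {h. \<exists>x\<in>W. lform h x = 0 \<and> (\<forall>w\<in>W. lform h w = 0 \<longrightarrow> lform (\<chi> i. D i x) w = 0)
            \<and> (\<exists>w\<in>W. lform (\<chi> i. D i x) w \<noteq> 0)}"
  define N3 where "N3 = {h. \<forall>w\<in>W. lform h w = 0}"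
  have dimW: "vec.dim W \<ge> 2" using W(2) Suc.prems by simp
  have "negligible N1" unfolding N1_def
    by (rule vanishing_hyperplane_sections_negligible[OF f _ W(1) dimW W(3)]) (use d in simp)
  moreover have "negligible N2" unfolding N2_def
    by (rule tangent_hyperplanes_negligible[OF d f D euler W(1,3)])
  moreover have "negligible N3"
  proof -
    have "\<not> W \<subseteq> {0}"
    proof
      assume "W \<subseteq> {0}"
      then have "vec.dim W = 0" by simp
      then show False using dimW by linarith
    qed
    then obtain w where w: "w \<in> W" "w \<noteq> 0" by blast
    then obtain i where i: "w $ i \<noteq> 0" by (auto simp: vec_eq_iff)
    define \<phi> where "\<phi> j = axis i (w $ j)" for j
    have \<phi>: "lincomb \<phi> h $ i = lform h w" for h
      by (simp add: lincomb_nth \<phi>_def lform_def axis_def)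
    have "negligible {h. lincomb \<phi> h $ i = 0}"
      by (rule negligible_form_zeros[where f = "\<lambda>x. x $ i" and v = "axis i 1", OF forms_coord]) (use i in \<open>simp add: \<phi>\<close>)
    then show ?thesis
      by (rule negligible_subset) (use w(1) in \<open>auto simp: N3_def \<phi>\<close>)
  qed
  ultimately have neg: "negligible (N1 \<union> N2 \<union> N3)" by (intro negligible_Un)
  have "\<not> ball (l k) \<epsilon> \<subseteq> N1 \<union> N2 \<union> N3"
    using negligible_subset[OF neg] open_not_negligible[OF open_ball, of "l k" \<epsilon>] \<epsilon> by auto
  then obtain h where h: "dist h (l k) < \<epsilon>" "h \<notin> N1" "h \<notin> N2" "h \<notin> N3"
  proof -
    assume *: "\<And>h. dist h (l k) < \<epsilon> \<Longrightarrow> h \<notin> N1 \<Longrightarrow> h \<notin> N2 \<Longrightarrow> h \<notin> N3 \<Longrightarrow> thesis"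
    assume "\<not> ball (l k) \<epsilon> \<subseteq> N1 \<union> N2 \<union> N3"
    then obtain h where "h \<in> ball (l k) \<epsilon>" "h \<notin> N1 \<union> N2 \<union> N3" by blast
    then show thesis by (intro *[of h]) (auto simp: dist_commute)
  qed
  obtain w where w: "w \<in> W" "lform h w \<noteq> 0" using h(4) by (auto simp: N3_def)
  define U where "U = {x \<in> W. lform h x = 0}"
  note dimU = dim_hyperplane_section[OF W(1) w, folded U_def]
  show ?case
  proof (intro exI[of _ "l'(k := h)"] exI[of _ U] conjI allI impI ballI)
    fix j assume "j < Suc k"
    then show "dist ((l'(k := h)) j) (l j) < \<epsilon>" using l' h(1) by (cases "j = k") auto
  next
    fix x j assume "x \<in> U" "j < Suc k"
    then show "lform ((l'(k := h)) j) x = 0" using lW by (cases "j = k") (auto simp: U_def)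
  next
    show "vec.subspace U" by (rule dimU(1))
    show "vec.dim U + Suc k = CARD('n)" using dimU(2) W(2) by simp
    show "\<exists>u\<in>U. f u \<noteq> 0" using h(2) by (auto simp: N1_def U_def)
  next
    fix x w assume x: "x \<in> U" "\<forall>w\<in>U. lform (\<chi> i. D i x) w = 0"
    have "\<forall>w\<in>W. lform (\<chi> i. D i x) w = 0"
    proof (rule ccontr)
      assume "\<not> ?thesis"
      then have "h \<in> N2" unfolding N2_def using x by (auto simp: U_def)
      then show False using h(3) by blast
    qed
    then show "lform (\<chi> i. D i x) w = 0" using sing x(1) by (simp add: U_def)
  qed
qed

text \<open>
  A generic section close to one that misses the singular cone acquires no new singular points and
  still misses the old ones.
\<close>

theorem exists_transversal_linear_section:
  fixes f :: "complex ^ 'n::finite \<Rightarrow> complex" and D :: "'n \<Rightarrow> complex ^ 'n \<Rightarrow> complex"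
  assumes d: "d \<ge> 2" and f: "f \<in> forms d" and D: "\<And>i. D i \<in> forms (d - 1)"
    and euler: "\<And>x. of_nat d * f x = lform (\<chi> i. D i x) x"
    and nz: "\<exists>u. f u \<noteq> 0" and k: "k + 2 \<le> CARD('n)"
    and thin: "\<not> thick k {x. x \<noteq> 0 \<and> (\<forall>i. D i x = 0)}"
  shows "\<exists>W. vec.subspace W \<and> vec.dim W + k = CARD('n) \<and>
    (\<forall>x\<in>W. x \<noteq> 0 \<longrightarrow> (\<exists>w\<in>W. lform (\<chi> i. D i x) w \<noteq> 0))"
proof -
  define X where "X = {x. x \<noteq> 0 \<and> (\<forall>i. D i x = 0)}"
  have "X = zero_cone (range D)" by (auto simp: X_def zero_cone_def)
  then have X: "acone X" using D unfolding acone_def by blast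
  obtain l where l: "\<And>x. x \<in> X \<Longrightarrow> \<exists>j<k. lform (l j) x \<noteq> 0"
    using thin unfolding thick_def X_def[symmetric] by blast
  obtain \<epsilon> where \<epsilon>: "\<epsilon> > 0"
    "\<And>l' x. (\<And>j. j < k \<Longrightarrow> dist (l' j) (l j) < \<epsilon>) \<Longrightarrow> x \<in> X \<Longrightarrow> \<exists>j<k. lform (l' j) x \<noteq> 0"
    using missing_linear_section_open[OF X l] by metis
  obtain l' W where l': "\<And>j. j < k \<Longrightarrow> dist (l' j) (l j) < \<epsilon>" and lW: "\<And>x j. x \<in> W \<Longrightarrow> j < k \<Longrightarrow> lform (l' j) x = 0"
    and W: "vec.subspace W" "vec.dim W + k = CARD('n)"
    and sing: "\<And>x. x \<in> W \<Longrightarrow> (\<forall>w\<in>W. lform (\<chi> i. D i x) w = 0) \<Longrightarrow> (\<forall>w. lform (\<chi> i. D i x) w = 0)"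
    using exists_generic_linear_section[OF d f D euler nz \<epsilon>(1) k, of l] by blast
  have "\<exists>w\<in>W. lform (\<chi> i. D i x) w \<noteq> 0" if x: "x \<in> W" "x \<noteq> 0" for x
  proof (rule ccontr)
    assume "\<not> ?thesis"
    then have "\<forall>w. lform (\<chi> i. D i x) w = 0" using sing[OF x(1)] by blast
    then have "(\<chi> i. D i x) = 0" by (intro lform_eq_zero_imp) blast
    then have "D i x = 0" for i by (metis vec_lambda_beta zero_index)
    then have "x \<in> X" using x(2) by (simp add: X_def)
    then show False using \<epsilon>(2)[OF l'] lW[OF x(1)] by blast
  qed
  then show ?thesis using W by blast
qed

section \<open>Formal polynomials and their derivatives\<close>

abbreviation "lookup \<equiv> Poly_Mapping.lookup"
abbreviation "keys \<equiv> Poly_Mapping.keys"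

lemma mp_eval_mfun:
  "mp_eval F x = (\<Sum>m\<in>keys F. lookup F m * mfun (lookup m) x)"
  by (simp add: mp_eval_def mfun_def)

lemma mp_eval_superset:
  assumes "finite A" "keys F \<subseteq> A"
  shows "mp_eval F x = (\<Sum>m\<in>A. lookup F m * mfun (lookup m) x)"
  unfolding mp_eval_mfun
  by (rule sum.mono_neutral_left) (use assms in \<open>auto simp: in_keys_iff\<close>)

lemma mp_eval_add: "mp_eval (F + G) x = mp_eval F x + mp_eval G x"
proof -
  define A where "A = keys F \<union> keys G"
  have A: "finite A" "keys F \<subseteq> A" "keys G \<subseteq> A" "keys (F + G) \<subseteq> A"
    using keys_add[of F G] by (auto simp: A_def)
  show ?thesis
    unfolding mp_eval_superset[OF A(1,2)] mp_eval_superset[OF A(1,3)] mp_eval_superset[OF A(1,4)]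
    by (simp add: lookup_add algebra_simps sum.distrib)
qed

lemma mp_eval_zero [simp]: "mp_eval 0 x = 0"
  by (simp add: mp_eval_def)

lemma mp_eval_sum: "mp_eval (sum F A) x = (\<Sum>i\<in>A. mp_eval (F i) x)"
  by (induction A rule: infinite_finite_induct) (auto simp: mp_eval_add)

lemma mp_eval_single: "mp_eval (Poly_Mapping.single m c) x = c * mfun (lookup m) x"
  using mp_eval_superset[of "{m}" "Poly_Mapping.single m c" x] by simp

lemma lookup_mp_scale: "lookup (mp_scale c F) m = c * lookup F m"
  by (simp add: mp_scale_def Poly_Mapping.map.rep_eq when_def)

lemma mp_eval_scale: "mp_eval (mp_scale c F) x = c * mp_eval F x"
proof -
  have "keys (mp_scale c F) \<subseteq> keys F"
    by (auto simp: in_keys_iff lookup_mp_scale)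
  then show ?thesis
    by (simp add: mp_eval_superset[of "keys F"] lookup_mp_scale sum_distrib_left mult.assoc)
qed

lemma homogeneous_iff: "homogeneous d F \<longleftrightarrow> (\<forall>m\<in>keys F. lookup m \<in> exps d)"
  by (simp add: homogeneous_def exps_def)

lemma mp_eval_forms:
  assumes "homogeneous d F"
  shows "mp_eval F \<in> forms d"
proof -
  have "mp_eval F = (\<Sum>m\<in>keys F. fscale (lookup F m) (mfun (lookup m)))"
    by (auto simp: fun_eq_iff mp_eval_mfun fscale_apply)
  moreover have "\<dots> \<in> forms d"
    using assms by (intro forms_sum forms_scale mfun_forms) (auto simp: homogeneous_iff)
  ultimately show ?thesis by (simp only:)
qed

lemma forms_eq_mp_eval:
  assumes "f \<in> forms d"
  obtains F where "homogeneous d F" "f = mp_eval F"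
proof -
  have "\<exists>F. homogeneous d F \<and> f = mp_eval F"
    using assms
  proof (induction rule: forms_induct)
    case zero
    have "homogeneous d (0 :: 'a mpoly) \<and> (0 :: complex ^ 'a \<Rightarrow> complex) = mp_eval 0"
      by (auto simp: homogeneous_def fun_eq_iff)
    then show ?case by (intro exI)
  next
    case (step c m g)
    then obtain G where G: "homogeneous d G" "g = mp_eval G" by blast
    define m' where "m' = Abs_poly_mapping m"
    have m': "lookup m' = m" by (simp add: m'_def)
    have "homogeneous d (Poly_Mapping.single m' c + G)"
      using G(1) step(1) keys_add[of "Poly_Mapping.single m' c" G] m'
      by (fastforce simp: homogeneous_iff split: if_splits)
    moreover have "fscale c (mfun m) + g = mp_eval (Poly_Mapping.single m' c + G)"
      by (auto simp: fun_eq_iff mp_eval_add mp_eval_single m' G(2) fscale_apply)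
    ultimately show ?case by blast
  qed
  then show thesis using that by blast
qed

lemma base_expansion_unique:
  fixes a b :: "nat \<Rightarrow> nat"
  assumes "\<And>j. j < N \<Longrightarrow> a j < B" "\<And>j. j < N \<Longrightarrow> b j < B"
    and "(\<Sum>j<N. a j * B ^ j) = (\<Sum>j<N. b j * B ^ j)" "j < N"
  shows "a j = b j"
  using assms
proof (induction N arbitrary: a b j)
  case (Suc N)
  have shift: "(\<Sum>j<Suc N. c j * B ^ j) = c 0 + B * (\<Sum>j<N. c (Suc j) * B ^ j)" for c :: "nat \<Rightarrow> nat"
    by (simp add: sum.lessThan_Suc_shift sum_distrib_left algebra_simps del: sum.lessThan_Suc)
  have eq: "a 0 + B * (\<Sum>j<N. a (Suc j) * B ^ j) = b 0 + B * (\<Sum>j<N. b (Suc j) * B ^ j)"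
    using Suc.prems(3) unfolding shift .
  have a0: "a 0 < B" "b 0 < B" using Suc.prems(1,2) by auto
  have "(a 0 + B * (\<Sum>j<N. a (Suc j) * B ^ j)) mod B = (b 0 + B * (\<Sum>j<N. b (Suc j) * B ^ j)) mod B"
    using eq by simp
  then have ab0: "a 0 = b 0" using a0 by simp
  then have "(\<Sum>j<N. a (Suc j) * B ^ j) = (\<Sum>j<N. b (Suc j) * B ^ j)" using eq a0 by simp
  then have "a (Suc i) = b (Suc i)" if "i < N" for i
    using Suc.IH[of "\<lambda>j. a (Suc j)" "\<lambda>j. b (Suc j)" i] Suc.prems(1,2) that by auto
  then show ?case using ab0 Suc.prems(4) by (cases j) auto
qed simp

text \<open>
  Kronecker's substitution \<open>x\<^sub>i = t ^ (Suc d ^ e\<^sub>i)\<close> sends the monomials of degree \<open>d\<close> to distinct powers of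
  \<open>t\<close>, since their exponents become digits in base \<open>Suc d\<close>.
\<close>

lemma nonzero_form_has_nonzero_value:
  fixes F :: "('n::finite) mpoly"
  assumes "homogeneous d F" "F \<noteq> 0"
  shows "\<exists>x. mp_eval F x \<noteq> 0"
proof -
  obtain e :: "'n \<Rightarrow> nat" where e: "bij_betw e UNIV {..<CARD('n)}"
    using finite_same_card_bij[of "UNIV :: 'n set" "{..<CARD('n)}"] by auto
  define wt where "wt m = (\<Sum>i\<in>UNIV. lookup m i * Suc d ^ e i)" for m :: "'n \<Rightarrow>\<^sub>0 nat"
  have le: "lookup m i \<le> d" if "m \<in> keys F" for m i
  proof -
    have "lookup m i \<le> (\<Sum>i\<in>UNIV. lookup m i)" by (rule member_le_sum) auto
    then show ?thesis using assms(1) that by (simp add: homogeneous_def)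
  qed
  define e' where "e' = inv_into UNIV e"
  have e': "e' (e i) = i" for i using e by (simp add: e'_def bij_betw_def)
  have ee': "e (e' j) = j" if "j < CARD('n)" for j
    using e that by (simp add: e'_def bij_betw_def f_inv_into_f)
  have wt': "wt m = (\<Sum>j<CARD('n). lookup m (e' j) * Suc d ^ j)" for m
    unfolding wt_def using sum.reindex_bij_betw[OF e, of "\<lambda>j. lookup m (e' j) * Suc d ^ j"] e' by simp
  have inj: "m = m'" if m: "m \<in> keys F" "m' \<in> keys F" and eq: "wt m = wt m'" for m m'
  proof (rule poly_mapping_eqI)
    fix i
    have "e i < CARD('n)" using e by (auto simp: bij_betw_def)
    then have "lookup m (e' (e i)) = lookup m' (e' (e i))"
      using eq le[OF m(1)] le[OF m(2)] unfolding wt'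
      by (intro base_expansion_unique[where a = "\<lambda>j. lookup m (e' j)" and b = "\<lambda>j. lookup m' (e' j)"
          and B = "Suc d" and N = "CARD('n)"]) (auto simp: less_Suc_eq_le)
    then show "lookup m i = lookup m' i" by (simp add: e')
  qed
  define p where "p = (\<Sum>m\<in>keys F. Polynomial.monom (lookup F m) (wt m))"
  obtain m0 where m0: "m0 \<in> keys F" using assms(2) by (metis keys_eq_empty ex_in_conv)
  have "coeff p (wt m0) = (\<Sum>m\<in>keys F. if m = m0 then lookup F m0 else 0)"
    unfolding p_def coeff_sum using inj[OF _ m0] by (intro sum.cong) auto
  also have "\<dots> \<noteq> 0" using m0 by (simp add: in_keys_iff)
  finally have "p \<noteq> 0" by auto
  then have "\<exists>t. poly p t \<noteq> 0" using poly_all_0_iff_0 by blast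
  then obtain t where t: "poly p t \<noteq> 0" by blast
  define x where "x = (\<chi> i. t ^ (Suc d ^ e i))"
  have "mfun (lookup m) x = t ^ wt m" for m
    by (simp add: mfun_def x_def wt_def power_sum mult.commute flip: power_mult)
  then have "mp_eval F x = poly p t"
    by (simp add: mp_eval_mfun p_def poly_sum poly_monom)
  then show ?thesis using t by metis
qed

definition grad :: "('n::finite) mpoly \<Rightarrow> complex ^ 'n \<Rightarrow> complex ^ 'n" where
  "grad F x = (\<chi> i. mp_eval (mp_deriv i F) x)"

lemma mp_eval_deriv:
  "mp_eval (mp_deriv i F) x = (\<Sum>m\<in>keys F. of_nat (lookup m i) * lookup F m *
     mfun (lookup (m - Poly_Mapping.single i 1)) x)"
  by (simp add: mp_deriv_def mp_eval_sum mp_eval_single)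

lemma mfun_lower_exponent:
  "mfun (lookup (m - Poly_Mapping.single i 1)) x =
     x $ i ^ (lookup m i - 1) * (\<Prod>j\<in>UNIV - {i}. x $ j ^ lookup m j)"
proof -
  have "(\<Prod>j\<in>UNIV - {i}. x $ j ^ lookup (m - Poly_Mapping.single i 1) j) =
      (\<Prod>j\<in>UNIV - {i}. x $ j ^ lookup m j)"
    by (rule prod.cong) (auto simp: lookup_minus lookup_single)
  then show ?thesis by (simp add: mfun_def prod.remove[of UNIV i] lookup_minus)
qed

lemma mp_deriv_forms:
  assumes "homogeneous d F"
  shows "mp_eval (mp_deriv i F) \<in> forms (d - 1)"
proof -
  have "mp_eval (mp_deriv i F) = (\<Sum>m\<in>keys F. fscale (of_nat (lookup m i) * lookup F m)
     (mfun (lookup (m - Poly_Mapping.single i 1))))"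
    by (auto simp: fun_eq_iff mp_eval_deriv fscale_apply)
  moreover have "\<dots> \<in> forms (d - 1)"
  proof (rule forms_sum)
    fix m assume m: "m \<in> keys F"
    show "fscale (of_nat (lookup m i) * lookup F m)
     (mfun (lookup (m - Poly_Mapping.single i 1))) \<in> forms (d - 1)"
    proof (cases "lookup m i = 0")
      case True
      then show ?thesis by (simp add: fscale_def)
    next
      case False
      have "(\<Sum>j\<in>UNIV. lookup (m - Poly_Mapping.single i 1) j) =
          (lookup m i - 1) + (\<Sum>j\<in>UNIV - {i}. lookup (m - Poly_Mapping.single i 1) j)"
        by (simp add: sum.remove[of UNIV i] lookup_minus)
      also have "(\<Sum>j\<in>UNIV - {i}. lookup (m - Poly_Mapping.single i 1) j) = (\<Sum>j\<in>UNIV - {i}. lookup m j)"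
        by (rule sum.cong) (auto simp: lookup_minus lookup_single)
      also have "(lookup m i - 1) + \<dots> = (\<Sum>j\<in>UNIV. lookup m j) - 1"
        using False by (simp add: sum.remove[of UNIV i])
      finally have "lookup (m - Poly_Mapping.single i 1) \<in> exps (d - 1)"
        using assms m by (simp add: exps_def homogeneous_def)
      then show ?thesis by (intro forms_scale mfun_forms)
    qed
  qed
  ultimately show ?thesis by (simp only:)
qed

lemma euler_identity:
  assumes "homogeneous d F"
  shows "of_nat d * mp_eval F x = lform (grad F x) x"
proof -
  have coord: "of_nat (lookup m i) * mfun (lookup (m - Poly_Mapping.single i 1)) x * x $ i
      = of_nat (lookup m i) * mfun (lookup m) x" for m i
  proof (cases "lookup m i")
    case (Suc k)
    have "mfun (lookup m) x = x $ i ^ lookup m i * (\<Prod>j\<in>UNIV - {i}. x $ j ^ lookup m j)"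
      by (simp add: mfun_def prod.remove[of UNIV i])
    then show ?thesis by (simp add: mfun_lower_exponent[simplified] Suc)
  qed simp
  have "lform (grad F x) x = (\<Sum>i\<in>UNIV. \<Sum>m\<in>keys F. lookup F m *
      (of_nat (lookup m i) * mfun (lookup (m - Poly_Mapping.single i 1)) x * x $ i))"
    by (simp add: lform_def grad_def mp_eval_deriv sum_distrib_left sum_distrib_right ac_simps)
  also have "\<dots> = (\<Sum>m\<in>keys F. \<Sum>i\<in>UNIV. lookup F m * (of_nat (lookup m i) * mfun (lookup m) x))"
    unfolding coord by (rule sum.swap)
  also have "\<dots> = (\<Sum>m\<in>keys F. of_nat d * (lookup F m * mfun (lookup m) x))"
  proof (rule sum.cong[OF refl])
    fix m assume "m \<in> keys F"
    then have "d = (\<Sum>i\<in>UNIV. lookup m i)" using assms by (simp add: homogeneous_def)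
    then have "(of_nat d :: complex) = (\<Sum>i\<in>UNIV. of_nat (lookup m i))" by simp
    then show "(\<Sum>i\<in>UNIV. lookup F m * (of_nat (lookup m i) * mfun (lookup m) x))
        = of_nat d * (lookup F m * mfun (lookup m) x)"
      by (simp add: sum_distrib_left sum_distrib_right ac_simps)
  qed
  also have "\<dots> = of_nat d * mp_eval F x" by (simp add: mp_eval_mfun sum_distrib_left)
  finally show ?thesis by simp
qed

lemma directional_derivative:
  "((\<lambda>t. mp_eval F (x + t *s w)) has_field_derivative lform (grad F x) w) (at 0)"
proof -
  have m: "((\<lambda>t. mfun (lookup m) (x + t *s w)) has_field_derivative
      (\<Sum>i\<in>UNIV. of_nat (lookup m i) * mfun (lookup (m - Poly_Mapping.single i 1)) x * w $ i)) (at 0)" for m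
  proof -
    have d: "((\<lambda>t. (x + t *s w) $ i ^ lookup m i) has_field_derivative
        of_nat (lookup m i) * x $ i ^ (lookup m i - 1) * w $ i) (at 0)" for i
      by (auto intro!: derivative_eq_intros)
    have "((\<lambda>t. \<Prod>i\<in>UNIV. (x + t *s w) $ i ^ lookup m i) has_field_derivative
       (\<Sum>i\<in>UNIV. of_nat (lookup m i) * x $ i ^ (lookup m i - 1) * w $ i *
         (\<Prod>j\<in>UNIV - {i}. (x + 0 *s w) $ j ^ lookup m j))) (at 0)"
      by (rule has_field_derivative_prod) (rule d)
    moreover have "(\<lambda>t. mfun (lookup m) (x + t *s w)) = (\<lambda>t. \<Prod>i\<in>UNIV. (x + t *s w) $ i ^ lookup m i)"
      by (simp add: mfun_def)
    ultimately show ?thesis by (simp add: mfun_lower_exponent[simplified] ac_simps)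
  qed
  have "((\<lambda>t. mp_eval F (x + t *s w)) has_field_derivative
     (\<Sum>m\<in>keys F. lookup F m *
       (\<Sum>i\<in>UNIV. of_nat (lookup m i) * mfun (lookup (m - Poly_Mapping.single i 1)) x * w $ i))) (at 0)"
    unfolding mp_eval_mfun by (intro DERIV_sum DERIV_cmult m)
  moreover have "(\<Sum>m\<in>keys F. lookup F m *
       (\<Sum>i\<in>UNIV. of_nat (lookup m i) * mfun (lookup (m - Poly_Mapping.single i 1)) x * w $ i))
     = lform (grad F x) w"
    unfolding lform_def grad_def vec_lambda_beta mp_eval_deriv sum_distrib_left sum_distrib_right
    by (subst sum.swap) (simp add: ac_simps)
  ultimately show ?thesis by simp
qed

lemma grad_scale:
  assumes "homogeneous d F"
  shows "grad F (c *s x) = c ^ (d - 1) *s grad F x"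
  by (simp add: grad_def vec_eq_iff forms_homogeneous[OF mp_deriv_forms[OF assms]])

section \<open>The Zariski topology in terms of cones\<close>

abbreviation pt :: "complex ^ 'n \<Rightarrow> 'n point" where
  "pt \<equiv> proj_class (*s)"

lemma pt_self: "x \<in> pt x"
  unfolding proj_class_def by (auto intro!: exI[of _ 1])

lemma proj_space_eq: "proj_space = pt ` (- {0})"
  by (auto simp: proj_space_def projectivization_def)

definition proj_cone :: "(complex ^ 'n::finite) set \<Rightarrow> 'n point set" where
  "proj_cone C = pt ` C"

lemma pt_subset_acone: "acone C \<Longrightarrow> x \<in> C \<Longrightarrow> pt x \<subseteq> C"
  by (auto simp: proj_class_def intro: acone_scale)

lemma Union_proj_cone: "acone C \<Longrightarrow> \<Union>(proj_cone C) = C"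
  using pt_subset_acone pt_self unfolding proj_cone_def by blast

lemma proj_cone_subset_iff: "acone A \<Longrightarrow> acone B \<Longrightarrow> proj_cone A \<subseteq> proj_cone B \<longleftrightarrow> A \<subseteq> B"
  using Union_proj_cone[of A] Union_proj_cone[of B] by (metis Union_mono image_mono proj_cone_def)

lemma proj_cone_eq_iff: "acone A \<Longrightarrow> acone B \<Longrightarrow> proj_cone A = proj_cone B \<longleftrightarrow> A = B"
  using Union_proj_cone by metis

lemma proj_cone_Un: "proj_cone (A \<union> B) = proj_cone A \<union> proj_cone B"
  by (auto simp: proj_cone_def)

lemma proj_cone_empty_iff: "proj_cone C = {} \<longleftrightarrow> C = {}"
  by (simp add: proj_cone_def)

lemma proj_cone_cone:
  assumes "\<And>f x c. f \<in> S \<Longrightarrow> c \<noteq> 0 \<Longrightarrow> f x = 0 \<Longrightarrow> f (c *s x) = 0"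
  shows "proj_cone (zero_cone S) = {p \<in> proj_space. \<forall>x\<in>p. \<forall>f\<in>S. f x = 0}"
proof
  show "proj_cone (zero_cone S) \<subseteq> {p \<in> proj_space. \<forall>x\<in>p. \<forall>f\<in>S. f x = 0}"
    using assms by (auto simp: proj_cone_def proj_space_eq zero_cone_def proj_class_def)
  show "{p \<in> proj_space. \<forall>x\<in>p. \<forall>f\<in>S. f x = 0} \<subseteq> proj_cone (zero_cone S)"
    using pt_self by (fastforce simp: proj_cone_def proj_space_eq zero_cone_def)
qed

lemma proj_cone_cone_forms:
  assumes "S \<subseteq> (\<Union>d. forms d)"
  shows "proj_cone (zero_cone S) = {p \<in> proj_space. \<forall>x\<in>p. \<forall>f\<in>S. f x = 0}"
proof (rule proj_cone_cone)
  fix f x and c :: complex assume "f \<in> S" "f x = 0"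
  then show "f (c *s x) = 0" using assms forms_homogeneous by (metis UN_E mult_zero_right subsetD)
qed

lemma hypersurface_eq_proj_cone:
  assumes "homogeneous d F"
  shows "hypersurface F = proj_cone (zero_cone {mp_eval F})"
  using proj_cone_cone_forms[of "{mp_eval F}"] mp_eval_forms[OF assms]
  by (auto simp: hypersurface_def)

lemma acone_Un:
  assumes "acone A" "acone B"
  shows "acone (A \<union> B)"
proof -
  obtain S T where S: "S \<subseteq> (\<Union>d. forms d)" "A = zero_cone S" and T: "T \<subseteq> (\<Union>d. forms d)" "B = zero_cone T"
    using assms by (auto simp: acone_def)
  have "A \<union> B = zero_cone {f * g |f g. f \<in> S \<and> g \<in> T}"
  proof
    show "A \<union> B \<subseteq> zero_cone {f * g |f g. f \<in> S \<and> g \<in> T}" by (auto simp: S T zero_cone_def)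
    show "zero_cone {f * g |f g. f \<in> S \<and> g \<in> T} \<subseteq> A \<union> B"
    proof
      fix x assume x: "x \<in> zero_cone {f * g |f g. f \<in> S \<and> g \<in> T}"
      show "x \<in> A \<union> B"
      proof (rule ccontr)
        assume "x \<notin> A \<union> B"
        then obtain f g where "f \<in> S" "g \<in> T" "f x \<noteq> 0" "g x \<noteq> 0" using x by (auto simp: S T zero_cone_def)
        moreover have "(f * g) x = 0" using x \<open>f \<in> S\<close> \<open>g \<in> T\<close> by (auto simp: zero_cone_def simp del: times_fun_apply)
        ultimately show False by simp
      qed
    qed
  qed
  moreover have "{f * g |f g. f \<in> S \<and> g \<in> T} \<subseteq> (\<Union>d. forms d)"
  proof clarify
    fix f g assume "f \<in> S" "g \<in> T"
    then obtain d e where "f \<in> forms d" "g \<in> forms e" using S(1) T(1) by blast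
    then show "f * g \<in> (\<Union>d. forms d)" using forms_mult by blast
  qed
  ultimately show ?thesis unfolding acone_def by blast
qed

lemma acone_cone:
  assumes "f \<in> forms d"
  shows "acone (zero_cone {f})"
proof -
  have "{f} \<subseteq> (\<Union>d. forms d)" using assms by blast
  then show ?thesis unfolding acone_def by (intro exI[of _ "{f}"]) simp
qed

lemma topspace_zariski: "topspace (zariski :: ('n::finite) point topology) = proj_space"
proof -
  have "hypersurface (Poly_Mapping.single 0 1 :: 'n mpoly) = {}"
  proof -
    have "mp_eval (Poly_Mapping.single 0 1 :: 'n mpoly) x = 1" for x
      using mp_eval_single[of 0 1 x] by (simp add: mfun_def)
    moreover have "p \<noteq> {}" if "p \<in> proj_space" for p :: "'n point" using that pt_self by (auto simp: proj_space_eq)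
    ultimately show ?thesis by (auto simp: hypersurface_def)
  qed
  moreover have "homogeneous 0 (Poly_Mapping.single 0 1 :: 'n mpoly)" by (simp add: homogeneous_def)
  ultimately have "proj_space \<in> {proj_space - hypersurface F |(F :: 'n mpoly) d. homogeneous d F}"
    by (intro CollectI exI[of _ "Poly_Mapping.single 0 1"] exI[of _ 0]) simp
  then show ?thesis unfolding zariski_def by auto
qed

lemma proj_cone_subset_proj_space: "acone C \<Longrightarrow> proj_cone C \<subseteq> proj_space"
  using acone_nonzero by (auto simp: proj_cone_def proj_space_eq)

lemma acone_nonzero_vectors: "acone (- {0} :: (complex ^ 'n::finite) set)"
  unfolding acone_def by (rule exI[of _ "{}"]) (auto simp: zero_cone_def)

text \<open>
  Closed sets are obtained from hypersurfaces by finite unions and arbitrary intersections. Cones of zeros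
  of forms are closed under both, finite unions being cut out by products.
\<close>

lemma closedin_zariski_iff:
  "closedin zariski Z \<longleftrightarrow> (\<exists>C. acone C \<and> Z = proj_cone (C :: (complex ^ 'n::finite) set))"
proof
  assume "closedin zariski Z"
  then have op: "openin zariski (proj_space - Z)" and sub: "Z \<subseteq> proj_space"
    by (auto simp: closedin_def topspace_zariski)
  have "\<exists>C. acone C \<and> proj_space - U = proj_cone (C :: (complex ^ 'n) set)"
    if "openin zariski U" for U :: "'n point set"
    using that unfolding zariski_def openin_topology_generated_by_iff
  proof (induction rule: generate_topology_on.induct)
    case Empty
    have "proj_space - {} = proj_cone (- {0} :: (complex ^ 'n) set)" by (auto simp: proj_cone_def proj_space_eq)
    then show ?case using acone_nonzero_vectors by blast
  next
    case (Int a b)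
    then obtain A B :: "(complex ^ 'n) set" where "acone A" "proj_space - a = proj_cone A" "acone B" "proj_space - b = proj_cone B" by blast
    then have "acone (A \<union> B)" "proj_space - a \<inter> b = proj_cone (A \<union> B)"
      by (auto simp: proj_cone_Un Diff_Int acone_Un)
    then show ?case by blast
  next
    case (UN K)
    show ?case
    proof (cases "K = {}")
      case True
      have "proj_space - {} = proj_cone (- {0} :: (complex ^ 'n) set)" by (auto simp: proj_cone_def proj_space_eq)
      then show ?thesis using acone_nonzero_vectors True by auto
    next
      case False
      have "\<forall>k. \<exists>C. k \<in> K \<longrightarrow> acone C \<and> proj_space - k = proj_cone (C :: (complex ^ 'n) set)" using UN.IH by blast
      then obtain C :: "'n point set \<Rightarrow> (complex ^ 'n) set" where C: "\<And>k. k \<in> K \<Longrightarrow> acone (C k)" "\<And>k. k \<in> K \<Longrightarrow> proj_space - k = proj_cone (C k)"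
        unfolding choice_iff by blast
      have ac: "acone (\<Inter>(C ` K))" using C(1) False by (intro acone_Inter) auto
      have "proj_space - \<Union>K = (\<Inter>k\<in>K. proj_cone (C k))" using False C(2) by auto
      also have "\<dots> = proj_cone (\<Inter>(C ` K))"
      proof
        show "proj_cone (\<Inter>(C ` K)) \<subseteq> (\<Inter>k\<in>K. proj_cone (C k))" by (auto simp: proj_cone_def)
        show "(\<Inter>k\<in>K. proj_cone (C k)) \<subseteq> proj_cone (\<Inter>(C ` K))"
        proof
          fix p assume p: "p \<in> (\<Inter>k\<in>K. proj_cone (C k))"
          then obtain x where x: "p = pt x" using False by (auto simp: proj_cone_def)
          have "x \<in> C k" if "k \<in> K" for k
            using p that pt_self[of x] Union_proj_cone[OF C(1)[OF that]] x by blast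
          then show "p \<in> proj_cone (\<Inter>(C ` K))" unfolding x proj_cone_def by blast
        qed
      qed
      finally show ?thesis using ac by blast
    qed
  next
    case (Basis s)
    then obtain F :: "'n mpoly" and d where F: "homogeneous d F" "s = proj_space - hypersurface F" by blast
    have "proj_space - s = hypersurface F" unfolding F(2) by (auto simp: hypersurface_def)
    then show ?case using hypersurface_eq_proj_cone[OF F(1)] acone_cone[OF mp_eval_forms[OF F(1)]] by blast
  qed
  from this[OF op] show "\<exists>C. acone C \<and> Z = proj_cone (C :: (complex ^ 'n) set)"
    using sub by (simp add: double_diff)
next
  assume "\<exists>C. acone C \<and> Z = proj_cone (C :: (complex ^ 'n) set)"
  then obtain S :: "(complex ^ 'n \<Rightarrow> complex) set" where S: "S \<subseteq> (\<Union>d. forms d)" "Z = proj_cone (zero_cone S)" by (auto simp: acone_def)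
  have cl: "closedin zariski (hypersurface F)" if "homogeneous d F" for F :: "'n mpoly" and d
  proof -
    have "openin zariski (proj_space - hypersurface F)"
      unfolding zariski_def openin_topology_generated_by_iff using that by (intro generate_topology_on.Basis) blast
    then show ?thesis unfolding closedin_def topspace_zariski by (auto simp: hypersurface_def)
  qed
  have "closedin zariski (proj_cone (zero_cone {f}))" if f: "f \<in> S" for f
  proof -
    obtain d where "f \<in> forms d" using f S(1) by blast
    then obtain F where "homogeneous d F" "f = mp_eval F" by (rule forms_eq_mp_eval)
    then show ?thesis using cl hypersurface_eq_proj_cone by metis
  qed
  then have "closedin zariski (\<Inter>(insert (topspace zariski) ((\<lambda>f. proj_cone (zero_cone {f})) ` S)))"
    by (intro closedin_Inter) auto
  moreover have "\<Inter>(insert (topspace zariski) ((\<lambda>f. proj_cone (zero_cone {f})) ` S)) = Z"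
  proof -
    have "proj_cone (zero_cone {f}) = {p \<in> proj_space. \<forall>x\<in>p. f x = 0}" if "f \<in> S" for f
      using proj_cone_cone_forms[of "{f}"] S(1) that by auto
    then show ?thesis unfolding S(2) proj_cone_cone_forms[OF S(1)] topspace_zariski by auto
  qed
  ultimately show "closedin zariski Z" by simp
qed

lemma irreducible_proj_cone_iff:
  assumes C: "acone C"
  shows "irreducible_space (subtopology zariski (proj_cone C)) \<longleftrightarrow> irr_cone C"
proof -
  have top: "topspace (subtopology zariski (proj_cone C)) = proj_cone C"
    using proj_cone_subset_proj_space[OF C] by (auto simp: topspace_zariski)
  have clC: "closedin zariski (proj_cone C)" using closedin_zariski_iff C by blast
  have cl: "closedin (subtopology zariski (proj_cone C)) A \<longleftrightarrow> (\<exists>B. acone B \<and> B \<subseteq> C \<and> A = proj_cone B)" for A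
    unfolding closedin_closed_subtopology[OF clC] closedin_zariski_iff
    using proj_cone_subset_iff[OF _ C] by blast
  show ?thesis
    unfolding irreducible_space_def irr_cone_def top cl
  proof (intro iffI conjI allI impI C)
    assume *: "proj_cone C \<noteq> {} \<and> (\<forall>A B. (\<exists>Ba. acone Ba \<and> Ba \<subseteq> C \<and> A = proj_cone Ba) \<and>
         (\<exists>Ba. acone Ba \<and> Ba \<subseteq> C \<and> B = proj_cone Ba) \<and> A \<union> B = proj_cone C \<longrightarrow> A = proj_cone C \<or> B = proj_cone C)"
    then show "C \<noteq> {}" by (simp add: proj_cone_empty_iff)
    fix A B assume AB: "acone A \<and> acone B \<and> A \<union> B = C"
    then have "proj_cone A \<union> proj_cone B = proj_cone C" by (metis proj_cone_Un)
    then have "proj_cone A = proj_cone C \<or> proj_cone B = proj_cone C" using * AB by blast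
    then show "A = C \<or> B = C" using AB C proj_cone_eq_iff by blast
  next
    assume *: "acone C \<and> C \<noteq> {} \<and> (\<forall>A B. acone A \<and> acone B \<and> A \<union> B = C \<longrightarrow> A = C \<or> B = C)"
    then show "proj_cone C \<noteq> {}" by (simp add: proj_cone_empty_iff)
    fix A B assume "(\<exists>Ba. acone Ba \<and> Ba \<subseteq> C \<and> A = proj_cone Ba) \<and>
         (\<exists>Ba. acone Ba \<and> Ba \<subseteq> C \<and> B = proj_cone Ba) \<and> A \<union> B = proj_cone C"
    then obtain A' B' where AB: "acone A'" "A = proj_cone A'" "acone B'" "B = proj_cone B'" "A \<union> B = proj_cone C" by blast
    then have "proj_cone (A' \<union> B') = proj_cone C" by (simp add: proj_cone_Un)
    then have "A' \<union> B' = C" using proj_cone_eq_iff[OF acone_Un[OF AB(1,3)] C] by simp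
    then have "A' = C \<or> B' = C" using * AB(1,3) by blast
    then show "A = proj_cone C \<or> B = proj_cone C" using AB(2,4) by auto
  qed
qed

lemma chain_of_closed_iff:
  assumes X: "acone X"
  shows "(\<exists>Z :: nat \<Rightarrow> ('n::finite) point set. (\<forall>i\<le>m. closedin (subtopology zariski (proj_cone X)) (Z i) \<and>
            irreducible_space (subtopology (subtopology zariski (proj_cone X)) (Z i))) \<and> (\<forall>i<m. Z i \<subset> Z (Suc i)))
    \<longleftrightarrow> (\<exists>C :: nat \<Rightarrow> (complex ^ 'n) set. (\<forall>i\<le>m. irr_cone (C i)) \<and> (\<forall>i<m. C i \<subset> C (Suc i)) \<and> C m \<subseteq> X)"
    (is "?L \<longleftrightarrow> ?R")
proof
  have clX: "closedin zariski (proj_cone X)" using closedin_zariski_iff X by blast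
  have cl: "closedin (subtopology zariski (proj_cone X)) A \<longleftrightarrow> (\<exists>B. acone B \<and> B \<subseteq> X \<and> A = proj_cone B)" for A
    unfolding closedin_closed_subtopology[OF clX] closedin_zariski_iff
    using proj_cone_subset_iff[OF _ X] by blast
  have sub: "subtopology (subtopology zariski (proj_cone X)) (proj_cone C) = subtopology zariski (proj_cone C)"
    if "C \<subseteq> X" for C
  proof -
    have "proj_cone X \<inter> proj_cone C = proj_cone C" using that by (auto simp: proj_cone_def)
    then show ?thesis by (simp add: subtopology_subtopology)
  qed
  {
    assume ?L
    then obtain Z where Z: "\<And>i. i \<le> m \<Longrightarrow> closedin (subtopology zariski (proj_cone X)) (Z i)"
      "\<And>i. i \<le> m \<Longrightarrow> irreducible_space (subtopology (subtopology zariski (proj_cone X)) (Z i))"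
      "\<And>i. i < m \<Longrightarrow> Z i \<subset> Z (Suc i)" by blast
    have "\<forall>i. \<exists>C. i \<le> m \<longrightarrow> acone C \<and> C \<subseteq> X \<and> Z i = proj_cone C" using Z(1) unfolding cl by blast
    then obtain C where C: "\<And>i. i \<le> m \<Longrightarrow> acone (C i)" "\<And>i. i \<le> m \<Longrightarrow> C i \<subseteq> X" "\<And>i. i \<le> m \<Longrightarrow> Z i = proj_cone (C i)"
      unfolding choice_iff by blast
    have "irr_cone (C i)" if "i \<le> m" for i
      using Z(2)[OF that] unfolding C(3)[OF that] sub[OF C(2)[OF that]] irreducible_proj_cone_iff[OF C(1)[OF that]] .
    moreover have "C i \<subset> C (Suc i)" if "i < m" for i
      using Z(3)[OF that] C(3)[of i] C(3)[of "Suc i"] proj_cone_subset_iff[OF C(1) C(1), of i "Suc i"] that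
      by (auto simp: psubset_eq)
    ultimately show ?R using C(2)[of m] by blast
  next
    assume ?R
    then obtain C where C: "\<And>i. i \<le> m \<Longrightarrow> irr_cone (C i)" "\<And>i. i < m \<Longrightarrow> C i \<subset> C (Suc i)" "C m \<subseteq> X" by blast
    have aC: "acone (C i)" if "i \<le> m" for i using C(1)[OF that] by (simp add: irr_cone_def)
    have CX: "C i \<subseteq> X" if "i \<le> m" for i
      using that
    proof (induction rule: inc_induct)
      case base
      show ?case by (rule C(3))
    next
      case (step i)
      then show ?case using C(2)[of i] by blast
    qed
    show ?L
    proof (intro exI[of _ "\<lambda>i. proj_cone (C i)"] conjI allI impI)
      fix i assume i: "i \<le> m"
      show "closedin (subtopology zariski (proj_cone X)) (proj_cone (C i))"
        unfolding cl using aC[OF i] CX[OF i] by blast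
      show "irreducible_space (subtopology (subtopology zariski (proj_cone X)) (proj_cone (C i)))"
        unfolding sub[OF CX[OF i]] irreducible_proj_cone_iff[OF aC[OF i]] by (rule C(1)[OF i])
    next
      fix i assume i: "i < m"
      then have "acone (C i)" "acone (C (Suc i))" using aC by auto
      then show "proj_cone (C i) \<subset> proj_cone (C (Suc i))"
        using C(2)[OF i] proj_cone_subset_iff proj_cone_eq_iff by (metis psubset_eq)
    qed
  }
qed

text \<open>
  A chain longer than \<open>k + 1\<close> is as good as one of length \<open>k + 1\<close>, since its top member meets even smaller linear
  subspaces.
\<close>

theorem thick_iff_krull_dim:
  fixes X :: "(complex ^ 'n::finite) set"
  assumes X: "acone X" "X \<noteq> {}"
  shows "thick k X \<longleftrightarrow> enat k \<le> krull_dim (subtopology zariski (proj_cone X))"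
proof
  assume "thick k X"
  then have "\<exists>C :: nat \<Rightarrow> (complex ^ 'n) set. (\<forall>i\<le>k. irr_cone (C i)) \<and> (\<forall>i<k. C i \<subset> C (Suc i)) \<and> C k \<subseteq> X"
    by (rule thick_imp_irreducible_chain[OF X(1)])
  then show "enat k \<le> krull_dim (subtopology zariski (proj_cone X))"
    unfolding krull_dim_def chain_of_closed_iff[OF X(1)] by (intro Sup_upper) blast
next
  assume le: "enat k \<le> krull_dim (subtopology zariski (proj_cone X))"
  show "thick k X"
  proof (cases k)
    \<comment> \<open>The inequality is void here, and \<open>X\<close> being nonempty replaces the chain.\<close>
    case 0
    then show ?thesis using X(2) by (auto simp: thick_def)
  next
    case (Suc j)
    have "\<exists>m\<ge>k. \<exists>C :: nat \<Rightarrow> (complex ^ 'n) set. (\<forall>i\<le>m. irr_cone (C i)) \<and> (\<forall>i<m. C i \<subset> C (Suc i)) \<and> C m \<subseteq> X"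
    proof (rule ccontr)
      assume no: "\<not> ?thesis"
      have "krull_dim (subtopology zariski (proj_cone X)) \<le> enat j"
        unfolding krull_dim_def chain_of_closed_iff[OF X(1)]
      proof (rule Sup_least)
        fix e assume "e \<in> {enat m |m. \<exists>C :: nat \<Rightarrow> (complex ^ 'n) set. (\<forall>i\<le>m. irr_cone (C i)) \<and> (\<forall>i<m. C i \<subset> C (Suc i)) \<and> C m \<subseteq> X}"
        then obtain m where "e = enat m" "\<not> m \<ge> k" using no by blast
        then show "e \<le> enat j" using Suc by simp
      qed
      then show False using le Suc by (simp add: order.trans[of "enat (Suc j)" _ "enat j"]) (metis enat_ord_simps(1) not_less_eq_eq order_refl order_trans)
    qed
    then obtain m and C :: "nat \<Rightarrow> (complex ^ 'n) set" where m: "m \<ge> k" and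
      C: "\<And>i. i \<le> m \<Longrightarrow> irr_cone (C i)" "\<And>i. i < m \<Longrightarrow> C i \<subset> C (Suc i)" "C m \<subseteq> X" by blast
    show ?thesis
      unfolding thick_def
    proof
      fix l
      obtain x where x: "x \<in> C m" "\<And>j. j < m \<Longrightarrow> lform (l j) x = 0"
        using irreducible_chain_meets_linear_section[of m C l] C(1,2) by blast
      then show "\<exists>x\<in>X. \<forall>j<k. lform (l j) x = 0" using C(3) m by (intro bexI[of _ x]) auto
    qed
  qed
qed

section \<open>Singular points and tangent spaces\<close>

definition sing_cone :: "('n::finite) mpoly \<Rightarrow> (complex ^ 'n) set" where
  "sing_cone F = {x. x \<noteq> 0 \<and> (\<forall>i. mp_eval (mp_deriv i F) x = 0)}"

lemma sing_cone_eq_cone: "sing_cone F = zero_cone (range (\<lambda>i. mp_eval (mp_deriv i F)))"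
  by (auto simp: sing_cone_def zero_cone_def)

lemma acone_sing_cone:
  assumes "homogeneous d F"
  shows "acone (sing_cone F)"
proof -
  have "range (\<lambda>i. mp_eval (mp_deriv i F)) \<subseteq> (\<Union>d. forms d)" using mp_deriv_forms[OF assms] by blast
  then show ?thesis
    unfolding acone_def sing_cone_eq_cone by (intro exI[of _ "range (\<lambda>i. mp_eval (mp_deriv i F))"]) simp
qed

lemma Sing_eq_proj_cone:
  assumes "homogeneous d F"
  shows "Sing F = proj_cone (sing_cone F)"
  unfolding sing_cone_eq_cone using mp_deriv_forms[OF assms]
  by (subst proj_cone_cone_forms) (auto simp: Sing_def)

lemma sgr_le_iff_thick:
  fixes F :: "('n::finite) mpoly"
  assumes F: "homogeneous d F" and r: "r + 1 \<le> CARD('n)"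
  shows "sgr F \<le> enat r \<longleftrightarrow> thick (CARD('n) - 1 - r) (sing_cone F)"
proof (cases "sing_cone F = {}")
  case True
  then have "sgr F = enat CARD('n)"
    by (simp add: sgr_def proj_codim_def Sing_eq_proj_cone[OF F] proj_cone_empty_iff)
  then show ?thesis using r True by (auto simp: thick_def)
next
  case False
  have "sgr F = enat (CARD('n) - 1) - krull_dim (subtopology zariski (proj_cone (sing_cone F)))"
    using False by (simp add: sgr_def proj_codim_def Sing_eq_proj_cone[OF F] proj_cone_empty_iff)
  moreover have "enat a - K \<le> enat r \<longleftrightarrow> enat (a - r) \<le> K" for a K
    by (cases K) auto
  ultimately show ?thesis
    using thick_iff_krull_dim[OF acone_sing_cone[OF F] False] by simp
qed

text \<open>
  The condition that the point lies on the hypersurface follows from Euler's identity, as the point itself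
  is one of the directions along \<open>l\<close>.
\<close>

lemma tangent_to_iff:
  fixes F :: "('n::finite) mpoly"
  assumes F: "homogeneous d F" "d \<ge> 1" and W: "vec.subspace W"
  shows "tangent_to F (projectivization (*s) W) \<longleftrightarrow>
     (\<exists>x\<in>W. x \<noteq> 0 \<and> (\<forall>w\<in>W. lform (grad F x) w = 0))"
proof -
  define l where "l = projectivization (*s) W"
  have l: "l = pt ` (W - {0})" by (auto simp: l_def projectivization_def)
  have scale: "c *s x \<in> W" if "x \<in> W" for c x using W that by (rule vec.subspace_scale)
  have Ul: "\<Union>l = W - {0}"
    unfolding l using scale pt_self by (fastforce simp: proj_class_def)
  have der: "((\<lambda>t. mp_eval F (x + t *s w)) has_field_derivative 0) (at 0) \<longleftrightarrow> lform (grad F x) w = 0" for x w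
    using directional_derivative[of F x w] DERIV_unique by (metis)
  show ?thesis unfolding l_def[symmetric]
  proof
    assume "tangent_to F l"
    then obtain p where p: "p \<in> l" "\<And>x w. x \<in> p \<Longrightarrow> w \<in> \<Union>l \<Longrightarrow> lform (grad F x) w = 0"
      unfolding tangent_to_def der by blast
    then obtain x where x: "x \<in> W" "x \<noteq> 0" "p = pt x" unfolding l by blast
    have "lform (grad F x) w = 0" if "w \<in> W" for w
      using p(2)[of x w] pt_self[of x] x(3) Ul that by (cases "w = 0") auto
    then show "\<exists>x\<in>W. x \<noteq> 0 \<and> (\<forall>w\<in>W. lform (grad F x) w = 0)" using x by blast
  next
    assume "\<exists>x\<in>W. x \<noteq> 0 \<and> (\<forall>w\<in>W. lform (grad F x) w = 0)"
    then obtain x where x: "x \<in> W" "x \<noteq> 0" "\<And>w. w \<in> W \<Longrightarrow> lform (grad F x) w = 0" by blast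
    have "mp_eval F x = 0" using euler_identity[OF F(1), of x] x(3)[OF x(1)] F(2) by simp
    then have "mp_eval F y = 0" if "y \<in> pt x" for y
      using that forms_homogeneous[OF mp_eval_forms[OF F(1)]] by (auto simp: proj_class_def)
    then have "pt x \<in> hypersurface F \<inter> l" using x by (auto simp: hypersurface_def proj_space_eq l)
    moreover have "lform (grad F y) w = 0" if "y \<in> pt x" "w \<in> \<Union>l" for y w
      using that x(3) by (auto simp: proj_class_def grad_scale[OF F(1)] lform_scale_left Ul)
    ultimately show "tangent_to F l" unfolding tangent_to_def der by blast
  qed
qed

text \<open>
  For \<open>r \<ge> CARD('n)\<close> both sides hold trivially; otherwise both express that the singular cone meets
  every subspace of dimension \<open>r + 1\<close>.
\<close>

lemma sgr_le_iff_tangent_to_all: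
  fixes F :: "('n::finite) mpoly"
  assumes F: "homogeneous d F" "F \<noteq> 0" and d: "d \<ge> 2" and r: "r \<ge> 1"
  shows "sgr F \<le> enat r \<longleftrightarrow> (\<forall>l. proj_linear_subspace r l \<longrightarrow> tangent_to F l)"
proof (cases "r + 1 \<le> CARD('n)")
  case False
  have "sgr F \<le> enat CARD('n)"
  proof -
    have "enat a - K \<le> enat a" for a K by (cases K) auto
    then have "enat (CARD('n) - 1) - K \<le> enat (CARD('n))" for K
      by (metis enat_ord_simps(1) diff_le_self order_trans)
    then show ?thesis by (simp add: sgr_def proj_codim_def)
  qed
  also have "enat CARD('n) \<le> enat r" using False by simp
  finally have "sgr F \<le> enat r" .
  moreover have "\<not> proj_linear_subspace r l" for l :: "'n point set"
  proof
    assume "proj_linear_subspace r l"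
    then obtain W :: "(complex ^ 'n) set" where "vec.dim W = r + 1" by (auto simp: proj_linear_subspace_def)
    moreover have "vec.dim W \<le> vec.dim (UNIV :: (complex ^ 'n) set)" by (rule vec.dim_subset) simp
    ultimately show False using False by (simp only: vec_dim_card)
  qed
  ultimately show ?thesis by blast
next
  case True
  define k where "k = CARD('n) - 1 - r"
  have k: "r + 1 + k = CARD('n)" using True by (simp add: k_def)
  have "thick k (sing_cone F) \<longleftrightarrow> (\<forall>l. proj_linear_subspace r l \<longrightarrow> tangent_to F l)"
  proof (intro iffI allI impI)
    fix l :: "'n point set" assume th: "thick k (sing_cone F)" and "proj_linear_subspace r l"
    then obtain W :: "(complex ^ 'n) set" where W: "vec.subspace W" "vec.dim W = r + 1" "l = projectivization (*s) W"
      by (auto simp: proj_linear_subspace_def)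
    have "vec.dim W + k = CARD('n)" using W(2) k by simp
    then obtain h where h: "\<And>x. (\<And>j. j < k \<Longrightarrow> lform (h j) x = 0) \<Longrightarrow> x \<in> W"
      using subspace_contains_linear_section[OF W(1)] by metis
    obtain x where x: "x \<in> sing_cone F" "\<And>j. j < k \<Longrightarrow> lform (h j) x = 0" using th unfolding thick_def by blast
    have "grad F x = 0" using x(1) by (simp add: grad_def sing_cone_def vec_eq_iff)
    then have "x \<in> W \<and> x \<noteq> 0 \<and> (\<forall>w\<in>W. lform (grad F x) w = 0)"
      using h[OF x(2)] x(1) by (simp add: sing_cone_def)
    then show "tangent_to F l" using tangent_to_iff[OF F(1) _ W(1)] d unfolding W(3) by auto
  next
    assume tan: "\<forall>l. proj_linear_subspace r l \<longrightarrow> tangent_to F l"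
    show "thick k (sing_cone F)"
    proof (rule ccontr)
      assume thin: "\<not> thick k (sing_cone F)"
      have "\<exists>W. vec.subspace W \<and> vec.dim W + k = CARD('n) \<and>
          (\<forall>x\<in>W. x \<noteq> 0 \<longrightarrow> (\<exists>w\<in>W. lform (\<chi> i. mp_eval (mp_deriv i F) x) w \<noteq> 0))"
      proof (rule exists_transversal_linear_section[OF d mp_eval_forms[OF F(1)] mp_deriv_forms[OF F(1)]])
        show "of_nat d * mp_eval F x = lform (\<chi> i. mp_eval (mp_deriv i F) x) x" for x
          using euler_identity[OF F(1)] by (simp add: grad_def)
        show "\<exists>u. mp_eval F u \<noteq> 0" by (rule nonzero_form_has_nonzero_value[OF F])
        show "k + 2 \<le> CARD('n)" using k r by simp
        show "\<not> thick k {x. x \<noteq> 0 \<and> (\<forall>i. mp_eval (mp_deriv i F) x = 0)}" using thin by (simp add: sing_cone_def)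
      qed
      then obtain W where W: "vec.subspace W" "vec.dim W + k = CARD('n)"
        "\<And>x. x \<in> W \<Longrightarrow> x \<noteq> 0 \<Longrightarrow> \<exists>w\<in>W. lform (grad F x) w \<noteq> 0" unfolding grad_def by blast
      have "vec.dim W = r + 1" using W(2) k by simp
      then have "proj_linear_subspace r (projectivization (*s) W)" using W(1) unfolding proj_linear_subspace_def by blast
      then have "tangent_to F (projectivization (*s) W)" using tan by blast
      then show False using tangent_to_iff[OF F(1) _ W(1)] d W(3) by auto
    qed
  qed
  then show ?thesis using sgr_le_iff_thick[OF F(1) True] by (simp add: k_def)
qed

lemma tangent_to_scale:
  assumes "tangent_to F l"
  shows "tangent_to (mp_scale c F) l"
proof -
  obtain p where p: "p \<in> hypersurface F \<inter> l"
    "\<And>x w. x \<in> p \<Longrightarrow> w \<in> \<Union>l \<Longrightarrow> ((\<lambda>t. mp_eval F (x + t *s w)) has_field_derivative 0) (at 0)"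
    using assms unfolding tangent_to_def by blast
  have "p \<in> hypersurface (mp_scale c F) \<inter> l" using p(1) by (auto simp: hypersurface_def mp_eval_scale)
  moreover have "((\<lambda>t. mp_eval (mp_scale c F) (x + t *s w)) has_field_derivative 0) (at 0)" if "x \<in> p" "w \<in> \<Union>l" for x w
    using DERIV_cmult[OF p(2)[OF that], of c] by (simp add: mp_eval_scale)
  ultimately show ?thesis unfolding tangent_to_def by blast
qed

lemma mp_class_eqD:
  assumes "proj_class mp_scale F = proj_class mp_scale G"
  obtains c where "F = mp_scale c G"
proof -
  have "mp_scale 1 F = F" by (rule poly_mapping_eqI) (simp add: lookup_mp_scale)
  then have "F \<in> proj_class mp_scale F" unfolding proj_class_def by (auto intro!: exI[of _ 1])
  then show thesis using that unfolding assms by (auto simp: proj_class_def)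
qed

text \<open>
  Tangency does not depend on the representative of a class of forms.
\<close>

lemma in_tangent_locus_iff:
  assumes "homogeneous d F" "F \<noteq> 0"
  shows "proj_class mp_scale F \<in> tangent_locus d l \<longleftrightarrow> tangent_to F l"
proof
  assume "proj_class mp_scale F \<in> tangent_locus d l"
  then obtain G where "proj_class mp_scale F = proj_class mp_scale G" "tangent_to G l" by (auto simp: tangent_locus_def)
  then show "tangent_to F l" using mp_class_eqD tangent_to_scale by metis
next
  assume "tangent_to F l"
  then show "proj_class mp_scale F \<in> tangent_locus d l" using assms unfolding tangent_locus_def by blast
qed

theorem theorem4p3:
  fixes n d r :: nat
  assumes "CARD('n::finite) = n + 1"
    and "d \<ge> 3" and "r \<ge> 1" and "n \<ge> 1"
  shows "(sgr_locus d r :: 'n mpoly set set) =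
           proj_forms d \<inter> (\<Inter>l \<in> {l. proj_linear_subspace r l}. tangent_locus d l)"
proof -
  have key: "sgr F \<le> enat r \<longleftrightarrow> (\<forall>l. proj_linear_subspace r l \<longrightarrow> tangent_to F l)"
    if "homogeneous d F" "F \<noteq> 0" for F :: "'n mpoly"
    using sgr_le_iff_tangent_to_all[OF that] assms(2,3) by simp
  show ?thesis
  proof (intro set_eqI iffI)
    fix P :: "'n mpoly set" assume "P \<in> sgr_locus d r"
    then obtain F where F: "P = proj_class mp_scale F" "F \<noteq> 0" "homogeneous d F" "sgr F \<le> enat r"
      by (auto simp: sgr_locus_def)
    then have "P \<in> proj_forms d" unfolding proj_forms_def projectivization_def by blast
    then show "P \<in> proj_forms d \<inter> (\<Inter>l \<in> {l. proj_linear_subspace r l}. tangent_locus d l)"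
      using key[OF F(3,2)] F(4) in_tangent_locus_iff[OF F(3,2)] by (auto simp: F(1))
  next
    fix P :: "'n mpoly set" assume P: "P \<in> proj_forms d \<inter> (\<Inter>l \<in> {l. proj_linear_subspace r l}. tangent_locus d l)"
    then obtain F where F: "P = proj_class mp_scale F" "F \<noteq> 0" "homogeneous d F"
      by (auto simp: proj_forms_def projectivization_def)
    have "sgr F \<le> enat r"
      using P key[OF F(3,2)] in_tangent_locus_iff[OF F(3,2)] by (auto simp: F(1))
    then show "P \<in> sgr_locus d r" using F unfolding sgr_locus_def by blast
  qed
qed

end
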